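(* Let $B=\begin{pmatrix} b_1^1 & b_2^1\\ b_1^2 & b_2^2\end{pmatrix}$ be a $2\times 2$ integer matrix with $\det(B)>0$ such that the domain $$\mathcal{U}=\left\{(z_1,z_2)\in\mathbb{C}^2 : |z_1|^{b_1^1}|z_2|^{b_2^1}<1,\ |z_1|^{b_1^2}|z_2|^{b_2^2}<1\right\}$$ is bounded. Define the integer matrix $$A=\begin{pmatrix} a_1^1 & a_2^1\\ a_1^2 & a_2^2\end{pmatrix}=\begin{pmatrix} \dfrac{b_2^2}{\gcd(b_2^2,b_1^2)} & \dfrac{-b_2^1}{\gcd(b_2^1,b_1^1)}\\[2ex] \dfrac{-b_1^2}{\gcd(b_2^2,b_1^2)} & \dfrac{b_1^1}{\gcd(b_2^1,b_1^1)}\end{pmatrix}.$$ Then there is a polynomial $g(t_1,t_2)\in\mathbb{Z}[t_1,t_2]$ with integer coefficients such that the Bergman kernel of $\mathcal{U}$ is given, for all $z,w\in\mathcal{U}$, by $$K_{\mathcal{U}}(z,w)=\frac{1}{\pi^2\det(A)}\cdot\frac{g(t_1,t_2)}{\left(t_2^{a_2^1}-t_1^{a_2^2}\right)^2\left(t_1^{a_1^2}-t_2^{a_1^1}\right)^2},\qquad t_j=z_j\overline{w_j},\ j=1,2.$$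
   Context: For an integer $2\times 2$ matrix, superscripts index rows and subscripts index columns: $b_j^i$ is the entry in row $i$ and column $j$ (superscripts on matrix entries are not powers). The expression $0^0$ is read as $1$, and a point at which a zero coordinate carries a negative exponent in one of the defining inequalities is not in $\mathcal{U}$. The Bergman kernel $K_\Omega(z,w)$ of a domain $\Omega\subset\mathbb{C}^2$ is the reproducing kernel of the Hilbert space of holomorphic functions on $\Omega$ that are square integrable with respect to Lebesgue measure; it is holomorphic in $z$ and antiholomorphic in $w$. $\gcd$ denotes the positive greatest common divisor. *)

theory Defs
  imports "HOL-Analysis.Analysis" "HOL-Computational_Algebra.Polynomial"
begin

text \<open>
  The entry \<open>b\<^sub>j\<^sup>i\<close> (row \<open>i\<close>, column \<open>j\<close>) of a matrix \<open>B\<close> is \<open>B $ i $ j\<close>. Since \<open>0 powi n = 0\<close> for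
  negative \<open>n\<close>, points at which a zero coordinate carries a negative exponent are excluded explicitly;
  \<open>0 powi 0 = 1\<close> is the intended convention.
\<close>

definition monomial_polyhedron :: "int^2^2 \<Rightarrow> (complex \<times> complex) set" where
  "monomial_polyhedron B =
     {(z1, z2). \<forall>i. (z1 = 0 \<longrightarrow> B $ i $ 1 \<ge> 0) \<and> (z2 = 0 \<longrightarrow> B $ i $ 2 \<ge> 0) \<and>
                    cmod z1 powi (B $ i $ 1) * cmod z2 powi (B $ i $ 2) < 1}"

text \<open>
  Holomorphy in two variables on an open set: at every point the real Frechet derivative exists
  and is complex linear.
\<close>

definition holomorphic2_on :: "(complex \<times> complex \<Rightarrow> complex) \<Rightarrow> (complex \<times> complex) set \<Rightarrow> bool"
    (infixl "holomorphic2'_on" 50) where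
  "f holomorphic2_on \<Omega> \<longleftrightarrow>
     (\<forall>z\<in>\<Omega>. \<exists>a b. (f has_derivative (\<lambda>(h, k). a * h + b * k)) (at z))"

definition bergman_space :: "(complex \<times> complex) set \<Rightarrow> (complex \<times> complex \<Rightarrow> complex) set" where
  "bergman_space \<Omega> =
     {f. f holomorphic2_on \<Omega> \<and> set_integrable lborel \<Omega> (\<lambda>z. (cmod (f z))\<^sup>2)}"

definition is_bergman_kernel ::
    "(complex \<times> complex) set \<Rightarrow> (complex \<times> complex \<Rightarrow> complex \<times> complex \<Rightarrow> complex) \<Rightarrow> bool" where
  "is_bergman_kernel \<Omega> K \<longleftrightarrow>
     (\<forall>w\<in>\<Omega>. (\<lambda>z. K z w) \<in> bergman_space \<Omega> \<and>
            (\<forall>f\<in>bergman_space \<Omega>. f w = (LINT z:\<Omega>|lborel. f z * cnj (K z w))))"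

text \<open>
  The values of the kernel are only meaningful on \<open>\<Omega> \<times> \<Omega>\<close>, where they are determined uniquely
  by the reproducing property.
\<close>

definition bergman_kernel ::
    "(complex \<times> complex) set \<Rightarrow> complex \<times> complex \<Rightarrow> complex \<times> complex \<Rightarrow> complex" where
  "bergman_kernel \<Omega> = (SOME K. is_bergman_kernel \<Omega> K)"

lemma is_bergman_kernel_cnj:
  assumes K: "is_bergman_kernel \<Omega> K" and L: "is_bergman_kernel \<Omega> L"
    and z: "z \<in> \<Omega>" and w: "w \<in> \<Omega>"
  shows "L z w = cnj (K w z)"
proof -
  have "cnj (K w z) = cnj (LINT x:\<Omega>|lborel. K x z * cnj (L x w))"
    using K L z w by (simp add: is_bergman_kernel_def)
  also have "\<dots> = (LINT x:\<Omega>|lborel. L x w * cnj (K x z))"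
    unfolding set_lebesgue_integral_def Bochner_Integration.integral_cnj [symmetric]
    by (simp add: mult.commute del: Bochner_Integration.integral_cnj)
  also have "\<dots> = L z w"
    using K L z w by (simp add: is_bergman_kernel_def)
  finally show ?thesis by simp
qed

lemma bergman_kernel_eqI:
  assumes "is_bergman_kernel \<Omega> K" and "z \<in> \<Omega>" and "w \<in> \<Omega>"
  shows "bergman_kernel \<Omega> z w = K z w"
proof -
  have "is_bergman_kernel \<Omega> (bergman_kernel \<Omega>)"
    unfolding bergman_kernel_def using someI [of "is_bergman_kernel \<Omega>"] assms(1) by blast
  then show ?thesis
    using is_bergman_kernel_cnj assms by metis
qed

text \<open>
  \<open>int poly poly\<close> represents \<open>\<int>[t\<^sub>1][t\<^sub>2]\<close>: the inner variable is \<open>t\<^sub>1\<close>, the outer one \<open>t\<^sub>2\<close>.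
\<close>

definition eval_int_poly2 :: "int poly poly \<Rightarrow> complex \<Rightarrow> complex \<Rightarrow> complex" where
  "eval_int_poly2 g t1 t2 = poly (map_poly (\<lambda>c. poly (map_poly of_int c) t1) g) t2"

end

theory Submission
  imports Defs "HOL-Complex_Analysis.Cauchy_Integral_Theorem"
begin

text \<open>
  Put \<open>p = a\<^sub>2\<^sup>2\<close>, \<open>q = a\<^sub>2\<^sup>1\<close>, \<open>r = a\<^sub>1\<^sup>1\<close>, \<open>s = a\<^sub>1\<^sup>2\<close>. In logarithmic coordinates the domain is the cone
  \<open>B x < 0\<close>, so boundedness forces the inverse of \<open>B\<close> to have nonnegative entries
  (\<open>bounded_monomial_polyhedron_signs\<close>). Hence these four exponents are nonnegative, and the domain is
  the Reinhardt domain \<open>|z\<^sub>1|\<^sup>p < |z\<^sub>2|\<^sup>q\<close>, \<open>|z\<^sub>2|\<^sup>r < |z\<^sub>1|\<^sup>s\<close> with \<open>d = p r - q s = det A > 0\<close>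
  (\<open>monomial_polyhedron_eq_wedge\<close>).

  On such a domain the Laurent monomials are orthogonal. Integrating over the cone gives
  \<open>\<parallel>z\<^sup>m\<parallel>\<^sup>2 = \<pi>\<^sup>2 d / (\<alpha>(m) \<beta>(m))\<close>, where \<open>\<alpha>(m)\<close> and \<open>\<beta>(m)\<close> are the pairings of \<open>m + (1, 1)\<close> with the two
  columns of \<open>A\<close>; the norm is infinite unless both are positive (\<open>nn_integral_zmon\<close>). With
  \<open>t\<^sub>j = z\<^sub>j cnj w\<^sub>j\<close> the kernel must therefore be the sum of \<open>\<alpha>(m) \<beta>(m) t\<^sup>m / (\<pi>\<^sup>2 d)\<close> over all \<open>m\<close> with
  \<open>\<alpha>(m), \<beta>(m) > 0\<close>. Adding \<open>(p, - q)\<close> to \<open>m\<close> raises \<open>\<alpha>\<close> by \<open>d\<close> and fixes \<open>\<beta>\<close>, while adding \<open>(- s, r)\<close> does the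
  opposite. So the sum splits into finitely many products of two series
  \<open>\<Sum>k. (a + k d) x\<^sup>k = (a + (d - a) x) / (1 - x)\<^sup>2\<close>, one product for each \<open>m\<close> with \<open>\<alpha>(m), \<beta>(m)\<close> in
  \<open>{1..d}\<close>, with ratios \<open>t\<^sub>1\<^sup>p / t\<^sub>2\<^sup>q\<close> and \<open>t\<^sub>2\<^sup>r / t\<^sub>1\<^sup>s\<close>. Clearing denominators yields the stated quotient; the
  bounds \<open>\<alpha>, \<beta> \<le> d\<close> make the remaining exponents nonnegative, so the numerator is a polynomial
  (\<open>kernel_term_closed_form\<close>).

  That this sum reproduces an arbitrary \<open>f\<close> in the Bergman space is shown by Fourier analysis on the
  torus, which acts on the domain by rotations and preserves Lebesgue measure. The torus average of
  \<open>f\<close> against a character is a multiple of one monomial (\<open>laurent_coefficient\<close>), and this monomial is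
  square integrable if the multiple is not zero (\<open>laurent_coefficient_L2\<close>). The kernel reproduces
  the square integrable monomials (\<open>integral_zmon_kernel\<close>). Hence for fixed \<open>w\<close> the functions
  \<open>e \<mapsto> f(e w)\<close> and \<open>e \<mapsto> \<integral> f(z) cnj (K(z, e w))\<close> on the torus have the same Fourier coefficients. Both
  are continuous, so they agree (\<open>fourier_null_imp_zero\<close>). Points on the coordinate axes are reached
  by continuity.
\<close>

section \<open>Rotations preserve Lebesgue measure\<close>

lemma lborel_complex_eq_distr:
  "(lborel :: complex measure) = distr (lborel \<Otimes>\<^sub>M lborel) borel (\<lambda>(x, y). Complex x y)"
proof (rule lborel_eqI)
  fix l u :: complex
  assume le: "\<And>b. b \<in> Basis \<Longrightarrow> l \<bullet> b \<le> u \<bullet> b"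
  have le': "Re l \<le> Re u" "Im l \<le> Im u"
    using le[of 1] le[of \<i>] by (auto simp: Basis_complex_def)
  have [measurable]: "(\<lambda>(x, y). Complex x y) \<in> borel_measurable (lborel \<Otimes>\<^sub>M (lborel :: real measure))"
    unfolding lborel_prod Complex_eq split_beta
    by (auto intro!: borel_measurable_continuous_onI continuous_intros)
  have "(\<lambda>(x, y). Complex x y) -` box l u = {Re l<..<Re u} \<times> {Im l<..<Im u}"
    by (auto simp: box_def Basis_complex_def)
  then show "emeasure (distr (lborel \<Otimes>\<^sub>M lborel) borel (\<lambda>(x, y). Complex x y)) (box l u)
      = (\<Prod>b\<in>Basis. (u - l) \<bullet> b)"
    using le' by (subst emeasure_distr)
      (auto simp: space_pair_measure lborel.emeasure_pair_measure_Times Basis_complex_def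
        ennreal_mult)
qed simp

text \<open>On every horizontal line a shear is a translation.\<close>

lemma lborel_shear_invariant:
  fixes a :: real
  shows "distr (lborel \<Otimes>\<^sub>M lborel) (lborel \<Otimes>\<^sub>M lborel) (\<lambda>(x, y). (x + a * y, y)) = lborel \<Otimes>\<^sub>M lborel"
    (is "?M = _")
proof -
  have meas: "(\<lambda>(x, y). (x + a * y, y)) \<in> (lborel \<Otimes>\<^sub>M (lborel :: real measure)) \<rightarrow>\<^sub>M (lborel \<Otimes>\<^sub>M lborel)"
    by (auto simp: split_beta intro!: measurable_Pair)
  show ?thesis
  proof (rule measure_eqI)
    fix A assume "A \<in> sets ?M"
    then have A [measurable]: "A \<in> sets (lborel \<Otimes>\<^sub>M (lborel :: real measure))" by simp
    have "emeasure ?M A = (\<integral>\<^sup>+z. indicator A z \<partial>?M)"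
      using A by simp
    also have "\<dots> = (\<integral>\<^sup>+z. indicator A ((\<lambda>(x, y). (x + a * y, y)) z) \<partial>(lborel \<Otimes>\<^sub>M lborel))"
      by (rule nn_integral_distr[OF meas]) simp
    also have "\<dots> = (\<integral>\<^sup>+y. \<integral>\<^sup>+x. indicator A (x + a * y, y) \<partial>lborel \<partial>lborel)"
      by (subst lborel_pair.nn_integral_snd[symmetric])
         (auto intro!: borel_measurable_indicator' measurable_sets[OF _ A])
    also have "\<dots> = (\<integral>\<^sup>+y. \<integral>\<^sup>+x. indicator A (x, y) \<partial>lborel \<partial>lborel)"
    proof (rule nn_integral_cong)
      fix y :: real
      show "(\<integral>\<^sup>+x. indicator A (x + a * y, y) \<partial>lborel) = (\<integral>\<^sup>+x. indicator A (x, y) \<partial>lborel)"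
        using nn_integral_real_affine[of "\<lambda>x. indicator A (x, y)" 1 "a * y"]
        by (simp add: add.commute)
    qed
    also have "\<dots> = emeasure (lborel \<Otimes>\<^sub>M lborel) A"
      by (subst lborel_pair.nn_integral_snd) (simp_all add: nn_integral_indicator[OF A])
    finally show "emeasure ?M A = emeasure (lborel \<Otimes>\<^sub>M lborel) A" .
  qed simp
qed

lemma lborel_shear_invariant':
  fixes a :: real
  shows "distr (lborel \<Otimes>\<^sub>M lborel) (lborel \<Otimes>\<^sub>M lborel) (\<lambda>(x, y). (x, y + a * x)) = lborel \<Otimes>\<^sub>M lborel"
    (is "?M = _")
proof -
  let ?L = "lborel \<Otimes>\<^sub>M (lborel :: real measure)"
  define W S where "W = (\<lambda>(x, y). (y, x) :: real \<times> real)" and "S = (\<lambda>(x, y). (x + a * y, y))"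
  have W: "distr ?L ?L W = ?L" and S: "distr ?L ?L S = ?L"
    unfolding W_def S_def
    by (rule lborel_pair.distr_pair_swap[symmetric] lborel_shear_invariant)+
  have [measurable]: "W \<in> ?L \<rightarrow>\<^sub>M ?L" "S \<in> ?L \<rightarrow>\<^sub>M ?L"
    by (auto simp: W_def S_def split_beta intro!: measurable_Pair)
  have "?M = distr ?L ?L ((W \<circ> S) \<circ> W)"
    by (intro distr_cong) (auto simp: W_def S_def)
  also have "\<dots> = distr (distr ?L ?L W) ?L (W \<circ> S)"
    by (rule distr_distr[symmetric]) auto
  also have "\<dots> = distr (distr ?L ?L S) ?L W"
    unfolding W by (rule distr_distr[symmetric]) auto
  also have "\<dots> = ?L"
    by (simp only: W S)
  finally show ?thesis .
qed

text \<open>A rotation other than a half turn is a product of three shears.\<close>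

lemma lborel_rotation_invariant:
  fixes u :: complex
  assumes "norm u = 1"
  shows "distr lborel lborel ((*) u) = lborel"
proof (cases "Im u = 0")
  case True
  then have "u = 1 \<or> u = -1"
    using assms by (auto simp: cmod_def complex_eq_iff)
  moreover have "distr lborel lborel ((*) (-1)) = (lborel :: complex measure)"
    using lborel_affine[of "-1" "0 :: complex"]
    by (simp add: density_1 one_ennreal_def[symmetric] cong: distr_cong)
  ultimately show ?thesis
    by (auto simp: distr_id2 cong: distr_cong)
next
  case False
  define a where "a = (Re u - 1) / Im u"
  let ?L = "lborel \<Otimes>\<^sub>M (lborel :: real measure)"
  define S T where "S = (\<lambda>(x, y). (x + a * y, y))" and "T = (\<lambda>(x, y). (x, y + Im u * x))"
  define C where "C = (\<lambda>(x, y). Complex x y)"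
  have norm: "Re u ^ 2 + Im u ^ 2 = 1"
    using assms by (simp add: cmod_def)
  have a: "1 + a * Im u = Re u" "a * (1 + Re u) = - Im u"
    using False norm by (auto simp: a_def field_simps power2_eq_square)
  have [measurable]: "S \<in> ?L \<rightarrow>\<^sub>M ?L" "T \<in> ?L \<rightarrow>\<^sub>M ?L"
    by (auto simp: S_def T_def split_beta intro!: measurable_Pair)
  have [measurable]: "C \<in> ?L \<rightarrow>\<^sub>M borel"
    unfolding lborel_prod Complex_eq split_beta C_def
    by (auto intro!: borel_measurable_continuous_onI continuous_intros)
  have rot: "u * C v = C (S (T (S v)))" for v
  proof -
    obtain x y where v: "v = (x, y)" by (cases v)
    have "x + a * y + a * (y + Im u * (x + a * y)) = (1 + a * Im u) * x + a * (1 + (1 + a * Im u)) * y"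
      by (simp add: algebra_simps)
    also have "\<dots> = Re u * x - Im u * y"
      unfolding a(1) a(2) by simp
    finally have 1: "x + a * y + a * (y + Im u * (x + a * y)) = Re u * x - Im u * y" .
    have "y + Im u * (x + a * y) = (1 + a * Im u) * y + Im u * x"
      by (simp add: algebra_simps)
    then have 2: "y + Im u * (x + a * y) = Re u * y + Im u * x"
      unfolding a(1) .
    show ?thesis
      using 1 2 by (simp add: v complex_eq_iff C_def S_def T_def)
  qed
  have ST: "distr ?L ?L S = ?L" "distr ?L ?L T = ?L"
    unfolding S_def T_def by (rule lborel_shear_invariant lborel_shear_invariant')+
  have C: "distr ?L borel C = lborel"
    unfolding C_def by (rule lborel_complex_eq_distr[symmetric])
  have "distr lborel lborel ((*) u) = distr (distr ?L borel C) borel ((*) u)"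
    unfolding C by (simp cong: distr_cong)
  also have "\<dots> = distr ?L borel ((\<lambda>v. C (S (T v))) \<circ> S)"
    by (subst distr_distr) (simp_all add: o_def rot)
  also have "\<dots> = distr (distr ?L ?L S) borel (\<lambda>v. C (S (T v)))"
    by (rule distr_distr[symmetric]) measurable
  also have "\<dots> = distr ?L borel ((\<lambda>v. C (S v)) \<circ> T)"
    unfolding ST by (simp add: o_def)
  also have "\<dots> = distr (distr ?L ?L T) borel (\<lambda>v. C (S v))"
    by (rule distr_distr[symmetric]) measurable
  also have "\<dots> = distr ?L borel (C \<circ> S)"
    unfolding ST by (simp add: o_def)
  also have "\<dots> = distr (distr ?L ?L S) borel C"
    by (rule distr_distr[symmetric]) measurable
  also have "\<dots> = lborel"
    unfolding ST by (rule C)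
  finally show ?thesis .
qed

text \<open>When the first argument is on the torus, this is the action of the torus on \<open>\<complex>\<^sup>2\<close> by rotations.\<close>

definition pmul :: "complex \<times> complex \<Rightarrow> complex \<times> complex \<Rightarrow> complex \<times> complex" where
  "pmul e z = (fst e * fst z, snd e * snd z)"

lemma pmul_measurable [measurable]:
  assumes "f \<in> M \<rightarrow>\<^sub>M borel" "g \<in> M \<rightarrow>\<^sub>M borel"
  shows "(\<lambda>x. pmul (f x) (g x)) \<in> M \<rightarrow>\<^sub>M borel"
  using assms unfolding pmul_def borel_prod[symmetric] by measurable

lemma lborel_pmul_invariant:
  assumes "norm (fst e) = 1" "norm (snd e) = 1"
  shows "distr lborel borel (pmul e) = (lborel :: (complex \<times> complex) measure)"
proof -
  have "distr lborel lborel ((*) (fst e)) \<Otimes>\<^sub>M distr lborel lborel ((*) (snd e)) =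
      distr (lborel \<Otimes>\<^sub>M lborel) (lborel \<Otimes>\<^sub>M lborel) (\<lambda>(x, y). (fst e * x, snd e * y))"
    by (rule pair_measure_distr) (simp_all add: lborel_rotation_invariant assms lborel.sigma_finite_measure_axioms)
  also have "\<dots> = distr lborel borel (pmul e)"
    unfolding lborel_prod pmul_def by (intro distr_cong) (auto simp: split_beta)
  finally show ?thesis
    by (simp add: lborel_rotation_invariant assms lborel_prod)
qed

section \<open>Radial coordinates\<close>

text \<open>Up to the origin, the set where the function exceeds \<open>x\<close> is the disc of radius \<open>exp (- x / 2)\<close>, which
  has area \<open>pi * exp (- x)\<close>.\<close>

lemma distr_log_radius:
  "distr (lborel :: complex measure) borel (\<lambda>z. - ln ((cmod z)\<^sup>2)) =
     density lborel (\<lambda>x. ennreal (pi * exp (- x)))"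
proof (rule measure_eqI_lessThan)
  fix x :: real
  have N: "emeasure (density lborel (\<lambda>x. ennreal (pi * exp (- x)))) {x<..} = ennreal (pi * exp (- x))"
  proof -
    have "emeasure (density lborel (\<lambda>x. ennreal (pi * exp (- x)))) {x<..} =
        (\<integral>\<^sup>+y. ennreal (pi * exp (- y)) * indicator {x<..} y \<partial>lborel)"
      by (simp add: emeasure_density)
    also have "\<dots> = (\<integral>\<^sup>+y. ennreal (pi * exp (- y)) * indicator {x..} y \<partial>lborel)"
    proof (rule nn_integral_cong_AE)
      show "AE y in lborel. ennreal (pi * exp (- y)) * indicator {x<..} y =
          ennreal (pi * exp (- y)) * indicator {x..} y"
        using AE_lborel_singleton[of x] by eventually_elim (auto split: split_indicator)
    qed
    also have "\<dots> = ennreal (0 - (- pi * exp (- x)))"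
    proof (rule nn_integral_FTC_atLeast)
      show "((\<lambda>y. - pi * exp (- y)) \<longlongrightarrow> 0) at_top"
        using tendsto_mult[OF tendsto_const[of "- pi"]
          filterlim_compose[OF exp_at_bot filterlim_uminus_at_bot_at_top]] by simp
      show "((\<lambda>y. - pi * exp (- y)) has_real_derivative pi * exp (- y)) (at y)" for y
        by (auto intro!: derivative_eq_intros)
    qed auto
    finally show ?thesis by simp
  qed
  have "emeasure (distr (lborel :: complex measure) borel (\<lambda>z. - ln ((cmod z)\<^sup>2))) {x<..} =
      emeasure lborel ((\<lambda>z::complex. - ln ((cmod z)\<^sup>2)) -` {x<..})"
    by (subst emeasure_distr) auto
  also have "\<dots> = emeasure lborel (ball (0::complex) (exp (- x / 2)))"
  proof (rule emeasure_eq_AE)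
    show "AE z in lborel. (z \<in> (\<lambda>z::complex. - ln ((cmod z)\<^sup>2)) -` {x<..}) = (z \<in> ball 0 (exp (- x / 2)))"
    proof (rule AE_mp[OF AE_lborel_singleton[of 0]], rule AE_I2, rule impI)
      fix z :: complex assume "z \<noteq> 0"
      then have "- ln ((cmod z)\<^sup>2) > x \<longleftrightarrow> ln (cmod z) < - x / 2"
        by (auto simp: ln_realpow)
      also have "\<dots> \<longleftrightarrow> cmod z < exp (- x / 2)"
        using \<open>z \<noteq> 0\<close> by (metis exp_less_cancel_iff exp_ln zero_less_norm_iff)
      finally show "(z \<in> (\<lambda>z::complex. - ln ((cmod z)\<^sup>2)) -` {x<..}) = (z \<in> ball 0 (exp (- x / 2)))"
        by simp
    qed
  qed (auto simp: measurable_sets_borel[of _ borel])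
  also have "\<dots> = ennreal (pi * exp (- x))"
    by (simp add: emeasure_ball unit_ball_vol_2 power2_eq_square flip: exp_add)
  finally have M: "emeasure (distr (lborel :: complex measure) borel (\<lambda>z. - ln ((cmod z)\<^sup>2))) {x<..} =
      ennreal (pi * exp (- x))" .
  show "emeasure (distr (lborel :: complex measure) borel (\<lambda>z. - ln ((cmod z)\<^sup>2))) {x<..} < \<infinity>"
    by (simp add: M)
  show "emeasure (distr (lborel :: complex measure) borel (\<lambda>z. - ln ((cmod z)\<^sup>2))) {x<..} =
      emeasure (density lborel (\<lambda>x. ennreal (pi * exp (- x)))) {x<..}"
    by (simp add: M N)
qed auto

section \<open>Laurent monomials\<close>

definition zmon :: "int \<times> int \<Rightarrow> complex \<times> complex \<Rightarrow> complex" where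
  "zmon m z = fst z powi fst m * snd z powi snd m"

lemma zmon_0 [simp]: "zmon 0 z = 1"
  by (simp add: zmon_def)

lemma zmon_add: "fst z \<noteq> 0 \<Longrightarrow> snd z \<noteq> 0 \<Longrightarrow> zmon (m + n) z = zmon m z * zmon n z"
  by (simp add: zmon_def power_int_add)

lemma zmon_minus: "zmon (- m) z = inverse (zmon m z)"
  by (simp add: zmon_def power_int_minus)

lemma zmon_nonzero: "fst z \<noteq> 0 \<Longrightarrow> snd z \<noteq> 0 \<Longrightarrow> zmon m z \<noteq> 0"
  by (simp add: zmon_def)

lemma zmon_pmul: "zmon m (pmul e z) = zmon m e * zmon m z"
  by (simp add: zmon_def pmul_def power_int_mult_distrib)

lemma norm_zmon: "norm (zmon m z) = cmod (fst z) powi fst m * cmod (snd z) powi snd m"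
  by (simp add: zmon_def norm_mult norm_power_int)

lemma borel_measurable_power_int [measurable (raw)]:
  fixes f :: "'a \<Rightarrow> complex"
  assumes "f \<in> borel_measurable M"
  shows "(\<lambda>x. f x powi k) \<in> borel_measurable M"
  using assms unfolding power_int_def by simp

lemma borel_measurable_cnj [measurable (raw)]:
  fixes f :: "'a \<Rightarrow> complex"
  assumes "f \<in> borel_measurable M"
  shows "(\<lambda>x. cnj (f x)) \<in> borel_measurable M"
  by (rule borel_measurable_continuous_on[OF _ assms]) (intro continuous_intros)

lemma zmon_measurable [measurable (raw)]:
  assumes [measurable]: "f \<in> borel_measurable M"
  shows "(\<lambda>x. zmon m (f x)) \<in> borel_measurable M"
proof -
  have [measurable]: "f \<in> M \<rightarrow>\<^sub>M borel \<Otimes>\<^sub>M borel"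
    unfolding borel_prod by simp
  show ?thesis
    unfolding zmon_def by measurable
qed

section \<open>The torus and its invariant measure\<close>

definition torus :: "(complex \<times> complex) set" where
  "torus = sphere 0 1 \<times> sphere 0 1"

lemma torus_iff: "e \<in> torus \<longleftrightarrow> norm (fst e) = 1 \<and> norm (snd e) = 1"
  by (cases e) (simp add: torus_def)

lemma torus_nonzero: "e \<in> torus \<Longrightarrow> fst e \<noteq> 0 \<and> snd e \<noteq> 0"
  by (auto simp: torus_iff)

lemma compact_torus: "compact torus"
  unfolding torus_def by (intro compact_Times compact_sphere)

lemma torus_borel [measurable]: "torus \<in> sets borel"
  by (intro borel_closed compact_imp_closed compact_torus)

lemma norm_zmon_torus: "e \<in> torus \<Longrightarrow> norm (zmon m e) = 1"
  by (simp add: torus_iff norm_zmon)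

lemma cnj_zmon_torus: "e \<in> torus \<Longrightarrow> cnj (zmon m e) = zmon (- m) e"
  using norm_zmon_torus[of e m] by (simp add: zmon_minus inverse_eq_divide divide_conv_cnj)

lemma continuous_on_zmon: "(\<And>z. z \<in> S \<Longrightarrow> fst z \<noteq> 0 \<and> snd z \<noteq> 0) \<Longrightarrow> continuous_on S (zmon m)"
  unfolding zmon_def [abs_def] by (intro continuous_intros) auto

text \<open>Both measures have total mass 1, so that integrals against them are averages.\<close>

definition circle_measure :: "complex measure" where
  "circle_measure = distr (restrict_space lborel {0..1}) borel (\<lambda>t. cis (2 * pi * t))"

definition torus_measure :: "(complex \<times> complex) measure" where
  "torus_measure = circle_measure \<Otimes>\<^sub>M circle_measure"

lemma cis_measurable [measurable]: "(\<lambda>t. cis (2 * pi * t)) \<in> borel_measurable (restrict_space lborel A)"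
proof -
  have "(\<lambda>t. cis (2 * pi * t)) \<in> borel_measurable borel"
    by (intro borel_measurable_continuous_onI continuous_intros)
  then show ?thesis
    by (intro measurable_restrict_space1) simp
qed

lemma sets_circle [simp, measurable_cong]: "sets circle_measure = sets borel"
  and space_circle [simp]: "space circle_measure = UNIV"
  by (simp_all add: circle_measure_def)

lemma emeasure_circle: "emeasure circle_measure UNIV = 1"
  unfolding circle_measure_def
  by (subst emeasure_distr) (auto simp: emeasure_restrict_space space_restrict_space)

interpretation circle: finite_measure circle_measure
  by standard (simp add: emeasure_circle)

interpretation torus: pair_sigma_finite circle_measure circle_measure ..

lemma sets_torus [simp, measurable_cong]: "sets torus_measure = sets borel"
  unfolding torus_measure_def
  by (simp add: borel_prod[symmetric] cong: sets_pair_measure_cong)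

lemma space_torus [simp]: "space torus_measure = UNIV"
  by (simp add: torus_measure_def space_pair_measure)

lemma emeasure_torus: "emeasure torus_measure UNIV = 1"
  using circle.emeasure_pair_measure_Times[of UNIV circle_measure UNIV]
  by (simp add: torus_measure_def emeasure_circle)

interpretation torus: finite_measure torus_measure
  by standard (simp add: emeasure_torus)

lemma measure_torus: "measure torus_measure UNIV = 1"
  by (simp add: measure_def emeasure_torus)

lemma AE_circle: "AE e in circle_measure. norm e = 1"
  unfolding circle_measure_def by (subst AE_distr_iff) auto

lemma AE_torus: "AE e in torus_measure. e \<in> torus"
  unfolding torus_measure_def
proof (rule torus.AE_pair_measure)
  show "{x \<in> space (circle_measure \<Otimes>\<^sub>M circle_measure). x \<in> torus} \<in> sets (circle_measure \<Otimes>\<^sub>M circle_measure)"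
    using sets_torus space_torus torus_borel by (simp add: torus_measure_def)
  show "AE x in circle_measure. AE y in circle_measure. (x, y) \<in> torus"
    using AE_circle
  proof eventually_elim
    case (elim x)
    then show ?case
      using AE_circle by (auto simp: torus_iff)
  qed
qed

lemma integral_circle:
  fixes f :: "complex \<Rightarrow> complex"
  assumes [measurable]: "f \<in> borel_measurable borel"
  shows "(\<integral>e. f e \<partial>circle_measure) = (LINT t:{0..1}|lborel. f (cis (2 * pi * t)))"
  unfolding circle_measure_def set_lebesgue_integral_def
  by (subst integral_distr) (auto simp: integral_restrict_space)

lemma integrable_torus:
  fixes h :: "complex \<times> complex \<Rightarrow> 'a :: {banach, second_countable_topology}"
  assumes "h \<in> borel_measurable borel" and "continuous_on torus h"
  shows "integrable torus_measure h"
proof -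
  have "bounded (h ` torus)"
    by (intro compact_imp_bounded compact_continuous_image assms compact_torus)
  then obtain B where B: "\<And>e. e \<in> torus \<Longrightarrow> norm (h e) \<le> B"
    by (auto simp: bounded_iff)
  show ?thesis
  proof (rule torus.integrable_const_bound)
    show "AE e in torus_measure. norm (h e) \<le> B"
      using AE_torus by eventually_elim (rule B)
  qed (use assms in simp)
qed

lemma integral_circle_powi: "(\<integral>e. e powi k \<partial>circle_measure) = (if k = 0 then 1 else 0)"
proof (cases "k = 0")
  case True
  then show ?thesis
    by (simp add: measure_def emeasure_circle)
next
  case False
  let ?c = "2 * pi * real_of_int k"
  have "?c \<noteq> 0" using False by simp
  have eq: "cis (2 * pi * t) powi k = cis (?c * t)" for t
    by (simp add: cis_power_int mult_ac)
  have "((\<lambda>t. cis (?c * t)) has_integral (cis (?c * 1) / (\<i> * ?c) - cis (?c * 0) / (\<i> * ?c))) {0..1}"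
    using \<open>?c \<noteq> 0\<close>
    by (intro fundamental_theorem_of_calculus)
       (auto intro!: derivative_eq_intros simp: cis_conv_exp simp flip: has_real_derivative_iff_has_vector_derivative
             intro!: has_vector_derivative_real_field)
  moreover have "cis (?c * 1) = 1"
    using cis_multiple_2pi[of "real_of_int k"] by (simp add: mult_ac)
  ultimately have "((\<lambda>t. cis (?c * t)) has_integral 0) {0..1}"
    by simp
  moreover have "set_integrable lborel {0..1} (\<lambda>t. cis (?c * t))"
    by (intro borel_integrable_atLeastAtMost' continuous_intros)
  ultimately have "(LINT t:{0..1}|lborel. cis (?c * t)) = 0"
    using set_borel_integral_eq_integral(2) by (metis integral_unique)
  then show ?thesis
    using False by (simp add: integral_circle eq)
qed

lemma integral_torus_zmon: "(\<integral>e. zmon m e \<partial>torus_measure) = (if m = 0 then 1 else 0)"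
proof -
  have "integrable torus_measure (zmon m)"
    by (intro integrable_torus continuous_on_zmon torus_nonzero) simp_all
  then have "integral\<^sup>L torus_measure (zmon m) = (\<integral>x. \<integral>y. zmon m (x, y) \<partial>circle_measure \<partial>circle_measure)"
    unfolding torus_measure_def by (rule torus.integral_fst'[symmetric])
  also have "\<dots> = (if fst m = 0 \<and> snd m = 0 then 1 else 0)"
    by (simp add: zmon_def integral_circle_powi)
  finally show ?thesis
    by (simp add: prod_eq_iff)
qed

text \<open>A continuous function that vanishes almost everywhere on the circle, or on the torus, vanishes
  there: no nonempty relatively open subset is a null set.\<close>

lemma circle_AE_zero:
  fixes g :: "complex \<Rightarrow> complex"
  assumes [measurable]: "g \<in> borel_measurable borel" and g: "continuous_on (sphere 0 1) g"
    and ae: "AE e in circle_measure. g e = 0" and e: "norm e = 1"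
  shows "g e = 0"
proof -
  define h where "h t = g (cis (2 * pi * t))" for t
  have h: "continuous_on {0..1} h"
    unfolding h_def by (rule continuous_on_compose2[OF g]) (auto intro!: continuous_intros)
  have "(\<integral>e. of_real (norm (g e)) \<partial>circle_measure) = (0 :: complex)"
    using ae by (intro integral_eq_zero_AE) auto
  also have "(\<integral>e. of_real (norm (g e)) \<partial>circle_measure) = (LINT t:{0..1}|lborel. complex_of_real (norm (h t)))"
    unfolding h_def by (rule integral_circle) measurable
  finally have "(LINT t:{0..1}|lborel. norm (h t)) = 0"
    by (simp add: set_integral_complex_of_real)
  moreover have "set_integrable lborel {0..1} (\<lambda>t. norm (h t))"
    by (intro borel_integrable_atLeastAtMost' continuous_intros h)
  ultimately have int0: "((\<lambda>t. norm (h t)) has_integral 0) (cbox 0 1)"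
    using set_borel_integral_eq_integral by (metis integrable_integral cbox_interval)
  have zero: "h t = 0" if "t \<in> {0..1}" for t
  proof -
    have "norm (h t) = 0"
      by (rule has_integral_0_cbox_imp_0[OF _ _ int0])
         (use h that in \<open>auto intro!: continuous_intros\<close>)
    then show ?thesis by simp
  qed
  obtain t where t: "0 \<le> t" "t < 2 * pi" "e = cis t"
    using e complex_unimodular_polar[of e] by (auto simp: complex_eq_iff)
  then show ?thesis
    using zero[of "t / (2 * pi)"] by (simp add: h_def)
qed

lemma torus_AE_zero:
  fixes g :: "complex \<times> complex \<Rightarrow> complex"
  assumes [measurable]: "g \<in> borel_measurable borel" and g: "continuous_on torus g"
    and ae: "AE e in torus_measure. g e = 0" and e: "e \<in> torus"
  shows "g e = 0"
proof -
  have [measurable]: "g \<in> borel_measurable (borel \<Otimes>\<^sub>M borel)"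
    unfolding borel_prod by simp
  have "AE x in circle_measure. AE y in circle_measure. g (x, y) = 0"
    using ae unfolding torus_measure_def by (rule torus.AE_pair)
  then have "AE x in circle_measure. g (x, snd e) = 0"
    using AE_circle
  proof eventually_elim
    case (elim x)
    show ?case
      by (rule circle_AE_zero[OF _ _ elim(1)])
         (use e elim in \<open>auto simp: torus_iff intro!: continuous_on_compose2[OF g] continuous_intros\<close>)
  qed
  then have "g (fst e, snd e) = 0"
    by (rule circle_AE_zero[rotated 2])
       (use e in \<open>auto simp: torus_iff intro!: continuous_on_compose2[OF g] continuous_intros\<close>)
  then show ?thesis by simp
qed

section \<open>A continuous function on the torus is determined by its Fourier coefficients\<close>

text \<open>Measurability is part of the definition because the Bochner integral of a function that is not
  measurable is 0.\<close>

definition fourier_null :: "(complex \<times> complex \<Rightarrow> complex) \<Rightarrow> bool" where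
  "fourier_null h \<longleftrightarrow> h \<in> borel_measurable borel \<and> continuous_on torus h \<and>
     (\<forall>m. (\<integral>e. h e * zmon m e \<partial>torus_measure) = 0)"

lemma integrable_torus_zmon:
  assumes "h \<in> borel_measurable borel" "continuous_on torus h"
  shows "integrable torus_measure (\<lambda>e. h e * zmon m e)"
  using assms by (intro integrable_torus continuous_on_mult continuous_on_zmon torus_nonzero) simp_all

lemma fourier_null_add:
  assumes "fourier_null f" "fourier_null g"
  shows "fourier_null (\<lambda>e. f e + g e)"
  using assms
  by (auto simp: fourier_null_def distrib_right integrable_torus_zmon intro!: continuous_intros)

lemma fourier_null_cmult:
  assumes "fourier_null f"
  shows "fourier_null (\<lambda>e. c * f e)"
  using assms
  by (auto simp: fourier_null_def mult.assoc intro!: continuous_intros)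

lemma fourier_null_cong:
  assumes "fourier_null f" "\<And>e. e \<in> torus \<Longrightarrow> g e = f e" "g \<in> borel_measurable borel"
  shows "fourier_null g"
proof -
  have [measurable]: "f \<in> borel_measurable borel" "g \<in> borel_measurable borel"
    using assms by (simp_all add: fourier_null_def)
  have "(\<integral>e. g e * zmon m e \<partial>torus_measure) = (\<integral>e. f e * zmon m e \<partial>torus_measure)" for m
  proof (rule integral_cong_AE)
    show "AE e in torus_measure. g e * zmon m e = f e * zmon m e"
      using AE_torus by eventually_elim (simp add: assms)
  qed measurable
  moreover have "continuous_on torus g"
    using assms by (auto simp: fourier_null_def cong: continuous_on_cong)
  ultimately show ?thesis
    using assms by (simp add: fourier_null_def)
qed

lemma fourier_null_zmon:
  assumes "fourier_null f"
  shows "fourier_null (\<lambda>e. zmon k e * f e)"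
proof -
  have [measurable]: "f \<in> borel_measurable borel"
    using assms by (simp add: fourier_null_def)
  have "(\<integral>e. zmon k e * f e * zmon m e \<partial>torus_measure) = (\<integral>e. f e * zmon (k + m) e \<partial>torus_measure)" for m
  proof (rule integral_cong_AE)
    show "AE e in torus_measure. zmon k e * f e * zmon m e = f e * zmon (k + m) e"
      using AE_torus by eventually_elim (simp add: zmon_add torus_nonzero)
  qed measurable
  then have "(\<integral>e. zmon k e * f e * zmon m e \<partial>torus_measure) = 0" for m
    using assms unfolding fourier_null_def by metis
  then show ?thesis
    using assms by (auto simp: fourier_null_def intro!: continuous_intros continuous_on_zmon torus_nonzero)
qed

text \<open>On the torus a coordinate and its conjugate are monomials, so multiplication by a real
  polynomial function preserves the vanishing of all Fourier coefficients.\<close>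

lemma fourier_null_polynomial:
  assumes "real_polynomial_function p" "fourier_null f"
  shows "fourier_null (\<lambda>e. of_real (p e) * f e)"
  using assms
proof (induction p arbitrary: f)
  case (linear p)
  have p: "p e = Re (fst e) * p (1, 0) + Im (fst e) * p (\<i>, 0) + (Re (snd e) * p (0, 1) + Im (snd e) * p (0, \<i>))"
    for e
  proof -
    have lin: "linear p"
      using linear(1) by (rule bounded_linear.linear)
    have "e = Re (fst e) *\<^sub>R (1, 0) + Im (fst e) *\<^sub>R (\<i>, 0) + (Re (snd e) *\<^sub>R (0, 1) + Im (snd e) *\<^sub>R (0, \<i>))"
      by (simp add: prod_eq_iff complex_eq_iff)
    then have "p e = p (Re (fst e) *\<^sub>R (1, 0) + Im (fst e) *\<^sub>R (\<i>, 0) + (Re (snd e) *\<^sub>R (0, 1) + Im (snd e) *\<^sub>R (0, \<i>)))"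
      by (rule arg_cong[where f = p])
    also have "\<dots> = Re (fst e) * p (1, 0) + Im (fst e) * p (\<i>, 0) + (Re (snd e) * p (0, 1) + Im (snd e) * p (0, \<i>))"
      by (simp only: linear_add[OF lin] linear_scale[OF lin] real_scaleR_def)
    finally show ?thesis .
  qed
  define F where "F e = p (1, 0) / 2 * (zmon (1, 0) e * f e) + p (1, 0) / 2 * (zmon (-1, 0) e * f e)
      + (p (\<i>, 0) / (2 * \<i>) * (zmon (1, 0) e * f e) + - p (\<i>, 0) / (2 * \<i>) * (zmon (-1, 0) e * f e))
      + (p (0, 1) / 2 * (zmon (0, 1) e * f e) + p (0, 1) / 2 * (zmon (0, -1) e * f e)
      + (p (0, \<i>) / (2 * \<i>) * (zmon (0, 1) e * f e) + - p (0, \<i>) / (2 * \<i>) * (zmon (0, -1) e * f e)))" for e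
  have F: "fourier_null F"
    unfolding F_def by (intro fourier_null_add fourier_null_cmult fourier_null_zmon linear)
  have [measurable]: "p \<in> borel_measurable borel" "f \<in> borel_measurable borel"
    using linear by (auto simp: fourier_null_def intro!: borel_measurable_continuous_onI linear_continuous_on)
  show ?case
  proof (rule fourier_null_cong[OF F])
    fix e assume e: "e \<in> torus"
    have inv: "inverse u = cnj u" if "norm u = 1" for u
      using that by (simp add: inverse_eq_divide divide_conv_cnj)
    have 1: "Re (fst e) = (fst e + inverse (fst e)) / 2" "Im (fst e) = (fst e - inverse (fst e)) / (2 * \<i>)"
      and 2: "Re (snd e) = (snd e + inverse (snd e)) / 2" "Im (snd e) = (snd e - inverse (snd e)) / (2 * \<i>)"
      using e by (auto simp: torus_iff inv complex_eq_iff)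
    have z: "zmon (1, 0) e = fst e" "zmon (-1, 0) e = inverse (fst e)"
      "zmon (0, 1) e = snd e" "zmon (0, -1) e = inverse (snd e)"
      by (simp_all add: zmon_def power_int_minus)
    have r: "(u + v) / 2 * a * y = a / 2 * (u * y) + a / 2 * (v * y)"
      "(u - v) / (2 * \<i>) * a * y = a / (2 * \<i>) * (u * y) + - a / (2 * \<i>) * (v * y)" for u v a y :: complex
      by (simp_all add: field_simps)
    show "of_real (p e) * f e = F e"
      unfolding p[of e] F_def of_real_add of_real_mult 1 2 z
      by (simp only: distrib_right r of_real_divide of_real_minus of_real_numeral)
  qed measurable
next
  case (const c)
  then show ?case by (rule fourier_null_cmult)
next
  case (add p q)
  then show ?case by (simp add: distrib_right fourier_null_add)
next
  case (mult p q)
  then show ?case by (simp add: mult.assoc)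
qed

lemma le_zero_if_le_eps_mult:
  fixes a b :: real
  assumes "\<And>\<epsilon>. \<epsilon> > 0 \<Longrightarrow> a \<le> \<epsilon> * b" and "b \<ge> 0"
  shows "a \<le> 0"
proof (rule ccontr)
  assume "\<not> a \<le> 0"
  then have "a * (2 * (b + 1)) \<le> a * b"
    using assms(1)[of "a / (2 * (b + 1))"] \<open>b \<ge> 0\<close> by (simp add: field_simps)
  then show False
    using \<open>\<not> a \<le> 0\<close> \<open>b \<ge> 0\<close> by simp
qed

text \<open>If \<open>g\<close> is a polynomial function close to the conjugate of \<open>f\<close>, then the average of \<open>g * f\<close> vanishes
  and is close to that of \<open>|f|\<^sup>2\<close>.\<close>

lemma fourier_null_imp_zero:
  assumes "fourier_null f" and "e \<in> torus"
  shows "f e = 0"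
proof -
  have [measurable]: "f \<in> borel_measurable borel" and f: "continuous_on torus f"
    using assms by (auto simp: fourier_null_def)
  have [measurable]: "(\<lambda>e. cnj (f e)) \<in> borel_measurable borel"
    by (rule borel_measurable_continuous_on[where g = f]) (auto intro!: continuous_intros)
  let ?I = "\<integral>e. norm (f e) \<partial>torus_measure"
  let ?J = "\<integral>e. cnj (f e) * f e \<partial>torus_measure"
  have int: "integrable torus_measure (\<lambda>e. norm (f e))" "integrable torus_measure (\<lambda>e. cnj (f e) * f e)"
    by (auto intro!: integrable_torus continuous_intros f)
  have "norm ?J \<le> \<epsilon> * ?I" if "\<epsilon> > 0" for \<epsilon>
  proof -
    have "continuous_on torus (\<lambda>e. cnj (f e))"
      by (intro continuous_intros f)
    from Stone_Weierstrass_polynomial_function[OF compact_torus this \<open>\<epsilon> > 0\<close>]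
    obtain g where g: "polynomial_function g" "\<And>e. e \<in> torus \<Longrightarrow> norm (cnj (f e) - g e) < \<epsilon>"
      by auto
    have "real_polynomial_function (Re \<circ> g)" "real_polynomial_function (Im \<circ> g)"
      using g(1) bounded_linear_Re bounded_linear_Im by (auto simp: polynomial_function_def)
    then have "fourier_null (\<lambda>e. of_real ((Re \<circ> g) e) * f e + \<i> * (of_real ((Im \<circ> g) e) * f e))"
      by (intro fourier_null_add fourier_null_cmult fourier_null_polynomial assms)
    also have "(\<lambda>e. of_real ((Re \<circ> g) e) * f e + \<i> * (of_real ((Im \<circ> g) e) * f e)) = (\<lambda>e. g e * f e)"
      by (auto simp: fun_eq_iff complex_eq_iff algebra_simps)
    finally have gf: "fourier_null (\<lambda>e. g e * f e)" .
    have gf0: "(\<integral>e. g e * f e \<partial>torus_measure) = 0"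
      using gf[unfolded fourier_null_def, THEN conjunct2, THEN conjunct2, rule_format, of 0] by simp
    have gfi: "integrable torus_measure (\<lambda>e. g e * f e)"
      using gf by (intro integrable_torus) (auto simp: fourier_null_def)
    have "norm ?J = norm (\<integral>e. (cnj (f e) * f e - g e * f e) \<partial>torus_measure)"
      using int gfi by (simp add: gf0)
    also have "\<dots> \<le> (\<integral>e. norm (cnj (f e) * f e - g e * f e) \<partial>torus_measure)"
      by (rule integral_norm_bound)
    also have "\<dots> \<le> (\<integral>e. \<epsilon> * norm (f e) \<partial>torus_measure)"
    proof (rule integral_mono_AE)
      show "AE e in torus_measure. norm (cnj (f e) * f e - g e * f e) \<le> \<epsilon> * norm (f e)"
        using AE_torus
      proof eventually_elim
        case (elim e)
        show ?case
          using g(2)[OF elim] by (auto simp: left_diff_distrib[symmetric] norm_mult intro!: mult_right_mono)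
      qed
    qed (use int gfi in auto)
    also have "\<dots> = \<epsilon> * ?I" by simp
    finally show ?thesis .
  qed
  then have "norm ?J \<le> 0"
    by (rule le_zero_if_le_eps_mult) simp_all
  then have "?J = 0" by simp
  moreover have "?J = of_real (\<integral>e. (norm (f e))\<^sup>2 \<partial>torus_measure)"
    unfolding integral_complex_of_real[symmetric] complex_norm_square by (simp only: mult.commute)
  ultimately have "(\<integral>e. (norm (f e))\<^sup>2 \<partial>torus_measure) = 0"
    by simp
  moreover have "integrable torus_measure (\<lambda>e. (norm (f e))\<^sup>2)"
    by (intro integrable_torus continuous_intros f) measurable
  ultimately have "AE e in torus_measure. f e = 0"
    by (subst (asm) integral_nonneg_eq_0_iff_AE) auto
  then show ?thesis
    using torus_AE_zero[OF _ f _ assms(2)] by simp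
qed

section \<open>Holomorphic functions of two variables\<close>

text \<open>The pointwise form of \<open>holomorphic2_on\<close>, which is convenient for closure properties.\<close>

definition holo_at :: "(complex \<times> complex \<Rightarrow> complex) \<Rightarrow> complex \<times> complex \<Rightarrow> bool" where
  "holo_at f z \<longleftrightarrow> (\<exists>a b. (f has_derivative (\<lambda>(h, k). a * h + b * k)) (at z))"

lemma holomorphic2_on_iff: "f holomorphic2_on \<Omega> \<longleftrightarrow> (\<forall>z\<in>\<Omega>. holo_at f z)"
  by (simp add: holomorphic2_on_def holo_at_def)

lemma holo_at_const [simp]: "holo_at (\<lambda>z. c) z"
  unfolding holo_at_def by (intro exI[of _ 0]) (simp add: case_prod_beta')

lemma holo_at_fst [simp]: "holo_at fst z" and holo_at_snd [simp]: "holo_at snd z"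
  unfolding holo_at_def
   apply (rule exI[of _ 1], rule exI[of _ 0])
   apply (auto simp: split_beta intro!: derivative_eq_intros)[1]
  apply (rule exI[of _ 0], rule exI[of _ 1])
  apply (auto simp: split_beta intro!: derivative_eq_intros)[1]
  done

lemma holo_at_compose:
  assumes g: "(g has_field_derivative g') (at (f z))" and f: "holo_at f z"
  shows "holo_at (\<lambda>x. g (f x)) z"
proof -
  obtain a b where ab: "(f has_derivative (\<lambda>(h, k). a * h + b * k)) (at z)"
    using f by (auto simp: holo_at_def)
  have "((\<lambda>x. g (f x)) has_derivative (\<lambda>x. g' * (case x of (h, k) \<Rightarrow> a * h + b * k))) (at z)"
    using has_derivative_compose[OF ab] g by (auto simp: has_field_derivative_def)
  also have "(\<lambda>x. g' * (case x of (h, k) \<Rightarrow> a * h + b * k)) = (\<lambda>(h, k). (g' * a) * h + (g' * b) * k)"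
    by (auto simp: algebra_simps)
  finally show ?thesis
    unfolding holo_at_def by blast
qed

lemma holo_at_add:
  assumes "holo_at f z" "holo_at g z"
  shows "holo_at (\<lambda>x. f x + g x) z"
proof -
  obtain a b c d where ab: "(f has_derivative (\<lambda>(h, k). a * h + b * k)) (at z)"
    and cd: "(g has_derivative (\<lambda>(h, k). c * h + d * k)) (at z)"
    using assms by (auto simp: holo_at_def)
  have "((\<lambda>x. f x + g x) has_derivative
      (\<lambda>x. (case x of (h, k) \<Rightarrow> a * h + b * k) + (case x of (h, k) \<Rightarrow> c * h + d * k))) (at z)"
    by (intro has_derivative_add ab cd)
  also have "(\<lambda>x. (case x of (h, k) \<Rightarrow> a * h + b * k) + (case x of (h, k) \<Rightarrow> c * h + d * k)) =
      (\<lambda>(h, k). (a + c) * h + (b + d) * k)"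
    by (auto simp: algebra_simps)
  finally show ?thesis
    unfolding holo_at_def by blast
qed

lemma holo_at_mult:
  assumes "holo_at f z" "holo_at g z"
  shows "holo_at (\<lambda>x. f x * g x) z"
proof -
  obtain a b c d where ab: "(f has_derivative (\<lambda>(h, k). a * h + b * k)) (at z)"
    and cd: "(g has_derivative (\<lambda>(h, k). c * h + d * k)) (at z)"
    using assms by (auto simp: holo_at_def)
  have "((\<lambda>x. f x * g x) has_derivative
      (\<lambda>x. f z * (case x of (h, k) \<Rightarrow> c * h + d * k) + (case x of (h, k) \<Rightarrow> a * h + b * k) * g z)) (at z)"
    by (intro has_derivative_mult ab cd)
  also have "(\<lambda>x. f z * (case x of (h, k) \<Rightarrow> c * h + d * k) + (case x of (h, k) \<Rightarrow> a * h + b * k) * g z) =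
      (\<lambda>(h, k). (f z * c + a * g z) * h + (f z * d + b * g z) * k)"
    by (auto simp: algebra_simps)
  finally show ?thesis
    unfolding holo_at_def by blast
qed

lemma holo_at_sum: "(\<And>i. i \<in> I \<Longrightarrow> holo_at (f i) z) \<Longrightarrow> holo_at (\<lambda>x. \<Sum>i\<in>I. f i x) z"
  by (induction I rule: infinite_finite_induct) (auto intro: holo_at_add)

lemma holo_at_transform:
  assumes "holo_at f z" "open S" "z \<in> S" "\<And>x. x \<in> S \<Longrightarrow> f x = g x"
  shows "holo_at g z"
  using assms has_derivative_transform_within_open unfolding holo_at_def by blast

lemma holo_at_powi:
  assumes "holo_at f z" "f z \<noteq> 0 \<or> n \<ge> 0"
  shows "holo_at (\<lambda>x. f x powi n) z"
proof (cases "n \<ge> 0")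
  case True
  have "((\<lambda>x. x ^ nat n) has_field_derivative of_nat (nat n) * f z ^ (nat n - 1)) (at (f z))"
    by (auto intro!: derivative_eq_intros)
  from holo_at_compose[OF this assms(1)] show ?thesis
    using True by (simp add: power_int_def)
next
  case False
  then have "f z \<noteq> 0" using assms by auto
  then have "((\<lambda>x. x powi n) has_field_derivative of_int n * f z powi (n - 1) * 1) (at (f z))"
    by (intro DERIV_power_int) auto
  from holo_at_compose[OF this assms(1)] show ?thesis by simp
qed

lemma holo_at_zmon:
  assumes "fst z \<noteq> 0 \<or> fst m \<ge> 0" "snd z \<noteq> 0 \<or> snd m \<ge> 0"
  shows "holo_at (zmon m) z"
  unfolding zmon_def [abs_def] using assms by (intro holo_at_mult holo_at_powi) auto

lemma holo_at_imp_continuous: "holo_at f z \<Longrightarrow> isCont f z"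
  unfolding holo_at_def using has_derivative_continuous by blast

lemma holo_at_fst_slice:
  assumes "holo_at f (exp x, w)"
  shows "(\<lambda>x. f (exp x, w)) field_differentiable (at x)"
proof -
  obtain a b where ab: "(f has_derivative (\<lambda>(h, k). a * h + b * k)) (at (exp x, w))"
    using assms by (auto simp: holo_at_def)
  have 1: "((\<lambda>x. (exp x, w)) has_derivative (\<lambda>h. (exp x * h, 0))) (at x)"
    by (auto intro!: derivative_eq_intros)
  have "((\<lambda>x. f (exp x, w)) has_derivative (\<lambda>h. (a * exp x) * h)) (at x)"
    using has_derivative_compose[OF 1 ab] by (simp add: mult_ac)
  then have "((\<lambda>x. f (exp x, w)) has_field_derivative (a * exp x)) (at x)"
    by (simp add: has_field_derivative_def)
  then show ?thesis
    by (auto simp: field_differentiable_def)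
qed

lemma holo_at_snd_slice:
  assumes "holo_at f (w, exp x)"
  shows "(\<lambda>x. f (w, exp x)) field_differentiable (at x)"
proof -
  obtain a b where ab: "(f has_derivative (\<lambda>(h, k). a * h + b * k)) (at (w, exp x))"
    using assms by (auto simp: holo_at_def)
  have 1: "((\<lambda>x. (w, exp x)) has_derivative (\<lambda>h. (0, exp x * h))) (at x)"
    by (auto intro!: derivative_eq_intros)
  have "((\<lambda>x. f (w, exp x)) has_derivative (\<lambda>h. (b * exp x) * h)) (at x)"
    using has_derivative_compose[OF 1 ab] by (simp add: mult_ac)
  then have "((\<lambda>x. f (w, exp x)) has_field_derivative (b * exp x)) (at x)"
    by (simp add: has_field_derivative_def)
  then show ?thesis
    by (auto simp: field_differentiable_def)
qed

section \<open>Laurent coefficients\<close>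

text \<open>If \<open>G\<close> is a primitive of \<open>g\<close>, the mean over a period is \<open>G (x + 2 * pi * \<i>) - G x\<close> up to a
  constant factor, and the derivative of this difference vanishes.\<close>

lemma period_mean_constant:
  fixes g :: "complex \<Rightarrow> complex"
  assumes V: "convex V" "open V" and trans: "\<And>x t. x \<in> V \<Longrightarrow> x + \<i> * of_real t \<in> V"
    and g: "\<And>x. x \<in> V \<Longrightarrow> g field_differentiable (at x)"
    and per: "\<And>x. x \<in> V \<Longrightarrow> g (x + 2 * pi * \<i>) = g x"
    and xy: "x \<in> V" "y \<in> V"
  shows "(LINT t:{0..1}|lborel. g (x + 2 * pi * \<i> * complex_of_real t)) = (LINT t:{0..1}|lborel. g (y + 2 * pi * \<i> * complex_of_real t))"
proof -
  have hol: "g holomorphic_on V"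
    using g by (auto simp: holomorphic_on_def intro: field_differentiable_at_within)
  obtain G where G: "\<And>x. x \<in> V \<Longrightarrow> (G has_field_derivative g x) (at x)"
    using holomorphic_convex_primitive'[OF V(1,2) hol] V(2) by (metis at_within_open)
  have trans': "x + 2 * pi * \<i> * t \<in> V" if "x \<in> V" for x and t :: real
    using trans[OF that, of "2 * pi * t"] by (simp add: mult_ac)
  have trans1: "x + 2 * pi * \<i> \<in> V" if "x \<in> V" for x
    using trans'[OF that, of 1] by simp
  have mean: "(LINT t:{0..1}|lborel. g (x + 2 * pi * \<i> * complex_of_real t)) = (G (x + 2 * pi * \<i>) - G x) / (2 * pi * \<i>)"
    if x: "x \<in> V" for x
  proof -
    have hi: "((\<lambda>t::real. g (x + 2 * pi * \<i> * t)) has_integral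
       (G (x + 2 * pi * \<i> * of_real 1) / (2 * pi * \<i>) - G (x + 2 * pi * \<i> * of_real 0) / (2 * pi * \<i>))) {0..1}"
    proof (rule fundamental_theorem_of_calculus[where f = "\<lambda>t. G (x + 2 * pi * \<i> * complex_of_real t) / (2 * pi * \<i>)"])
      fix t :: real
      have l: "((\<lambda>t. x + 2 * pi * \<i> * t) has_field_derivative (2 * pi * \<i>)) (at (of_real t))"
        by (rule DERIV_cong, rule DERIV_add[OF DERIV_const DERIV_cmult[OF DERIV_ident]]) simp
      have "((\<lambda>t. G (x + 2 * pi * \<i> * t) / (2 * pi * \<i>)) has_field_derivative
          (g (x + 2 * pi * \<i> * t) * (2 * pi * \<i>)) / (2 * pi * \<i>)) (at (of_real t))"
        by (rule DERIV_cdivide[OF DERIV_chain2[OF G[OF trans'[OF x, of t]] l]])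
      then have "((\<lambda>t. G (x + 2 * pi * \<i> * t) / (2 * pi * \<i>)) has_field_derivative
          g (x + 2 * pi * \<i> * t)) (at (of_real t))"
        by simp
      then show "((\<lambda>t. G (x + 2 * pi * \<i> * complex_of_real t) / (2 * pi * \<i>)) has_vector_derivative
          g (x + 2 * pi * \<i> * t)) (at t within {0..1})"
        by (rule has_vector_derivative_real_field)
    qed simp
    have si: "set_integrable lborel {0..1} (\<lambda>t. g (x + 2 * pi * \<i> * of_real t))"
    proof (rule borel_integrable_atLeastAtMost')
      have "continuous_on {0..1} (\<lambda>t. x + 2 * pi * \<i> * complex_of_real t)"
        by (intro continuous_intros)
      then show "continuous_on {0..1} (\<lambda>t. g (x + 2 * pi * \<i> * of_real t))"
        by (rule continuous_on_compose2[OF holomorphic_on_imp_continuous_on[OF hol]]) (use trans'[OF x] in blast)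
    qed
    show ?thesis
      using set_borel_integral_eq_integral(2)[OF si] integral_unique[OF hi] by (simp add: diff_divide_distrib)
  qed
  have "(\<lambda>x. G (x + 2 * pi * \<i>) - G x) constant_on V"
  proof (rule has_field_derivative_0_imp_constant_on)
    fix x assume x: "x \<in> V"
    have "((\<lambda>x. x + 2 * pi * \<i>) has_field_derivative 1) (at x)"
      by (rule DERIV_cong, rule DERIV_add[OF DERIV_ident DERIV_const]) simp
    from DERIV_diff[OF DERIV_chain2[OF G[OF trans1[OF x]] this] G[OF x]] per[OF x]
    show "((\<lambda>x. G (x + 2 * pi * \<i>) - G x) has_field_derivative 0) (at x)"
      by simp
  qed (use V convex_connected in auto)
  then obtain c where c: "\<And>x. x \<in> V \<Longrightarrow> G (x + 2 * pi * \<i>) - G x = c"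
    by (auto simp: constant_on_def)
  show ?thesis
    unfolding mean[OF xy(1)] mean[OF xy(2)] c[OF xy(1)] c[OF xy(2)] ..
qed

definition exp2 :: "complex \<times> complex \<Rightarrow> complex \<times> complex" where
  "exp2 x = (exp (fst x), exp (snd x))"

text \<open>In logarithmic coordinates \<open>F\<close> is periodic and holomorphic in each variable, so its average over
  the torus does not change when one coordinate moves inside its (convex) slice. It is therefore
  locally constant on the convex set \<open>L\<close>.\<close>

lemma torus_mean_constant:
  fixes F :: "complex \<times> complex \<Rightarrow> complex"
  assumes L: "convex L" "open L"
    and trans: "\<And>x1 x2 t u. (x1, x2) \<in> L \<Longrightarrow> (x1 + \<i> * of_real t, x2 + \<i> * of_real u) \<in> L"
    and F [measurable]: "F \<in> borel_measurable borel"
    and hol: "\<And>x. x \<in> L \<Longrightarrow> holo_at F (exp2 x)"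
    and xy: "x \<in> L" "y \<in> L"
  shows "(\<integral>e. F (pmul e (exp2 x)) \<partial>torus_measure) = (\<integral>e. F (pmul e (exp2 y)) \<partial>torus_measure)"
proof -
  have F2 [measurable]: "F \<in> borel_measurable (borel \<Otimes>\<^sub>M borel)"
    unfolding borel_prod by simp
  have Fs [measurable]: "(\<lambda>e. F (e * a, w)) \<in> borel_measurable borel" "(\<lambda>e. F (w, e * a)) \<in> borel_measurable borel" for a w
    by measurable
  have cis_exp: "cis (2 * pi * t) * exp x = exp (x + 2 * pi * \<i> * t)" for t x
    by (simp add: cis_conv_exp exp_add mult_ac)
  have rot: "\<exists>t. e * exp x = exp (x + \<i> * of_real t)" if e: "norm e = 1" for e x
  proof -
    have "e = exp (\<i> * of_real (Arg2pi e))"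
      using e complex_norm_eq_1_exp[of e] by simp
    then have "e * exp x = exp (x + \<i> * of_real (Arg2pi e))"
      by (metis exp_add mult.commute)
    then show ?thesis ..
  qed
  have holo: "holo_at F (a * exp x1, b * exp x2)" if xL: "(x1, x2) \<in> L" and ab: "norm a = 1" "norm b = 1" for a b x1 x2
  proof -
    obtain t u where "a * exp x1 = exp (x1 + \<i> * of_real t)" "b * exp x2 = exp (x2 + \<i> * of_real u)"
      using rot[OF ab(1)] rot[OF ab(2)] by metis
    then show ?thesis
      using hol[OF trans[OF xL, of t u]] by (simp add: exp2_def)
  qed
  have int: "integrable torus_measure (\<lambda>e. F (pmul e (exp2 x)))" if "x \<in> L" for x
  proof (rule integrable_torus)
    show "continuous_on torus (\<lambda>e. F (pmul e (exp2 x)))"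
    proof (intro continuous_at_imp_continuous_on ballI)
      fix e assume "e \<in> torus"
      then have "isCont F (pmul e (exp2 x))"
        using holo[of "fst x" "snd x" "fst e" "snd e"] that
        by (intro holo_at_imp_continuous) (simp add: pmul_def exp2_def torus_iff)
      moreover have "isCont (\<lambda>e. pmul e (exp2 x)) e"
        unfolding pmul_def by (intro continuous_intros)
      ultimately show "isCont (\<lambda>e. F (pmul e (exp2 x))) e"
        by (rule isCont_o2[rotated])
    qed
  qed measurable
  define c where "c x = (\<integral>e. F (pmul e (exp2 x)) \<partial>torus_measure)" for x
  have c_fst: "c (x1, x2) = (\<integral>a. \<integral>b. F (a * exp x1, b * exp x2) \<partial>circle_measure \<partial>circle_measure)"
    and c_snd: "c (x1, x2) = (\<integral>b. \<integral>a. F (a * exp x1, b * exp x2) \<partial>circle_measure \<partial>circle_measure)"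
    if "(x1, x2) \<in> L" for x1 x2
  proof -
    have i: "integrable (circle_measure \<Otimes>\<^sub>M circle_measure) (\<lambda>e. F (pmul e (exp2 (x1, x2))))"
      using int[OF that] by (simp add: torus_measure_def)
    show "c (x1, x2) = (\<integral>a. \<integral>b. F (a * exp x1, b * exp x2) \<partial>circle_measure \<partial>circle_measure)"
      unfolding c_def torus_measure_def
      by (subst torus.integral_fst'[OF i, symmetric]) (simp add: pmul_def exp2_def)
    have i': "integrable (circle_measure \<Otimes>\<^sub>M circle_measure) (\<lambda>(a, b). F (a * exp x1, b * exp x2))"
      using i by (simp add: pmul_def exp2_def case_prod_beta')
    show "c (x1, x2) = (\<integral>b. \<integral>a. F (a * exp x1, b * exp x2) \<partial>circle_measure \<partial>circle_measure)"
      using torus.integral_snd[OF i'] unfolding c_def torus_measure_def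
      by (simp add: pmul_def exp2_def case_prod_beta')
  qed
  have move_fst: "c (x1, x2) = c (y1, x2)" if "(x1, x2) \<in> L" "(y1, x2) \<in> L" for x1 y1 x2
  proof -
    let ?V = "(\<lambda>x. (x, x2)) -` L"
    have V: "convex ?V" "open ?V"
    proof -
      have "?V = fst ` (L \<inter> UNIV \<times> {x2})" by force
      then show "convex ?V"
        using L(1) by (auto intro!: convex_linear_image linear_fst convex_Int convex_Times)
      show "open ?V"
        using L(2) by (intro open_vimage continuous_intros)
    qed
    have eq: "(\<integral>a. F (a * exp x1, b * exp x2) \<partial>circle_measure) = (\<integral>a. F (a * exp y1, b * exp x2) \<partial>circle_measure)"
      if b: "norm b = 1" for b
    proof -
      have "(LINT t:{0..1}|lborel. F (exp (x1 + 2 * pi * \<i> * complex_of_real t), b * exp x2)) =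
          (LINT t:{0..1}|lborel. F (exp (y1 + 2 * pi * \<i> * complex_of_real t), b * exp x2))"
      proof (rule period_mean_constant[OF V])
        fix x assume "x \<in> ?V"
        then show "(\<lambda>x. F (exp x, b * exp x2)) field_differentiable at x"
          using holo[of x x2 1 b] b by (intro holo_at_fst_slice) simp
      next
        fix x t assume "x \<in> ?V"
        then show "x + \<i> * complex_of_real t \<in> ?V"
          using trans[of x x2 t 0] by simp
      qed (use that \<open>(x1, x2) \<in> L\<close> \<open>(y1, x2) \<in> L\<close> in \<open>auto simp: exp_add\<close>)
      then show ?thesis
        by (simp add: integral_circle cis_exp)
    qed
    show ?thesis
      unfolding c_snd[OF that(1)] c_snd[OF that(2)]
    proof (rule integral_cong_AE)
      show "AE b in circle_measure. (\<integral>a. F (a * exp x1, b * exp x2) \<partial>circle_measure) = (\<integral>a. F (a * exp y1, b * exp x2) \<partial>circle_measure)"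
        using AE_circle by eventually_elim (rule eq)
    qed measurable
  qed
  have move_snd: "c (x1, x2) = c (x1, y2)" if "(x1, x2) \<in> L" "(x1, y2) \<in> L" for x1 x2 y2
  proof -
    let ?V = "(\<lambda>x. (x1, x)) -` L"
    have V: "convex ?V" "open ?V"
    proof -
      have "?V = snd ` (L \<inter> {x1} \<times> UNIV)" by force
      then show "convex ?V"
        using L(1) by (auto intro!: convex_linear_image linear_snd convex_Int convex_Times)
      show "open ?V"
        using L(2) by (intro open_vimage continuous_intros)
    qed
    have eq: "(\<integral>b. F (a * exp x1, b * exp x2) \<partial>circle_measure) = (\<integral>b. F (a * exp x1, b * exp y2) \<partial>circle_measure)"
      if a: "norm a = 1" for a
    proof -
      have "(LINT t:{0..1}|lborel. F (a * exp x1, exp (x2 + 2 * pi * \<i> * complex_of_real t))) =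
          (LINT t:{0..1}|lborel. F (a * exp x1, exp (y2 + 2 * pi * \<i> * complex_of_real t)))"
      proof (rule period_mean_constant[OF V])
        fix x assume "x \<in> ?V"
        then show "(\<lambda>x. F (a * exp x1, exp x)) field_differentiable at x"
          using holo[of x1 x a 1] a by (intro holo_at_snd_slice) simp
      next
        fix x t assume "x \<in> ?V"
        then show "x + \<i> * complex_of_real t \<in> ?V"
          using trans[of x1 x 0 t] by simp
      qed (use that \<open>(x1, x2) \<in> L\<close> \<open>(x1, y2) \<in> L\<close> in \<open>auto simp: exp_add\<close>)
      then show ?thesis
        by (simp add: integral_circle cis_exp)
    qed
    show ?thesis
      unfolding c_fst[OF that(1)] c_fst[OF that(2)]
    proof (rule integral_cong_AE)
      show "AE a in circle_measure. (\<integral>b. F (a * exp x1, b * exp x2) \<partial>circle_measure) = (\<integral>b. F (a * exp x1, b * exp y2) \<partial>circle_measure)"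
        using AE_circle by eventually_elim (rule eq)
    qed measurable
  qed
  have "c x = c y"
  proof (rule connected_local_const[OF convex_connected[OF L(1)] xy], rule ballI)
    fix x assume "x \<in> L"
    then obtain A B where AB: "open A" "open B" "x \<in> A \<times> B" "A \<times> B \<subseteq> L"
      using open_prod_elim[OF L(2)] by metis
    have "c x = c y" if "y \<in> A \<times> B" for y
    proof -
      have "c (fst x, snd x) = c (fst y, snd x)"
        using AB that by (intro move_fst) auto
      also have "\<dots> = c (fst y, snd y)"
        using AB that by (intro move_snd) auto
      finally show ?thesis by simp
    qed
    moreover have "eventually (\<lambda>y. y \<in> A \<times> B) (at x within L)"
      by (rule filter_leD[OF at_within_le_nhds eventually_nhds_in_open[OF open_Times[OF AB(1,2)] AB(3)]])
    ultimately show "eventually (\<lambda>y. c x = c y) (at x within L)"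
      by (auto elim: eventually_mono)
  qed
  then show ?thesis by (simp add: c_def)
qed

section \<open>Integrals of exponentials over a wedge\<close>

text \<open>The infinite value is kept because it is what later rules out the monomials that are not square
  integrable.\<close>

lemma nn_integral_exp_halfline:
  fixes a :: real
  shows "(\<integral>\<^sup>+y. ennreal (exp (- a * y)) * indicator {0<..} y \<partial>lborel) = (if a > 0 then ennreal (1 / a) else \<infinity>)"
proof (cases "a > 0")
  case True
  have "(\<integral>\<^sup>+y. ennreal (exp (- a * y)) * indicator {0<..} y \<partial>lborel) =
      (\<integral>\<^sup>+y. ennreal (exp (- a * y)) * indicator {0..} y \<partial>lborel)"
  proof (rule nn_integral_cong_AE)
    show "AE y in lborel. ennreal (exp (- a * y)) * indicator {0<..} y =
        ennreal (exp (- a * y)) * indicator {0..} y"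
      using AE_lborel_singleton[of 0] by eventually_elim (auto split: split_indicator)
  qed
  also have "\<dots> = ennreal (0 - (- (1 / a) * exp (- a * 0)))"
  proof (rule nn_integral_FTC_atLeast)
    have "filterlim (\<lambda>y. - a * y) at_bot at_top"
      using True by (intro filterlim_tendsto_neg_mult_at_bot[OF tendsto_const] filterlim_ident) auto
    from tendsto_mult[OF tendsto_const[of "- (1 / a)"] filterlim_compose[OF exp_at_bot this]]
    show "((\<lambda>y. - (1 / a) * exp (- a * y)) \<longlongrightarrow> 0) at_top" by simp
    show "((\<lambda>y. - (1 / a) * exp (- a * y)) has_real_derivative exp (- a * y)) (at y)" for y
      using True by (auto intro!: derivative_eq_intros)
  qed auto
  finally show ?thesis using True by simp
next
  case False
  have "(\<integral>\<^sup>+y. indicator {0::real<..} y \<partial>lborel) \<le> (\<integral>\<^sup>+y. ennreal (exp (- a * y)) * indicator {0<..} y \<partial>lborel)"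
  proof (intro nn_integral_mono)
    fix y :: real
    have "1 \<le> exp (- a * y)" if "y > 0"
      using False that by (simp add: mult_nonpos_nonneg)
    then have "1 \<le> ennreal (exp (- a * y))" if "y > 0"
      using that ennreal_leI[of 1] by simp
    then show "indicator {0<..} y \<le> ennreal (exp (- a * y)) * indicator {0<..} y"
      by (auto split: split_indicator)
  qed
  moreover have "(\<integral>\<^sup>+y. indicator {0::real<..} y \<partial>lborel) = (\<infinity> :: ennreal)"
  proof (rule ccontr)
    assume "(\<integral>\<^sup>+y. indicator {0::real<..} y \<partial>lborel) \<noteq> (\<infinity> :: ennreal)"
    then obtain n where n: "emeasure lborel {0::real<..} < of_nat n"
      using ennreal_Ex_less_of_nat by (auto simp: less_top)
    have "emeasure lborel {0<..real n} \<le> emeasure lborel {0::real<..}"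
      by (intro emeasure_mono) auto
    then show False
      using n by (simp add: ennreal_of_nat_eq_real_of_nat)
  qed
  ultimately show ?thesis using False by (simp add: top_unique)
qed

lemma nn_integral_log_radius:
  assumes [measurable]: "g \<in> borel_measurable borel"
  shows "(\<integral>\<^sup>+z. g (- ln ((cmod z)\<^sup>2)) \<partial>lborel) = (\<integral>\<^sup>+x. ennreal (pi * exp (- x)) * g x \<partial>lborel)"
proof -
  have "(\<integral>\<^sup>+z. g (- ln ((cmod z)\<^sup>2)) \<partial>lborel) = (\<integral>\<^sup>+x. g x \<partial>distr (lborel :: complex measure) borel (\<lambda>z. - ln ((cmod z)\<^sup>2)))"
    by (subst nn_integral_distr) auto
  also have "\<dots> = (\<integral>\<^sup>+x. ennreal (pi * exp (- x)) * g x \<partial>lborel)"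
    unfolding distr_log_radius by (subst nn_integral_density) auto
  finally show ?thesis .
qed

lemma nn_integral_log_radius2:
  assumes [measurable]: "(\<lambda>(x, y). g x y) \<in> borel_measurable (borel \<Otimes>\<^sub>M borel)"
  shows "(\<integral>\<^sup>+z. g (- ln ((cmod (fst z))\<^sup>2)) (- ln ((cmod (snd z))\<^sup>2)) \<partial>lborel) =
    ennreal (pi\<^sup>2) * (\<integral>\<^sup>+y. \<integral>\<^sup>+x. ennreal (exp (- (x + y))) * g x y \<partial>lborel \<partial>lborel)"
proof -
  have "(\<integral>\<^sup>+z. g (- ln ((cmod (fst z))\<^sup>2)) (- ln ((cmod (snd z))\<^sup>2)) \<partial>lborel) =
      (\<integral>\<^sup>+z2. \<integral>\<^sup>+z1. g (- ln ((cmod z1)\<^sup>2)) (- ln ((cmod z2)\<^sup>2)) \<partial>lborel \<partial>lborel)"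
    unfolding lborel_prod[symmetric]
    by (subst lborel_pair.nn_integral_snd[symmetric]) (simp_all add: case_prod_beta')
  also have "\<dots> = (\<integral>\<^sup>+z2. \<integral>\<^sup>+x. ennreal (pi * exp (- x)) * g x (- ln ((cmod z2)\<^sup>2)) \<partial>lborel \<partial>lborel)"
    by (intro nn_integral_cong nn_integral_log_radius) measurable
  also have "\<dots> = (\<integral>\<^sup>+y. ennreal (pi * exp (- y)) * (\<integral>\<^sup>+x. ennreal (pi * exp (- x)) * g x y \<partial>lborel) \<partial>lborel)"
    by (rule nn_integral_log_radius) measurable
  also have "\<dots> = (\<integral>\<^sup>+y. \<integral>\<^sup>+x. ennreal (pi\<^sup>2) * (ennreal (exp (- (x + y))) * g x y) \<partial>lborel \<partial>lborel)"
  proof (rule nn_integral_cong)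
    fix y :: real
    have "ennreal (pi * exp (- y)) * (\<integral>\<^sup>+x. ennreal (pi * exp (- x)) * g x y \<partial>lborel) =
        (\<integral>\<^sup>+x. ennreal (pi * exp (- y)) * (ennreal (pi * exp (- x)) * g x y) \<partial>lborel)"
      by (rule nn_integral_cmult[symmetric]) measurable
    also have "\<dots> = (\<integral>\<^sup>+x. ennreal (pi\<^sup>2) * (ennreal (exp (- (x + y))) * g x y) \<partial>lborel)"
    proof (rule nn_integral_cong)
      fix x :: real
      have "(pi * exp (- y)) * (pi * exp (- x)) = pi\<^sup>2 * exp (- (x + y))"
        using exp_add[of "- x" "- y"] by (simp add: power2_eq_square mult_ac)
      then have "ennreal (pi * exp (- y)) * ennreal (pi * exp (- x)) = ennreal (pi\<^sup>2) * ennreal (exp (- (x + y)))"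
        by (simp add: ennreal_mult[symmetric])
      then show "ennreal (pi * exp (- y)) * (ennreal (pi * exp (- x)) * g x y) =
          ennreal (pi\<^sup>2) * (ennreal (exp (- (x + y))) * g x y)"
        by (simp only: mult.assoc[symmetric])
    qed
    finally show "ennreal (pi * exp (- y)) * (\<integral>\<^sup>+x. ennreal (pi * exp (- x)) * g x y \<partial>lborel) =
       (\<integral>\<^sup>+x. ennreal (pi\<^sup>2) * (ennreal (exp (- (x + y))) * g x y) \<partial>lborel)" .
  qed
  also have "\<dots> = ennreal (pi\<^sup>2) * (\<integral>\<^sup>+y. \<integral>\<^sup>+x. ennreal (exp (- (x + y))) * g x y \<partial>lborel \<partial>lborel)"
    by (simp add: nn_integral_cmult)
  finally show ?thesis .
qed

text \<open>The substitutions \<open>x = (q y + u) / p\<close> and then \<open>y = (s u + v) / (p r - q s)\<close> map the wedge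
  to a quadrant.\<close>

lemma nn_integral_exp_wedge:
  fixes p q r s a b :: real
  assumes p: "p > 0" and d: "p * r - q * s > 0"
  shows "(\<integral>\<^sup>+y. \<integral>\<^sup>+x. ennreal (exp (- (a * x + b * y))) * (if q * y < p * x \<and> s * x < r * y then 1 else 0) \<partial>lborel \<partial>lborel) =
    (if r * a + s * b > 0 \<and> q * a + p * b > 0
     then ennreal ((p * r - q * s) / ((r * a + s * b) * (q * a + p * b))) else \<infinity>)"
proof -
  define d where "d = p * r - q * s"
  have d0: "d > 0" using d by (simp add: d_def)
  let ?A = "(r * a + s * b) / d" and ?B = "(q * a + p * b) / (p * d)"
  let ?f = "\<lambda>x y. ennreal (exp (- (a * x + b * y))) * (if q * y < p * x \<and> s * x < r * y then 1 else 0)"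
  have cond1: "q * y < p * (q / p * y + 1 / p * u) \<longleftrightarrow> u > 0" for u y
    using p by (simp add: field_simps zero_less_mult_iff)
  have cond2: "s * (q / p * y + 1 / p * u) < r * y \<longleftrightarrow> s * u < d * y" for u y
  proof -
    have "s * (q / p * y + 1 / p * u) < r * y \<longleftrightarrow> p * (s * (q / p * y + 1 / p * u)) < p * (r * y)"
      by (rule mult_less_cancel_left_pos[OF p, symmetric])
    also have "p * (s * (q / p * y + 1 / p * u)) = s * q * y + s * u"
      using p by (simp add: field_simps)
    also have "s * q * y + s * u < p * (r * y) \<longleftrightarrow> s * u < d * y"
      by (simp add: d_def algebra_simps)
    finally show ?thesis .
  qed
  have cond3: "s * u < d * (s / d * u + 1 / d * v) \<longleftrightarrow> v > 0" for u v
    using d0 by (simp add: field_simps zero_less_mult_iff)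
  have expo: "a * (q / p * (s / d * u + 1 / d * v) + 1 / p * u) + b * (s / d * u + 1 / d * v) = ?A * u + ?B * v" for u v
  proof -
    have "p * d * (a * (q / p * (s / d * u + 1 / d * v) + 1 / p * u) + b * (s / d * u + 1 / d * v)) =
        a * (q * (s * u + v) + d * u) + p * b * (s * u + v)"
      using p d0 by (simp add: field_simps)
    also have "\<dots> = p * (r * a + s * b) * u + (q * a + p * b) * v"
      by (simp add: d_def algebra_simps)
    also have "\<dots> = p * d * (?A * u + ?B * v)"
      using p d0 by (simp add: field_simps)
    finally show ?thesis using p d0 by simp
  qed
  have "(\<integral>\<^sup>+y. \<integral>\<^sup>+x. ?f x y \<partial>lborel \<partial>lborel) =
      (\<integral>\<^sup>+y. ennreal (1 / p) * (\<integral>\<^sup>+u. ?f (q / p * y + 1 / p * u) y \<partial>lborel) \<partial>lborel)"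
    using p by (intro nn_integral_cong, subst nn_integral_real_affine[where c = "1 / p"]) auto
  also have "\<dots> = ennreal (1 / p) * (\<integral>\<^sup>+y. \<integral>\<^sup>+u. ?f (q / p * y + 1 / p * u) y \<partial>lborel \<partial>lborel)"
    by (simp add: nn_integral_cmult)
  also have "(\<integral>\<^sup>+y. \<integral>\<^sup>+u. ?f (q / p * y + 1 / p * u) y \<partial>lborel \<partial>lborel) =
      (\<integral>\<^sup>+u. \<integral>\<^sup>+y. ?f (q / p * y + 1 / p * u) y \<partial>lborel \<partial>lborel)"
    by (intro lborel_pair.Fubini') measurable
  also have "\<dots> = (\<integral>\<^sup>+u. ennreal (1 / d) * (\<integral>\<^sup>+v. ?f (q / p * (s / d * u + 1 / d * v) + 1 / p * u) (s / d * u + 1 / d * v) \<partial>lborel) \<partial>lborel)"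
  proof (rule nn_integral_cong)
    fix u :: real
    have "(\<integral>\<^sup>+y. ?f (q / p * y + 1 / p * u) y \<partial>lborel) = ennreal \<bar>1 / d\<bar> *
       (\<integral>\<^sup>+v. ?f (q / p * (s / d * u + 1 / d * v) + 1 / p * u) (s / d * u + 1 / d * v) \<partial>lborel)"
      using d0 by (intro nn_integral_real_affine) auto
    then show "(\<integral>\<^sup>+y. ?f (q / p * y + 1 / p * u) y \<partial>lborel) = ennreal (1 / d) *
       (\<integral>\<^sup>+v. ?f (q / p * (s / d * u + 1 / d * v) + 1 / p * u) (s / d * u + 1 / d * v) \<partial>lborel)"
      using d0 by simp
  qed
  also have "\<dots> = (\<integral>\<^sup>+u. ennreal (1 / d) * (\<integral>\<^sup>+v. (ennreal (exp (- ?A * u)) * indicator {0<..} u) *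
       (ennreal (exp (- ?B * v)) * indicator {0<..} v) \<partial>lborel) \<partial>lborel)"
  proof -
    have "?f (q / p * (s / d * u + 1 / d * v) + 1 / p * u) (s / d * u + 1 / d * v) =
        (ennreal (exp (- ?A * u)) * indicator {0<..} u) * (ennreal (exp (- ?B * v)) * indicator {0<..} v)" for u v
      unfolding cond1 cond2 cond3 expo
      by (simp add: ennreal_mult[symmetric] exp_add[symmetric] split: split_indicator)
    then show ?thesis by simp
  qed
  also have "\<dots> = ennreal (1 / d) * ((\<integral>\<^sup>+u. ennreal (exp (- ?A * u)) * indicator {0<..} u \<partial>lborel) *
       (\<integral>\<^sup>+v. ennreal (exp (- ?B * v)) * indicator {0<..} v \<partial>lborel))"
    by (simp add: nn_integral_cmult nn_integral_multc)
  also have "\<dots> = ennreal (1 / d) * ((if ?A > 0 then ennreal (1 / ?A) else \<infinity>) * (if ?B > 0 then ennreal (1 / ?B) else \<infinity>))"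
    by (simp only: nn_integral_exp_halfline)
  finally have "(\<integral>\<^sup>+y. \<integral>\<^sup>+x. ?f x y \<partial>lborel \<partial>lborel) =
      ennreal (1 / p) * (ennreal (1 / d) * ((if ?A > 0 then ennreal (1 / ?A) else \<infinity>) * (if ?B > 0 then ennreal (1 / ?B) else \<infinity>)))" .
  also have "\<dots> = (if r * a + s * b > 0 \<and> q * a + p * b > 0
     then ennreal (d / ((r * a + s * b) * (q * a + p * b))) else \<infinity>)"
  proof -
    have AB: "?A > 0 \<longleftrightarrow> r * a + s * b > 0" "?B > 0 \<longleftrightarrow> q * a + p * b > 0"
      using p d0 by (simp_all add: pos_less_divide_eq[OF d0] pos_less_divide_eq[OF mult_pos_pos[OF p d0]])
    show ?thesis
      unfolding AB using p d0
      by (auto simp: ennreal_mult[symmetric] ennreal_mult_eq_top_iff ennreal_top_mult ennreal_mult_top)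
  qed
  finally show ?thesis by (simp add: d_def)
qed

section \<open>Averages over the torus\<close>

lemma AE_lborel_coordinates_nonzero: "AE z in (lborel :: (complex \<times> complex) measure). fst z \<noteq> 0 \<and> snd z \<noteq> 0"
  unfolding lborel_prod[symmetric]
proof (rule lborel_pair.AE_pair_measure)
  show "{x \<in> space (lborel \<Otimes>\<^sub>M lborel). fst x \<noteq> (0::complex) \<and> snd x \<noteq> (0::complex)} \<in> sets (lborel \<Otimes>\<^sub>M lborel)"
    by measurable
  show "AE x in lborel. AE y in lborel. fst (x, y) \<noteq> (0::complex) \<and> snd (x, y) \<noteq> (0::complex)"
    using AE_lborel_singleton[of "0::complex"]
    by eventually_elim (use AE_lborel_singleton[of "0::complex"] in \<open>auto elim: eventually_mono\<close>)
qed

interpretation torus_lborel: pair_sigma_finite torus_measure "lborel :: (complex \<times> complex) measure" ..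

lemma integral_pmul:
  fixes \<Phi> :: "complex \<times> complex \<Rightarrow> 'a :: {banach, second_countable_topology}"
  assumes [measurable]: "\<Phi> \<in> borel_measurable borel" and e: "e \<in> torus"
  shows "(\<integral>z. \<Phi> (pmul e z) \<partial>lborel) = (\<integral>z. \<Phi> z \<partial>lborel)"
proof -
  have "(\<integral>z. \<Phi> z \<partial>lborel) = (\<integral>z. \<Phi> z \<partial>distr lborel borel (pmul e))"
    using e by (simp add: lborel_pmul_invariant torus_iff)
  also have "\<dots> = (\<integral>z. \<Phi> (pmul e z) \<partial>lborel)"
    by (subst integral_distr) auto
  finally show ?thesis by simp
qed

lemma integrable_pmul:
  fixes \<Phi> :: "complex \<times> complex \<Rightarrow> 'a :: {banach, second_countable_topology}"
  assumes int: "integrable lborel \<Phi>" and e: "e \<in> torus"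
  shows "integrable lborel (\<lambda>z. \<Phi> (pmul e z))"
proof -
  have "integrable (distr lborel borel (pmul e)) \<Phi>"
    using e int by (simp add: lborel_pmul_invariant torus_iff)
  then show ?thesis
    by (subst (asm) integrable_distr_eq) (use int in auto)
qed

text \<open>By rotation invariance the integral of \<open>|\<Phi>(e z)|\<close> over \<open>z\<close> is the same for every \<open>e\<close>, so Tonelli's
  theorem applies.\<close>

lemma integrable_torus_pair:
  fixes \<Phi> :: "complex \<times> complex \<Rightarrow> 'a :: {banach, second_countable_topology}"
  assumes int: "integrable lborel \<Phi>"
  shows "integrable (torus_measure \<Otimes>\<^sub>M lborel) (\<lambda>v. \<Phi> (pmul (fst v) (snd v)))"
proof (rule torus_lborel.Fubini_integrable)
  have [measurable]: "\<Phi> \<in> borel_measurable borel" using int by simp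
  show "(\<lambda>v. \<Phi> (pmul (fst v) (snd v))) \<in> borel_measurable (torus_measure \<Otimes>\<^sub>M lborel)"
    by measurable
  show "AE e in torus_measure. integrable lborel (\<lambda>z. \<Phi> (pmul (fst (e, z)) (snd (e, z))))"
    using AE_torus by eventually_elim (simp add: integrable_pmul int)
  show "integrable torus_measure (\<lambda>e. \<integral>z. norm (\<Phi> (pmul (fst (e, z)) (snd (e, z)))) \<partial>lborel)"
  proof (rule torus.integrable_const_bound)
    show "AE e in torus_measure. norm (\<integral>z. norm (\<Phi> (pmul (fst (e, z)) (snd (e, z)))) \<partial>lborel) \<le> (\<integral>z. norm (\<Phi> z) \<partial>lborel)"
      using AE_torus by eventually_elim (simp add: integral_pmul[of "\<lambda>z. norm (\<Phi> z)"])
  qed measurable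
qed

lemma integral_torus_average:
  fixes \<Phi> :: "complex \<times> complex \<Rightarrow> complex"
  assumes int: "integrable lborel \<Phi>"
  shows "(\<integral>z. \<Phi> z \<partial>lborel) = (\<integral>z. \<integral>e. \<Phi> (pmul e z) \<partial>torus_measure \<partial>lborel)"
proof -
  have [measurable]: "\<Phi> \<in> borel_measurable borel" using int by simp
  have "(\<integral>z. \<integral>e. \<Phi> (pmul e z) \<partial>torus_measure \<partial>lborel) = (\<integral>e. \<integral>z. \<Phi> (pmul e z) \<partial>lborel \<partial>torus_measure)"
    using integrable_torus_pair[OF int]
    by (intro torus_lborel.Fubini_integral) (simp add: case_prod_beta')
  also have "\<dots> = (\<integral>e. (\<integral>z. \<Phi> z \<partial>lborel) \<partial>torus_measure)"
  proof (rule integral_cong_AE)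
    show "AE e in torus_measure. (\<integral>z. \<Phi> (pmul e z) \<partial>lborel) = (\<integral>z. \<Phi> z \<partial>lborel)"
      using AE_torus by eventually_elim (simp add: integral_pmul)
  qed measurable
  also have "\<dots> = (\<integral>z. \<Phi> z \<partial>lborel)"
    by (simp add: measure_torus)
  finally show ?thesis by simp
qed

lemma integrable_mult_L2:
  fixes F G :: "'a \<Rightarrow> complex"
  assumes "F \<in> borel_measurable M" "G \<in> borel_measurable M"
    and "integrable M (\<lambda>z. (norm (F z))\<^sup>2)" "integrable M (\<lambda>z. (norm (G z))\<^sup>2)"
  shows "integrable M (\<lambda>z. F z * G z)"
proof (rule Bochner_Integration.integrable_bound)
  show "integrable M (\<lambda>z. (norm (F z))\<^sup>2 + (norm (G z))\<^sup>2)"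
    using assms by simp
  have "x * y \<le> x\<^sup>2 + y\<^sup>2" if "x \<ge> 0" "y \<ge> 0" for x y :: real
    using sum_squares_bound[of x y] mult_nonneg_nonneg[OF that] by linarith
  then show "AE z in M. norm (F z * G z) \<le> norm ((norm (F z))\<^sup>2 + (norm (G z))\<^sup>2)"
    by (simp add: norm_mult)
qed (use assms in simp)

lemma integrable_torus_pair_L2:
  fixes F G :: "complex \<times> complex \<Rightarrow> complex"
  assumes [measurable]: "F \<in> borel_measurable borel" "G \<in> borel_measurable borel"
    and F: "integrable lborel (\<lambda>z. (norm (F z))\<^sup>2)" and G: "integrable lborel (\<lambda>z. (norm (G z))\<^sup>2)"
  shows "integrable (torus_measure \<Otimes>\<^sub>M lborel) (\<lambda>v. F (pmul (fst v) (snd v)) * G (snd v) * zmon m (fst v))"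
proof (rule Bochner_Integration.integrable_bound)
  let ?P = "torus_measure \<Otimes>\<^sub>M (lborel :: (complex \<times> complex) measure)"
  have 1: "integrable ?P (\<lambda>v. (norm (F (pmul (fst v) (snd v))))\<^sup>2)"
    by (rule integrable_torus_pair[OF F])
  have 2: "integrable ?P (\<lambda>v. (norm (G (snd v)))\<^sup>2)"
  proof (rule torus_lborel.Fubini_integrable)
    show "(\<lambda>v. (norm (G (snd v)))\<^sup>2) \<in> borel_measurable ?P" by measurable
  qed (use G in simp_all)
  show "integrable ?P (\<lambda>v. F (pmul (fst v) (snd v)) * G (snd v))"
    by (rule integrable_mult_L2[OF _ _ 1 2]) measurable
  have "AE v in ?P. fst v \<in> torus"
  proof (rule torus_lborel.AE_pair_measure)
    show "{x \<in> space ?P. fst x \<in> torus} \<in> sets ?P" by measurable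
    show "AE x in torus_measure. AE y in (lborel :: (complex \<times> complex) measure). fst (x, y) \<in> torus"
      using AE_torus by eventually_elim simp
  qed
  then show "AE v in ?P. norm (F (pmul (fst v) (snd v)) * G (snd v) * zmon m (fst v)) \<le>
      norm (F (pmul (fst v) (snd v)) * G (snd v))"
    by eventually_elim (simp add: norm_mult norm_zmon_torus)
qed measurable

text \<open>Jensen's inequality for the square, from \<open>2 b x \<le> b\<^sup>2 + x\<^sup>2\<close> with \<open>b\<close> the average of \<open>|g|\<close>.\<close>

lemma norm_torus_mean_square_le:
  fixes g :: "complex \<times> complex \<Rightarrow> complex"
  assumes g: "integrable torus_measure g" and g2: "integrable torus_measure (\<lambda>e. (norm (g e))\<^sup>2)"
  shows "(norm (\<integral>e. g e \<partial>torus_measure))\<^sup>2 \<le> (\<integral>e. (norm (g e))\<^sup>2 \<partial>torus_measure)"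
proof -
  define b where "b = (\<integral>e. norm (g e) \<partial>torus_measure)"
  have "(\<integral>e. 2 * b * norm (g e) \<partial>torus_measure) \<le> (\<integral>e. b\<^sup>2 + (norm (g e))\<^sup>2 \<partial>torus_measure)"
    using g g2 sum_squares_bound[of b] by (intro integral_mono) auto
  then have "2 * b\<^sup>2 \<le> (\<integral>e. (norm (g e))\<^sup>2 \<partial>torus_measure) + b\<^sup>2"
    using g g2 by (simp add: b_def[symmetric] measure_torus power2_eq_square mult.assoc)
  moreover have "norm (\<integral>e. g e \<partial>torus_measure) \<le> b"
    unfolding b_def by (rule integral_norm_bound)
  then have "(norm (\<integral>e. g e \<partial>torus_measure))\<^sup>2 \<le> b\<^sup>2"
    by (intro power_mono) auto
  ultimately show ?thesis by simp
qed

section \<open>The domain and the norms of its monomials\<close>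

text \<open>The four exponents are the entries of \<open>A\<close>, and the assumption says that its determinant is positive.\<close>

locale monomial_wedge =
  fixes p q r s :: nat
  assumes wedge: "q * s < p * r"
begin

definition U :: "(complex \<times> complex) set" where
  "U = {z. cmod (fst z) ^ p < cmod (snd z) ^ q \<and> cmod (snd z) ^ r < cmod (fst z) ^ s}"

text \<open>The determinant of \<open>A\<close>, and the pairings of \<open>m + (1, 1)\<close> with the two columns of \<open>A\<close>. The shift by
  \<open>(1, 1)\<close> comes from the area element in polar coordinates.\<close>

definition dt :: int where "dt = int p * int r - int q * int s"

definition al :: "int \<times> int \<Rightarrow> int" where
  "al m = int r * (fst m + 1) + int s * (snd m + 1)"

definition be :: "int \<times> int \<Rightarrow> int" where
  "be m = int q * (fst m + 1) + int p * (snd m + 1)"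

definition log_U :: "(complex \<times> complex) set" where
  "log_U = {x. p * Re (fst x) < q * Re (snd x) \<and> r * Re (snd x) < s * Re (fst x)}"

lemma dt_pos: "dt > 0"
proof -
  have "int (q * s) < int (p * r)"
    using wedge by (simp only: of_nat_less_iff)
  then show ?thesis by (simp add: dt_def)
qed

lemma p_pos: "p > 0" and r_pos: "r > 0"
  using wedge by (auto intro: gr0I)

lemma open_U: "open U"
  unfolding U_def by (intro open_Collect_conj open_Collect_less continuous_intros)

lemma U_borel [measurable]: "U \<in> sets borel"
  by (rule borel_open[OF open_U])

text \<open>A coordinate can vanish on the domain only if its exponent in the bound for the other coordinate
  is 0, by the convention \<open>0 ^ 0 = 1\<close>.\<close>

lemma U_fst_zero: "z \<in> U \<Longrightarrow> fst z = 0 \<Longrightarrow> s = 0"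
  and U_snd_zero: "z \<in> U \<Longrightarrow> snd z = 0 \<Longrightarrow> q = 0"
  using p_pos r_pos by (auto simp: U_def zero_power power_0_left not_less split: if_splits)

lemma pmul_U [simp]: "e \<in> torus \<Longrightarrow> pmul e z \<in> U \<longleftrightarrow> z \<in> U"
  by (simp add: U_def pmul_def norm_mult torus_iff)

lemma exp2_in_U: "exp2 x \<in> U \<longleftrightarrow> x \<in> log_U"
  by (simp add: U_def exp2_def log_U_def exp_of_nat_mult[symmetric])

lemma U_exp2: "z \<in> U \<Longrightarrow> fst z \<noteq> 0 \<Longrightarrow> snd z \<noteq> 0 \<Longrightarrow> \<exists>x\<in>log_U. z = exp2 x"
  by (rule bexI[of _ "(Ln (fst z), Ln (snd z))"]) (auto simp: exp2_in_U[symmetric] exp2_def)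

lemma open_log_U: "open log_U"
  unfolding log_U_def by (intro open_Collect_conj open_Collect_less continuous_intros)

lemma convex_log_U: "convex log_U"
proof -
  define l1 l2 :: "complex \<times> complex \<Rightarrow> real"
    where "l1 x = p * Re (fst x) - q * Re (snd x)" and "l2 x = r * Re (snd x) - s * Re (fst x)" for x
  have "linear l1" "linear l2"
    by (auto simp: l1_def l2_def intro!: linearI) (auto simp: algebra_simps)
  then have "convex (l1 -` {..<0} \<inter> l2 -` {..<0})"
    by (intro convex_Int convex_linear_vimage convex_real_interval)
  also have "l1 -` {..<0} \<inter> l2 -` {..<0} = log_U"
    by (auto simp: l1_def l2_def log_U_def)
  finally show ?thesis .
qed

text \<open>The integrand depends only on the moduli. In the coordinates \<open>x = - ln (|z\<^sub>1|\<^sup>2)\<close>, \<open>y = - ln (|z\<^sub>2|\<^sup>2)\<close>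
  the domain is a wedge and the monomial is an exponential.\<close>

lemma nn_integral_zmon:
  "(\<integral>\<^sup>+z. ennreal (indicator U z * (norm (zmon m z))\<^sup>2) \<partial>lborel) =
     (if al m > 0 \<and> be m > 0 then ennreal (pi\<^sup>2 * dt / (al m * be m)) else \<infinity>)"
proof -
  define a b where "a = real_of_int (fst m)" and "b = real_of_int (snd m)"
  define g where "g x y = (if real q * y < real p * x \<and> real s * x < real r * y then 1 else 0) * ennreal (exp (- (a * x + b * y)))"
    for x y :: real
  have [measurable]: "(\<lambda>(x, y). g x y) \<in> borel_measurable (borel \<Otimes>\<^sub>M borel)"
    unfolding g_def by measurable
  have pw: "ennreal (indicator U z * (norm (zmon m z))\<^sup>2) = g (- ln ((cmod (fst z))\<^sup>2)) (- ln ((cmod (snd z))\<^sup>2))"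
    if z: "fst z \<noteq> 0" "snd z \<noteq> 0" for z
  proof -
    define x y where "x = ln (cmod (fst z))" and "y = ln (cmod (snd z))"
    have ex: "cmod (fst z) = exp x" and ey: "cmod (snd z) = exp y"
      using z by (simp_all add: x_def y_def)
    have ln2: "- ln ((exp x)\<^sup>2) = - 2 * x" "- ln ((exp y)\<^sup>2) = - 2 * y"
      by (simp_all add: ln_realpow)
    have U: "z \<in> U \<longleftrightarrow> real q * (- 2 * y) < real p * (- 2 * x) \<and> real s * (- 2 * x) < real r * (- 2 * y)"
      by (auto simp: U_def ex ey exp_of_nat_mult[symmetric])
    have powi: "exp t powi k = exp (of_int k * t)" for t :: real and k
      by (simp add: exp_power_int mult.commute)
    have n: "(norm (zmon m z))\<^sup>2 = exp (- (a * (- 2 * x) + b * (- 2 * y)))"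
      unfolding norm_zmon ex ey powi by (simp add: exp_add[symmetric] exp_double[symmetric] a_def b_def algebra_simps)
    show ?thesis
      unfolding ex ey ln2 n g_def U[symmetric] by (simp split: split_indicator)
  qed
  have "(\<integral>\<^sup>+z. ennreal (indicator U z * (norm (zmon m z))\<^sup>2) \<partial>lborel) =
      (\<integral>\<^sup>+z. g (- ln ((cmod (fst z))\<^sup>2)) (- ln ((cmod (snd z))\<^sup>2)) \<partial>lborel)"
  proof (rule nn_integral_cong_AE)
    show "AE z in lborel. ennreal (indicator U z * (norm (zmon m z))\<^sup>2) = g (- ln ((cmod (fst z))\<^sup>2)) (- ln ((cmod (snd z))\<^sup>2))"
      using AE_lborel_coordinates_nonzero by eventually_elim (simp add: pw)
  qed
  also have "\<dots> = ennreal (pi\<^sup>2) * (\<integral>\<^sup>+y. \<integral>\<^sup>+x. ennreal (exp (- (x + y))) * g x y \<partial>lborel \<partial>lborel)"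
    by (rule nn_integral_log_radius2) measurable
  also have "(\<lambda>y x. ennreal (exp (- (x + y))) * g x y) =
      (\<lambda>(y::real) (x::real). ennreal (exp (- ((a + 1) * x + (b + 1) * y))) * (if q * y < p * x \<and> s * x < r * y then 1 else 0))"
    by (auto simp: fun_eq_iff g_def ennreal_mult[symmetric] exp_add[symmetric] algebra_simps)
  also have "(\<integral>\<^sup>+(y::real). \<integral>\<^sup>+(x::real). ennreal (exp (- ((a + 1) * x + (b + 1) * y))) * (if q * y < p * x \<and> s * x < r * y then 1 else 0) \<partial>lborel \<partial>lborel) =
    (if r * (a + 1) + s * (b + 1) > 0 \<and> q * (a + 1) + p * (b + 1) > 0
     then ennreal ((real p * real r - real q * real s) / ((r * (a + 1) + s * (b + 1)) * (q * (a + 1) + p * (b + 1)))) else \<infinity>)"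
  proof (rule nn_integral_exp_wedge)
    show "real p > 0" using p_pos by simp
    have "real (q * s) < real (p * r)" using wedge by (simp only: of_nat_less_iff)
    then show "real p * real r - real q * real s > 0" by simp
  qed
  also have "r * (a + 1) + s * (b + 1) = real_of_int (al m)"
    by (simp add: al_def a_def b_def)
  also have "q * (a + 1) + p * (b + 1) = real_of_int (be m)"
    by (simp add: be_def a_def b_def)
  also have "real p * real r - real q * real s = real_of_int dt"
    by (simp add: dt_def)
  finally show ?thesis
    using dt_pos by (simp add: ennreal_mult[symmetric] ennreal_mult_top)
qed

lemma integrable_zmon:
  assumes "al m > 0" "be m > 0"
  shows "integrable lborel (\<lambda>z. indicator U z * (norm (zmon m z))\<^sup>2)"
    and "(\<integral>z. indicator U z * (norm (zmon m z))\<^sup>2 \<partial>lborel) = pi\<^sup>2 * dt / (al m * be m)"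
proof -
  have 0: "pi\<^sup>2 * dt / (al m * be m) \<ge> 0"
    using dt_pos assms by simp
  have "has_bochner_integral lborel (\<lambda>z. indicator U z * (norm (zmon m z))\<^sup>2) (pi\<^sup>2 * dt / (al m * be m))"
    using nn_integral_zmon[of m] assms 0 by (intro has_bochner_integral_nn_integral) auto
  then show "integrable lborel (\<lambda>z. indicator U z * (norm (zmon m z))\<^sup>2)"
    and "(\<integral>z. indicator U z * (norm (zmon m z))\<^sup>2 \<partial>lborel) = pi\<^sup>2 * dt / (al m * be m)"
    by (auto simp: has_bochner_integral_iff)
qed


section \<open>Laurent coefficients of functions in the Bergman space\<close>

lemma cut_measurable:
  assumes "f holomorphic2_on U"
  shows "(\<lambda>z. indicator U z *\<^sub>R f z) \<in> borel_measurable borel"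
proof (rule borel_measurable_continuous_on_indicator)
  show "continuous_on U f"
    using assms by (intro continuous_at_imp_continuous_on) (auto simp: holomorphic2_on_iff holo_at_imp_continuous)
qed simp

lemma holo_at_cut:
  assumes "f holomorphic2_on U" "z \<in> U"
  shows "holo_at (\<lambda>z. indicator U z *\<^sub>R f z) z"
  by (rule holo_at_transform[OF _ open_U assms(2)]) (use assms in \<open>auto simp: holomorphic2_on_iff\<close>)

lemma continuous_on_orbit:
  assumes "f holomorphic2_on U" "z \<in> U"
  shows "continuous_on torus (\<lambda>e. indicator U (pmul e z) *\<^sub>R f (pmul e z))"
proof (intro continuous_at_imp_continuous_on ballI)
  fix e assume "e \<in> torus"
  then have "isCont (\<lambda>z. indicator U z *\<^sub>R f z) (pmul e z)"
    using assms by (intro holo_at_imp_continuous holo_at_cut) auto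
  moreover have "isCont (\<lambda>e. pmul e z) e"
    unfolding pmul_def by (intro continuous_intros)
  ultimately show "isCont (\<lambda>e. indicator U (pmul e z) *\<^sub>R f (pmul e z)) e"
    by (rule isCont_o2[rotated])
qed

text \<open>Dividing by \<open>z\<^sup>m\<close> makes the average against the character invariant under rotations of \<open>z\<close>; by
  \<open>torus_mean_constant\<close> it does not depend on \<open>z\<close> at all.\<close>

lemma laurent_coefficient:
  assumes f: "f holomorphic2_on U"
  shows "\<exists>c. \<forall>z\<in>U. fst z \<noteq> 0 \<longrightarrow> snd z \<noteq> 0 \<longrightarrow>
    (\<integral>e. indicator U (pmul e z) *\<^sub>R f (pmul e z) * zmon (- m) e \<partial>torus_measure) = c * zmon m z"
proof -
  define F where "F z = indicator U z *\<^sub>R f z" for z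
  have [measurable]: "F \<in> borel_measurable borel"
    unfolding F_def by (rule cut_measurable[OF f])
  define G where "G z = F z * zmon (- m) z" for z
  define c where "c x = (\<integral>e. G (pmul e (exp2 x)) \<partial>torus_measure)" for x
  have const: "c x = c y" if "x \<in> log_U" "y \<in> log_U" for x y
    unfolding c_def
  proof (rule torus_mean_constant[OF convex_log_U open_log_U _ _ _ that])
    show "G \<in> borel_measurable borel" unfolding G_def by measurable
    show "holo_at G (exp2 x)" if "x \<in> log_U" for x
      unfolding G_def F_def using that f exp2_in_U[of x]
      by (intro holo_at_mult holo_at_cut holo_at_zmon) (auto simp: exp2_def)
  qed (auto simp: log_U_def)
  have mean: "(\<integral>e. F (pmul e (exp2 x)) * zmon (- m) e \<partial>torus_measure) = c x * zmon m (exp2 x)" for x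
  proof -
    have "fst (exp2 x) \<noteq> 0" "snd (exp2 x) \<noteq> 0" by (auto simp: exp2_def)
    then have "zmon (- m) (exp2 x) * zmon m (exp2 x) = 1"
      by (simp add: zmon_minus zmon_nonzero)
    then have "F (pmul e (exp2 x)) * zmon (- m) e = G (pmul e (exp2 x)) * zmon m (exp2 x)" for e
      by (simp add: G_def zmon_pmul mult.assoc)
    then show ?thesis by (simp add: c_def)
  qed
  show ?thesis
  proof (cases "log_U = {}")
    case True
    then show ?thesis using U_exp2 by blast
  next
    case False
    then obtain x0 where x0: "x0 \<in> log_U" by blast
    show ?thesis
    proof (intro exI[of _ "c x0"] ballI impI)
      fix z assume "z \<in> U" "fst z \<noteq> 0" "snd z \<noteq> 0"
      then obtain x where "x \<in> log_U" "z = exp2 x"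
        using U_exp2 by blast
      then show "(\<integral>e. indicator U (pmul e z) *\<^sub>R f (pmul e z) * zmon (- m) e \<partial>torus_measure) = c x0 * zmon m z"
        using mean[of x] const[OF _ x0] by (simp add: F_def)
    qed
  qed
qed

lemma bergman_cut:
  assumes "f \<in> bergman_space U"
  shows "f holomorphic2_on U" "integrable lborel (\<lambda>z. (norm (indicator U z *\<^sub>R f z))\<^sup>2)"
proof -
  show "f holomorphic2_on U" using assms by (simp add: bergman_space_def)
  have "integrable lborel (\<lambda>z. indicator U z *\<^sub>R (cmod (f z))\<^sup>2)"
    using assms by (simp add: bergman_space_def set_integrable_def)
  also have "(\<lambda>z. indicator U z *\<^sub>R (cmod (f z))\<^sup>2) = (\<lambda>z. (norm (indicator U z *\<^sub>R f z))\<^sup>2)"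
    by (auto simp: fun_eq_iff split: split_indicator)
  finally show "integrable lborel (\<lambda>z. (norm (indicator U z *\<^sub>R f z))\<^sup>2)" .
qed

text \<open>The Laurent component \<open>c z\<^sup>m\<close> is a torus average of \<open>f\<close>, hence square integrable.\<close>

lemma laurent_coefficient_L2:
  assumes f: "f \<in> bergman_space U"
    and c: "\<And>z. z \<in> U \<Longrightarrow> fst z \<noteq> 0 \<Longrightarrow> snd z \<noteq> 0 \<Longrightarrow>
      (\<integral>e. indicator U (pmul e z) *\<^sub>R f (pmul e z) * zmon (- m) e \<partial>torus_measure) = c * zmon m z"
    and "c \<noteq> 0"
  shows "al m > 0 \<and> be m > 0"
proof -
  define F where "F z = indicator U z *\<^sub>R f z" for z
  have hol: "f holomorphic2_on U" and L2: "integrable lborel (\<lambda>z. (norm (F z))\<^sup>2)"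
    using bergman_cut[OF f] by (simp_all add: F_def)
  have [measurable]: "F \<in> borel_measurable borel"
    unfolding F_def by (rule cut_measurable[OF hol])
  have cont: "continuous_on torus (\<lambda>e. F (pmul e z))" if "z \<in> U" for z
    unfolding F_def by (rule continuous_on_orbit[OF hol that])
  have "integrable (torus_measure \<Otimes>\<^sub>M lborel) (\<lambda>(e, z). (norm (F (pmul e z)))\<^sup>2)"
    using integrable_torus_pair[OF L2] by (simp add: case_prod_beta')
  from torus_lborel.integrable_snd[OF this]
  have int: "integrable lborel (\<lambda>z. \<integral>e. (norm (F (pmul e z)))\<^sup>2 \<partial>torus_measure)" .
  have le: "indicator U z * (norm (c * zmon m z))\<^sup>2 \<le> (\<integral>e. (norm (F (pmul e z)))\<^sup>2 \<partial>torus_measure)"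
    if z: "fst z \<noteq> 0" "snd z \<noteq> 0" for z
  proof (cases "z \<in> U")
    case True
    have "(norm (c * zmon m z))\<^sup>2 = (norm (\<integral>e. F (pmul e z) * zmon (- m) e \<partial>torus_measure))\<^sup>2"
      using c[OF True z] by (simp add: F_def)
    also have "\<dots> \<le> (\<integral>e. (norm (F (pmul e z) * zmon (- m) e))\<^sup>2 \<partial>torus_measure)"
      by (intro norm_torus_mean_square_le integrable_torus continuous_intros continuous_on_zmon torus_nonzero cont True)
         measurable
    also have "\<dots> = (\<integral>e. (norm (F (pmul e z)))\<^sup>2 \<partial>torus_measure)"
    proof (rule integral_cong_AE)
      show "AE e in torus_measure. (norm (F (pmul e z) * zmon (- m) e))\<^sup>2 = (norm (F (pmul e z)))\<^sup>2"
        using AE_torus by eventually_elim (simp add: norm_mult norm_zmon_torus)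
    qed measurable
    finally show ?thesis using True by simp
  qed simp
  have "integrable lborel (\<lambda>z. indicator U z * (norm (c * zmon m z))\<^sup>2)"
  proof (rule Bochner_Integration.integrable_bound[OF int])
    show "AE z in lborel. norm (indicator U z * (norm (c * zmon m z))\<^sup>2) \<le> norm (\<integral>e. (norm (F (pmul e z)))\<^sup>2 \<partial>torus_measure)"
      using AE_lborel_coordinates_nonzero by eventually_elim (use le in simp)
  qed measurable
  then have "integrable lborel (\<lambda>z. (norm c)\<^sup>2 * (indicator U z * (norm (zmon m z))\<^sup>2))"
    by (simp add: norm_mult power_mult_distrib mult_ac)
  then have "integrable lborel (\<lambda>z. indicator U z * (norm (zmon m z))\<^sup>2)"
    using \<open>c \<noteq> 0\<close> by simp
  then have "(\<integral>\<^sup>+z. ennreal (indicator U z * (norm (zmon m z))\<^sup>2) \<partial>lborel) \<noteq> \<infinity>"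
    by (subst nn_integral_eq_integral) auto
  then show ?thesis
    unfolding nn_integral_zmon by (auto split: if_splits)
qed

section \<open>Orthogonality of the monomials\<close>

lemma integrable_cut_zmon:
  assumes "al m > 0" "be m > 0"
  shows "integrable lborel (\<lambda>z. (norm (indicator U z *\<^sub>R zmon m z))\<^sup>2)"
proof -
  have "(\<lambda>z. (norm (indicator U z *\<^sub>R zmon m z))\<^sup>2) = (\<lambda>z. indicator U z * (norm (zmon m z))\<^sup>2)"
    by (auto simp: fun_eq_iff split: split_indicator)
  then show ?thesis using integrable_zmon(1)[OF assms] by simp
qed

text \<open>For \<open>m \<noteq> n\<close> the product is multiplied by a nontrivial character under rotations, so its average
  over every torus orbit vanishes.\<close>

lemma integral_zmon_cnj_zmon:
  assumes m: "al m > 0" "be m > 0" and n: "al n > 0" "be n > 0"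
  shows "integrable lborel (\<lambda>z. indicator U z *\<^sub>R (zmon m z * cnj (zmon n z)))"
    and "(\<integral>z. indicator U z *\<^sub>R (zmon m z * cnj (zmon n z)) \<partial>lborel) =
      (if m = n then of_real (pi\<^sup>2 * dt / (al m * be m)) else 0)"
proof -
  let ?\<Phi> = "\<lambda>z. indicator U z *\<^sub>R (zmon m z * cnj (zmon n z))"
  have cnj_meas [measurable]: "(\<lambda>z. cnj (zmon n z)) \<in> borel_measurable borel"
    by (rule borel_measurable_continuous_on[where g = "zmon n"]) (auto intro!: continuous_intros)
  have "integrable lborel (\<lambda>z. (indicator U z *\<^sub>R zmon m z) * (indicator U z *\<^sub>R cnj (zmon n z)))"
  proof (rule integrable_mult_L2)
    show "integrable lborel (\<lambda>z. (norm (indicator U z *\<^sub>R cnj (zmon n z)))\<^sup>2)"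
      using integrable_cut_zmon[OF n] by simp
  qed (use integrable_cut_zmon[OF m] in measurable)
  also have "(\<lambda>z. (indicator U z *\<^sub>R zmon m z) * (indicator U z *\<^sub>R cnj (zmon n z))) = ?\<Phi>"
    by (auto simp: fun_eq_iff split: split_indicator)
  finally show int: "integrable lborel ?\<Phi>" .
  show "(\<integral>z. ?\<Phi> z \<partial>lborel) = (if m = n then of_real (pi\<^sup>2 * dt / (al m * be m)) else 0)"
  proof (cases "m = n")
    case True
    have "?\<Phi> = (\<lambda>z. of_real (indicator U z * (norm (zmon m z))\<^sup>2))"
      unfolding True by (auto simp: fun_eq_iff complex_norm_square[symmetric] split: split_indicator)
    then show ?thesis
      using True integrable_zmon(2)[OF m] by (simp only: integral_complex_of_real if_True simp_thms)
  next
    case False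
    have "(\<integral>e. ?\<Phi> (pmul e z) \<partial>torus_measure) = 0" for z
    proof -
      have "(\<integral>e. ?\<Phi> (pmul e z) \<partial>torus_measure) = (\<integral>e. ?\<Phi> z * zmon (m - n) e \<partial>torus_measure)"
      proof (rule integral_cong_AE)
        show "AE e in torus_measure. ?\<Phi> (pmul e z) = ?\<Phi> z * zmon (m - n) e"
          using AE_torus
        proof eventually_elim
          case (elim e)
          have "zmon (m - n) e = zmon m e * cnj (zmon n e)"
            using elim zmon_add[of e m "- n"] torus_nonzero[OF elim] by (simp add: cnj_zmon_torus)
          then show ?case
            using elim by (auto simp: zmon_pmul indicator_def)
        qed
      qed measurable
      also have "\<dots> = 0"
        using False by (simp add: integral_torus_zmon)
      finally show ?thesis .
    qed
    then show ?thesis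
      using False integral_torus_average[OF int] by simp
  qed
qed

end

section \<open>The kernel\<close>

text \<open>The sum of the arithmetic-geometric series \<open>\<Sum>k. (a + k * d) * x ^ k\<close>, and its partial sums.\<close>

definition ag_sum :: "int \<Rightarrow> int \<Rightarrow> complex \<Rightarrow> complex" where
  "ag_sum d a x = (of_int a + of_int (d - a) * x) / (1 - x)\<^sup>2"

definition ag_partial :: "int \<Rightarrow> int \<Rightarrow> nat \<Rightarrow> complex \<Rightarrow> complex" where
  "ag_partial d a N x = (\<Sum>k<N. of_int (a + int k * d) * x ^ k)"

lemma ag_partial_tendsto:
  assumes "norm x < 1"
  shows "(\<lambda>N. ag_partial d a N x) \<longlonglongrightarrow> ag_sum d a x"
proof -
  have "x \<noteq> 1" using assms by auto
  have "(\<lambda>k. of_int (a - d) * x ^ k + of_int d * (of_nat (Suc k) * x ^ k)) sums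
      (of_int (a - d) * (1 / (1 - x)) + of_int d * (1 / (1 - x)\<^sup>2))"
    using assms by (intro sums_add sums_mult geometric_sums geometric_deriv_sums)
  also have "(\<lambda>k. of_int (a - d) * x ^ k + of_int d * (of_nat (Suc k) * x ^ k)) =
      (\<lambda>k. of_int (a + int k * d) * x ^ k)"
    by (auto simp: fun_eq_iff algebra_simps)
  also have "of_int (a - d) * (1 / (1 - x)) + of_int d * (1 / (1 - x)\<^sup>2) = ag_sum d a x"
  proof -
    have "of_int (a - d) * (1 / (1 - x)) = of_int (a - d) * (1 - x) / (1 - x)\<^sup>2"
      using \<open>x \<noteq> 1\<close> by (simp add: power2_eq_square)
    then have "of_int (a - d) * (1 / (1 - x)) + of_int d * (1 / (1 - x)\<^sup>2) =
        (of_int (a - d) * (1 - x) + of_int d) / (1 - x)\<^sup>2"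
      by (simp add: add_divide_distrib)
    also have "of_int (a - d) * (1 - x) + of_int d = of_int a + of_int (d - a) * x"
      by (simp add: algebra_simps)
    finally show ?thesis by (simp only: ag_sum_def)
  qed
  finally show ?thesis
    by (simp add: sums_def ag_partial_def)
qed

lemma norm_ag_partial_le:
  assumes x: "norm x \<le> \<rho>" and \<rho>: "\<rho> < 1" and a: "0 \<le> a" "a \<le> d"
  shows "norm (ag_partial d a N x) \<le> d / (1 - \<rho>)\<^sup>2"
proof -
  have "\<rho> \<ge> 0" using x norm_ge_zero[of x] by linarith
  have s: "(\<lambda>k. real (Suc k) * \<rho> ^ k) sums (1 / (1 - \<rho>)\<^sup>2)"
    using \<open>\<rho> \<ge> 0\<close> \<rho> by (intro geometric_deriv_sums) auto
  have "norm (ag_partial d a N x) \<le> (\<Sum>k<N. norm (of_int (a + int k * d) * x ^ k))"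
    unfolding ag_partial_def by (rule norm_sum)
  also have "\<dots> \<le> (\<Sum>k<N. real_of_int d * (real (Suc k) * \<rho> ^ k))"
  proof (rule sum_mono)
    fix k
    have "0 \<le> a + int k * d" using a by simp
    then have "norm (of_int (a + int k * d) :: complex) = real_of_int (a + int k * d)"
      by (simp only: norm_of_int abs_of_nonneg of_int_0_le_iff)
    also have "\<dots> \<le> real_of_int d * real (Suc k)"
      using a by (simp add: algebra_simps)
    finally have 1: "norm (of_int (a + int k * d) :: complex) \<le> real_of_int d * real (Suc k)" .
    have "norm (of_int (a + int k * d) * x ^ k) \<le> real_of_int d * real (Suc k) * \<rho> ^ k"
      unfolding norm_mult norm_power
      by (rule mult_mono[OF 1 power_mono[OF x]]) (use a in auto)
    then show "norm (of_int (a + int k * d) * x ^ k) \<le> real_of_int d * (real (Suc k) * \<rho> ^ k)"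
      by (simp add: mult.assoc)
  qed
  also have "\<dots> = real_of_int d * (\<Sum>k<N. real (Suc k) * \<rho> ^ k)"
    by (simp add: sum_distrib_left)
  also have "\<dots> \<le> real_of_int d * (1 / (1 - \<rho>)\<^sup>2)"
  proof (rule mult_left_mono)
    show "(\<Sum>k<N. real (Suc k) * \<rho> ^ k) \<le> 1 / (1 - \<rho>)\<^sup>2"
      unfolding sums_unique[OF s] using s \<open>\<rho> \<ge> 0\<close> by (intro sum_le_suminf) (auto simp: sums_iff)
  qed (use a in auto)
  finally show ?thesis by simp
qed

lemma norm_ag_sum_le:
  assumes "norm x \<le> \<rho>" "\<rho> < 1" "0 \<le> a" "a \<le> d"
  shows "norm (ag_sum d a x) \<le> d / (1 - \<rho>)\<^sup>2"
proof (rule Lim_norm_ubound[OF _ ag_partial_tendsto])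
  show "\<forall>\<^sub>F N in sequentially. norm (ag_partial d a N x) \<le> d / (1 - \<rho>)\<^sup>2"
    using norm_ag_partial_le[OF assms] by simp
qed (use assms in auto)

lemma ag_sum_field_differentiable:
  assumes "x \<noteq> 1"
  shows "ag_sum d a field_differentiable (at x)"
  unfolding ag_sum_def [abs_def] using assms
  by (intro derivative_intros field_differentiable_divide) auto

context monomial_wedge
begin

text \<open>The two monomials whose moduli cut out the domain: \<open>X = z\<^sub>1\<^sup>p / z\<^sub>2\<^sup>q\<close> and \<open>Y = z\<^sub>2\<^sup>r / z\<^sub>1\<^sup>s\<close> have modulus
  less than 1. Multiplication by \<open>X\<close> adds \<open>(dt, 0)\<close> to the pair \<open>(al, be)\<close> of a monomial,
  multiplication by \<open>Y\<close> adds \<open>(0, dt)\<close>.\<close>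

definition X :: "complex \<times> complex \<Rightarrow> complex" where "X = zmon (int p, - int q)"
definition Y :: "complex \<times> complex \<Rightarrow> complex" where "Y = zmon (- int s, int r)"

text \<open>Every square integrable monomial is \<open>X ^ k * Y ^ l\<close> times a monomial with exponent in \<open>R\<close>, in exactly
  one way.\<close>

definition R :: "(int \<times> int) set" where
  "R = {m. al m \<in> {1..dt} \<and> be m \<in> {1..dt}}"

text \<open>The sum of \<open>al n * be n * z\<^sup>n * cnj (w\<^sup>n)\<close> over all \<open>n\<close> obtained from \<open>m\<close> by these shifts.\<close>

definition kernel_term :: "int \<times> int \<Rightarrow> complex \<times> complex \<Rightarrow> complex \<times> complex \<Rightarrow> complex" where
  "kernel_term m z w = zmon m z * cnj (zmon m w) *
     ag_sum dt (al m) (X z * cnj (X w)) * ag_sum dt (be m) (Y z * cnj (Y w))"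

definition kernel :: "complex \<times> complex \<Rightarrow> complex \<times> complex \<Rightarrow> complex" where
  "kernel z w = of_real (1 / (pi\<^sup>2 * dt)) * (\<Sum>m\<in>R. kernel_term m z w)"

text \<open>Cramer's rule.\<close>

lemma dt_al_be: "dt * (fst m + 1) = int p * al m - int s * be m" "dt * (snd m + 1) = int r * be m - int q * al m"
  by (simp_all add: dt_def al_def be_def algebra_simps)

lemma al_be_inj: "al m = al n \<Longrightarrow> be m = be n \<Longrightarrow> m = n"
proof -
  assume "al m = al n" "be m = be n"
  then have "dt * (fst m + 1) = dt * (fst n + 1)" "dt * (snd m + 1) = dt * (snd n + 1)"
    by (simp_all only: dt_al_be)
  then show ?thesis using dt_pos by (simp add: prod_eq_iff)
qed

lemma finite_R: "finite R"
proof (rule finite_imageD[of "\<lambda>m. (al m, be m)"])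
  show "finite ((\<lambda>m. (al m, be m)) ` R)"
    by (rule finite_subset[of _ "{1..dt} \<times> {1..dt}"]) (auto simp: R_def)
  show "inj_on (\<lambda>m. (al m, be m)) R"
    using al_be_inj by (auto intro!: inj_onI)
qed

lemma norm_X: assumes "z \<in> U" shows "norm (X z) < 1"
proof -
  have lt: "cmod (fst z) ^ p < cmod (snd z) ^ q" using assms by (simp add: U_def)
  then have "cmod (snd z) ^ q > 0" by (meson le_less_trans norm_ge_zero zero_le_power)
  then show ?thesis
    using lt by (simp add: X_def norm_zmon power_int_minus field_simps)
qed

lemma norm_Y: assumes "z \<in> U" shows "norm (Y z) < 1"
proof -
  have lt: "cmod (snd z) ^ r < cmod (fst z) ^ s" using assms by (simp add: U_def)
  then have "cmod (fst z) ^ s > 0" by (meson le_less_trans norm_ge_zero zero_le_power)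
  then show ?thesis
    using lt by (simp add: Y_def norm_zmon power_int_minus field_simps)
qed

lemma norm_mult_cnj_le:
  fixes x y :: complex
  assumes "norm x < 1"
  shows "norm (x * cnj y) \<le> norm y"
  using mult_right_mono[of "norm x" 1 "norm y"] assms by (simp add: norm_mult)

lemma norm_XX: "z \<in> U \<Longrightarrow> norm (X z * cnj (X w)) \<le> norm (X w)"
  and norm_YY: "z \<in> U \<Longrightarrow> norm (Y z * cnj (Y w)) \<le> norm (Y w)"
  by (rule norm_mult_cnj_le, erule norm_X norm_Y)+

lemma holo_at_X: assumes "z \<in> U" shows "holo_at X z"
  unfolding X_def by (rule holo_at_zmon) (use U_snd_zero[OF assms] in auto)

lemma holo_at_Y: assumes "z \<in> U" shows "holo_at Y z"
  unfolding Y_def by (rule holo_at_zmon) (use U_fst_zero[OF assms] in auto)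

text \<open>Where a coordinate vanishes on the domain, the monomials of the kernel have a nonnegative
  exponent there.\<close>

lemma al_nonneg_fst: "al m > 0 \<Longrightarrow> s = 0 \<Longrightarrow> fst m \<ge> 0"
  unfolding al_def using r_pos by (simp add: zero_less_mult_iff)

lemma be_nonneg_snd: "be m > 0 \<Longrightarrow> q = 0 \<Longrightarrow> snd m \<ge> 0"
  unfolding be_def using p_pos by (simp add: zero_less_mult_iff)

lemma R_D: "m \<in> R \<Longrightarrow> al m > 0 \<and> be m > 0 \<and> al m \<le> dt \<and> be m \<le> dt"
  by (auto simp: R_def)

lemma holo_at_zmon_R: assumes "m \<in> R" "z \<in> U" shows "holo_at (zmon m) z"
  by (rule holo_at_zmon)
     (use R_D[OF assms(1)] U_fst_zero[OF assms(2)] U_snd_zero[OF assms(2)] al_nonneg_fst[of m] be_nonneg_snd[of m] in auto)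

lemma holo_at_kernel_term:
  assumes "m \<in> R" "z \<in> U" "w \<in> U"
  shows "holo_at (\<lambda>z. kernel_term m z w) z"
proof -
  have lt: "norm (X z * cnj (X w)) < 1" "norm (Y z * cnj (Y w)) < 1"
    using norm_XX[OF assms(2), of w] norm_YY[OF assms(2), of w] norm_X[OF assms(3)] norm_Y[OF assms(3)] by auto
  then have ne: "X z * cnj (X w) \<noteq> 1" "Y z * cnj (Y w) \<noteq> 1" by force+
  obtain g1 where g1: "(ag_sum dt (al m) has_field_derivative g1) (at (X z * cnj (X w)))"
    using ag_sum_field_differentiable[OF ne(1)] by (auto simp: field_differentiable_def)
  obtain g2 where g2: "(ag_sum dt (be m) has_field_derivative g2) (at (Y z * cnj (Y w)))"
    using ag_sum_field_differentiable[OF ne(2)] by (auto simp: field_differentiable_def)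
  show ?thesis
    unfolding kernel_term_def using assms
    by (intro holo_at_mult holo_at_zmon_R holo_at_const 
         holo_at_compose[where g = "ag_sum dt (al m)" and f = "\<lambda>z. X z * cnj (X w)", OF g1]
         holo_at_compose[where g = "ag_sum dt (be m)" and f = "\<lambda>z. Y z * cnj (Y w)", OF g2]
         holo_at_X holo_at_Y)
qed

text \<open>The factor besides \<open>zmon m z\<close> does not depend on \<open>z\<close>, so \<open>kernel_term\<close> inherits square
  integrability from the monomial.\<close>

lemma norm_kernel_term_le:
  assumes "m \<in> R" "z \<in> U" "w \<in> U"
  shows "norm (kernel_term m z w) \<le>
    norm (zmon m z) * (norm (zmon m w) * (dt / (1 - norm (X w))\<^sup>2) * (dt / (1 - norm (Y w))\<^sup>2))"
proof -
  have "norm (ag_sum dt (al m) (X z * cnj (X w))) \<le> dt / (1 - norm (X w))\<^sup>2"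
    by (rule norm_ag_sum_le[OF norm_XX[OF assms(2)] norm_X[OF assms(3)]]) (use R_D[OF assms(1)] in auto)
  moreover have "norm (ag_sum dt (be m) (Y z * cnj (Y w))) \<le> dt / (1 - norm (Y w))\<^sup>2"
    by (rule norm_ag_sum_le[OF norm_YY[OF assms(2)] norm_Y[OF assms(3)]]) (use R_D[OF assms(1)] in auto)
  ultimately have "norm (zmon m z * cnj (zmon m w)) * (norm (ag_sum dt (al m) (X z * cnj (X w))) * norm (ag_sum dt (be m) (Y z * cnj (Y w))))
    \<le> norm (zmon m z * cnj (zmon m w)) * ((dt / (1 - norm (X w))\<^sup>2) * (dt / (1 - norm (Y w))\<^sup>2))"
    using dt_pos by (intro mult_left_mono mult_mono) auto
  then show ?thesis
    by (simp add: kernel_term_def norm_mult mult.assoc)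
qed

lemma kernel_term_measurable:
  assumes "m \<in> R" "w \<in> U"
  shows "(\<lambda>z. indicator U z *\<^sub>R kernel_term m z w) \<in> borel_measurable borel"
  by (rule cut_measurable) (simp add: holomorphic2_on_iff holo_at_kernel_term assms)

lemma kernel_term_L2:
  assumes "m \<in> R" "w \<in> U"
  shows "integrable lborel (\<lambda>z. (norm (indicator U z *\<^sub>R kernel_term m z w))\<^sup>2)"
proof (rule Bochner_Integration.integrable_bound)
  let ?C = "norm (zmon m w) * (dt / (1 - norm (X w))\<^sup>2) * (dt / (1 - norm (Y w))\<^sup>2)"
  show "integrable lborel (\<lambda>z. (norm (indicator U z *\<^sub>R zmon m z))\<^sup>2 * ?C\<^sup>2)"
    using R_D[OF assms(1)] by (intro integrable_mult_left integrable_cut_zmon) auto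
  have "(norm (indicator U z *\<^sub>R kernel_term m z w))\<^sup>2 \<le> (norm (indicator U z *\<^sub>R zmon m z))\<^sup>2 * ?C\<^sup>2" for z
  proof (cases "z \<in> U")
    case True
    have "(norm (kernel_term m z w))\<^sup>2 \<le> (norm (zmon m z) * ?C)\<^sup>2"
      by (rule power_mono[OF norm_kernel_term_le[OF assms(1) True assms(2)] norm_ge_zero])
    also have "\<dots> = (norm (zmon m z))\<^sup>2 * ?C\<^sup>2"
      by (rule power_mult_distrib)
    finally show ?thesis
      using True by (simp only: indicator_simps scaleR_one)
  qed simp
  then show "AE z in lborel. norm ((norm (indicator U z *\<^sub>R kernel_term m z w))\<^sup>2) \<le> norm ((norm (indicator U z *\<^sub>R zmon m z))\<^sup>2 * ?C\<^sup>2)"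
    by (intro AE_I2) simp
qed (use kernel_term_measurable[OF assms] in measurable)

lemma kernel_in_bergman_space:
  assumes "w \<in> U"
  shows "(\<lambda>z. kernel z w) \<in> bergman_space U"
proof -
  have hol: "(\<lambda>z. kernel z w) holomorphic2_on U"
    unfolding kernel_def holomorphic2_on_iff using assms
    by (intro ballI holo_at_mult holo_at_const holo_at_sum holo_at_kernel_term)
  have "integrable lborel (\<lambda>z. (norm (\<Sum>m\<in>R. indicator U z *\<^sub>R kernel_term m z w))\<^sup>2)"
  proof (rule Bochner_Integration.integrable_bound)
    show "integrable lborel (\<lambda>z. real (card R) * (\<Sum>m\<in>R. (norm (indicator U z *\<^sub>R kernel_term m z w))\<^sup>2))"
      using kernel_term_L2 assms by (intro integrable_mult_right Bochner_Integration.integrable_sum)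
    have "(norm (\<Sum>m\<in>R. indicator U z *\<^sub>R kernel_term m z w))\<^sup>2 \<le> card R * (\<Sum>m\<in>R. (norm (indicator U z *\<^sub>R kernel_term m z w))\<^sup>2)" for z
    proof -
      have "(norm (\<Sum>m\<in>R. indicator U z *\<^sub>R kernel_term m z w))\<^sup>2 \<le> (\<Sum>m\<in>R. norm (indicator U z *\<^sub>R kernel_term m z w))\<^sup>2"
        by (intro power_mono norm_sum) auto
      also have "\<dots> \<le> card R * (\<Sum>m\<in>R. (norm (indicator U z *\<^sub>R kernel_term m z w))\<^sup>2)"
        using Cauchy_Schwarz_ineq_sum[of "\<lambda>_. 1" "\<lambda>m. norm (indicator U z *\<^sub>R kernel_term m z w)" R]
        by simp
      finally show ?thesis .
    qed
    then show "AE z in lborel. norm ((norm (\<Sum>m\<in>R. indicator U z *\<^sub>R kernel_term m z w))\<^sup>2) \<le>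
        norm (real (card R) * (\<Sum>m\<in>R. (norm (indicator U z *\<^sub>R kernel_term m z w))\<^sup>2))"
      by (intro AE_I2) (simp add: sum_nonneg)
  qed (use kernel_term_measurable assms in measurable)
  then have "integrable lborel (\<lambda>z. (1 / (pi\<^sup>2 * dt))\<^sup>2 * (norm (\<Sum>m\<in>R. indicator U z *\<^sub>R kernel_term m z w))\<^sup>2)"
    by (rule integrable_mult_right)
  also have "(\<lambda>z. (1 / (pi\<^sup>2 * dt))\<^sup>2 * (norm (\<Sum>m\<in>R. indicator U z *\<^sub>R kernel_term m z w))\<^sup>2) =
      (\<lambda>z. indicator U z *\<^sub>R (cmod (kernel z w))\<^sup>2)"
    by (auto simp: fun_eq_iff kernel_def norm_mult norm_divide norm_power power_mult_distrib power_divide split: split_indicator)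
  finally show ?thesis
    using hol by (simp add: bergman_space_def set_integrable_def)
qed


section \<open>The kernel reproduces the square integrable monomials\<close>

definition kernel_partial :: "nat \<Rightarrow> complex \<times> complex \<Rightarrow> complex \<times> complex \<Rightarrow> complex" where
  "kernel_partial N z w = of_real (1 / (pi\<^sup>2 * dt)) * (\<Sum>m\<in>R. zmon m z * cnj (zmon m w) *
     ag_partial dt (al m) N (X z * cnj (X w)) * ag_partial dt (be m) N (Y z * cnj (Y w)))"

text \<open>The exponent of \<open>zmon m z * X z ^ k * Y z ^ l\<close>.\<close>

definition shift :: "int \<times> int \<Rightarrow> nat \<Rightarrow> nat \<Rightarrow> int \<times> int" where
  "shift m k l = (fst m + int k * int p - int l * int s, snd m - int k * int q + int l * int r)"

lemma al_shift: "al (shift m k l) = al m + int k * dt"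
  and be_shift: "be (shift m k l) = be m + int l * dt"
  by (simp_all add: al_def be_def shift_def dt_def algebra_simps)

lemma zmon_shift:
  assumes "fst z \<noteq> 0" "snd z \<noteq> 0"
  shows "zmon (shift m k l) z = zmon m z * X z ^ k * Y z ^ l"
proof -
  have "shift m k l = m + (int p * int k, - int q * int k) + (- int s * int l, int r * int l)"
    by (simp add: shift_def prod_eq_iff)
  moreover have "zmon (int p * int k, - int q * int k) z = X z ^ k"
    unfolding X_def zmon_def power_mult_distrib power_int_power' by simp
  moreover have "zmon (- int s * int l, int r * int l) z = Y z ^ l"
    unfolding Y_def zmon_def power_mult_distrib power_int_power' by simp
  ultimately show ?thesis
    by (simp add: zmon_add assms)
qed

definition shifts :: "nat \<Rightarrow> ((int \<times> int) \<times> nat \<times> nat) set" where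
  "shifts N = R \<times> {..<N} \<times> {..<N}"

abbreviation sh :: "(int \<times> int) \<times> nat \<times> nat \<Rightarrow> int \<times> int" where
  "sh t \<equiv> shift (fst t) (fst (snd t)) (snd (snd t))"

lemma finite_shifts: "finite (shifts N)"
  by (simp add: shifts_def finite_R)

lemma shifts_pos: "t \<in> shifts N \<Longrightarrow> al (sh t) > 0 \<and> be (sh t) > 0"
  using dt_pos R_D by (auto simp: shifts_def al_shift be_shift intro!: add_pos_nonneg)

lemma sh_inj: "inj_on sh (shifts N)"
proof (rule inj_onI)
  fix t u assume t: "t \<in> shifts N" and u: "u \<in> shifts N" and eq: "sh t = sh u"
  have unique: "k = l \<and> a = b" if "a + int k * dt = b + int l * dt" "a \<in> {1..dt}" "b \<in> {1..dt}" for a b k l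
  proof -
    have "(a - 1 + int k * dt) div dt = (b - 1 + int l * dt) div dt"
      using that(1) by (simp add: algebra_simps)
    moreover have "(a - 1 + int k * dt) div dt = int k" "(b - 1 + int l * dt) div dt = int l"
      using that(2,3) dt_pos by (simp_all add: div_pos_pos_trivial)
    ultimately show ?thesis using that(1) by simp
  qed
  have "al (fst t) + int (fst (snd t)) * dt = al (fst u) + int (fst (snd u)) * dt"
    "be (fst t) + int (snd (snd t)) * dt = be (fst u) + int (snd (snd u)) * dt"
    using arg_cong[OF eq, of al] arg_cong[OF eq, of be] unfolding al_shift be_shift by simp_all
  moreover have "al (fst t) \<in> {1..dt}" "al (fst u) \<in> {1..dt}" "be (fst t) \<in> {1..dt}" "be (fst u) \<in> {1..dt}"
    using t u by (auto simp: shifts_def R_def)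
  ultimately have "fst (snd t) = fst (snd u) \<and> al (fst t) = al (fst u)" "snd (snd t) = snd (snd u) \<and> be (fst t) = be (fst u)"
    using unique by metis+
  moreover from this have "fst t = fst u"
    by (intro al_be_inj) auto
  ultimately show "t = u"
    by (simp add: prod_eq_iff)
qed

lemma shifts_exhaust:
  assumes "al m > 0" "be m > 0"
  shows "\<forall>\<^sub>F N in sequentially. m \<in> sh ` shifts N"
proof -
  \<comment> \<open>The remainders must lie in \<open>{1..dt}\<close> and not in \<open>{0..<dt}\<close>, hence the subtraction of 1.\<close>
  define k l where "k = nat ((al m - 1) div dt)" and "l = nat ((be m - 1) div dt)"
  define \<mu> where "\<mu> = (fst m - int k * int p + int l * int s, snd m + int k * int q - int l * int r)"
  have m: "m = shift \<mu> k l"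
    by (simp add: shift_def \<mu>_def)
  have kl: "int k = (al m - 1) div dt" "int l = (be m - 1) div dt"
    using assms dt_pos by (simp_all add: k_def l_def pos_imp_zdiv_nonneg_iff)
  have "al \<mu> = al m - int k * dt" "be \<mu> = be m - int l * dt"
    unfolding m al_shift be_shift by simp_all
  then have "al \<mu> = (al m - 1) mod dt + 1" "be \<mu> = (be m - 1) mod dt + 1"
    by (simp_all add: kl minus_div_mult_eq_mod[symmetric])
  then have "1 \<le> al \<mu> \<and> al \<mu> \<le> dt" "1 \<le> be \<mu> \<and> be \<mu> \<le> dt"
    using pos_mod_bound[OF dt_pos, of "al m - 1"] pos_mod_bound[OF dt_pos, of "be m - 1"]
      pos_mod_sign[OF dt_pos, of "al m - 1"] pos_mod_sign[OF dt_pos, of "be m - 1"] by linarith+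
  then have "\<mu> \<in> R" by (simp add: R_def)
  then have "m \<in> sh ` shifts N" if "N > max k l" for N
    using that by (intro image_eqI[of _ _ "(\<mu>, k, l)"]) (auto simp: m shifts_def)
  then show ?thesis
    using eventually_gt_at_top[of "max k l"] by (auto elim: eventually_mono)
qed

lemma kernel_partial_expand:
  assumes z: "fst z \<noteq> 0" "snd z \<noteq> 0" and w: "fst w \<noteq> 0" "snd w \<noteq> 0"
  shows "kernel_partial N z w = of_real (1 / (pi\<^sup>2 * dt)) *
    (\<Sum>t\<in>shifts N. of_int (al (sh t) * be (sh t)) * (zmon (sh t) z * cnj (zmon (sh t) w)))"
proof -
  have "zmon m z * cnj (zmon m w) * ag_partial dt (al m) N (X z * cnj (X w)) * ag_partial dt (be m) N (Y z * cnj (Y w)) =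
     (\<Sum>k<N. \<Sum>l<N. of_int (al (shift m k l) * be (shift m k l)) * (zmon (shift m k l) z * cnj (zmon (shift m k l) w)))" for m
  proof -
    let ?a = "zmon m z * cnj (zmon m w)"
    have "?a * ag_partial dt (al m) N (X z * cnj (X w)) * ag_partial dt (be m) N (Y z * cnj (Y w)) =
        (\<Sum>k<N. \<Sum>l<N. ?a * ((of_int (al m + int k * dt) * (X z * cnj (X w)) ^ k) *
           (of_int (be m + int l * dt) * (Y z * cnj (Y w)) ^ l)))"
      by (simp only: mult.assoc[of ?a] ag_partial_def sum_product) (simp only: sum_distrib_left)
    also have "\<dots> = (\<Sum>k<N. \<Sum>l<N. of_int (al (shift m k l) * be (shift m k l)) * (zmon (shift m k l) z * cnj (zmon (shift m k l) w)))"
      by (intro sum.cong refl) (simp add: al_shift be_shift zmon_shift z w power_mult_distrib)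
    finally show ?thesis .
  qed
  then show ?thesis
    by (simp add: kernel_partial_def shifts_def sum.cartesian_product split_beta)
qed

lemma kernel_partial_measurable [measurable]: "(\<lambda>z. kernel_partial N z w) \<in> borel_measurable borel"
  unfolding kernel_partial_def ag_partial_def X_def Y_def by measurable

lemma kernel_partial_tendsto:
  assumes "z \<in> U" "w \<in> U"
  shows "(\<lambda>N. kernel_partial N z w) \<longlonglongrightarrow> kernel z w"
proof -
  have "norm (X z * cnj (X w)) < 1" "norm (Y z * cnj (Y w)) < 1"
    using norm_XX[OF assms(1), of w] norm_YY[OF assms(1), of w] norm_X[OF assms(2)] norm_Y[OF assms(2)] by auto
  then show ?thesis
    unfolding kernel_partial_def kernel_def kernel_term_def
    by (intro tendsto_mult tendsto_const tendsto_sum ag_partial_tendsto)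
qed

lemma norm_kernel_partial_le:
  assumes "z \<in> U" "w \<in> U"
  shows "norm (kernel_partial N z w) \<le> norm (1 / (pi\<^sup>2 * dt)) *
    (\<Sum>m\<in>R. norm (zmon m z) * (norm (zmon m w) * (dt / (1 - norm (X w))\<^sup>2) * (dt / (1 - norm (Y w))\<^sup>2)))"
proof -
  have "norm (zmon m z * cnj (zmon m w) * ag_partial dt (al m) N (X z * cnj (X w)) * ag_partial dt (be m) N (Y z * cnj (Y w)))
      \<le> norm (zmon m z) * (norm (zmon m w) * (dt / (1 - norm (X w))\<^sup>2) * (dt / (1 - norm (Y w))\<^sup>2))"
    if m: "m \<in> R" for m
  proof -
    have "norm (ag_partial dt (al m) N (X z * cnj (X w))) \<le> dt / (1 - norm (X w))\<^sup>2"
      by (rule norm_ag_partial_le[OF norm_XX[OF assms(1)] norm_X[OF assms(2)]]) (use R_D[OF m] in auto)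
    moreover have "norm (ag_partial dt (be m) N (Y z * cnj (Y w))) \<le> dt / (1 - norm (Y w))\<^sup>2"
      by (rule norm_ag_partial_le[OF norm_YY[OF assms(1)] norm_Y[OF assms(2)]]) (use R_D[OF m] in auto)
    ultimately have "norm (zmon m z * cnj (zmon m w)) * (norm (ag_partial dt (al m) N (X z * cnj (X w))) * norm (ag_partial dt (be m) N (Y z * cnj (Y w))))
      \<le> norm (zmon m z * cnj (zmon m w)) * ((dt / (1 - norm (X w))\<^sup>2) * (dt / (1 - norm (Y w))\<^sup>2))"
      using dt_pos by (intro mult_left_mono mult_mono) auto
    then show ?thesis
      by (simp add: norm_mult mult.assoc)
  qed
  then have "norm (\<Sum>m\<in>R. zmon m z * cnj (zmon m w) * ag_partial dt (al m) N (X z * cnj (X w)) * ag_partial dt (be m) N (Y z * cnj (Y w)))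
     \<le> (\<Sum>m\<in>R. norm (zmon m z) * (norm (zmon m w) * (dt / (1 - norm (X w))\<^sup>2) * (dt / (1 - norm (Y w))\<^sup>2)))"
    by (rule sum_norm_le)
  then show ?thesis
    unfolding kernel_partial_def norm_mult norm_of_real real_norm_def by (rule mult_left_mono) simp
qed

text \<open>By orthogonality only the summand with exponent \<open>m\<close> survives.\<close>

lemma integral_zmon_kernel_partial:
  assumes m: "al m > 0" "be m > 0" and w: "fst w \<noteq> 0" "snd w \<noteq> 0" and "m \<in> sh ` shifts N"
  shows "(\<integral>z. indicator U z *\<^sub>R (zmon m z * cnj (kernel_partial N z w)) \<partial>lborel) = zmon m w"
proof -
  let ?c = "of_real (1 / (pi\<^sup>2 * dt)) :: complex"
  let ?d = "\<lambda>n. of_int (al n * be n) * zmon n w"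
  let ?I = "\<lambda>n z. indicator U z *\<^sub>R (zmon m z * cnj (zmon n z))"
  have int: "integrable lborel (?I (sh t))" if "t \<in> shifts N" for t
    using shifts_pos[OF that] m by (intro integral_zmon_cnj_zmon) auto
  have "(\<integral>z. indicator U z *\<^sub>R (zmon m z * cnj (kernel_partial N z w)) \<partial>lborel) =
      (\<integral>z. ?c * (\<Sum>t\<in>shifts N. ?d (sh t) * ?I (sh t) z) \<partial>lborel)"
  proof (rule integral_cong_AE)
    show "AE z in lborel. indicator U z *\<^sub>R (zmon m z * cnj (kernel_partial N z w)) =
        ?c * (\<Sum>t\<in>shifts N. ?d (sh t) * ?I (sh t) z)"
      using AE_lborel_coordinates_nonzero
    proof eventually_elim
      case (elim z)
      then show ?case
        using w by (simp add: kernel_partial_expand sum_distrib_left scaleR_conv_of_real mult_ac)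
    qed
  qed measurable
  also have "\<dots> = ?c * (\<Sum>t\<in>shifts N. \<integral>z. ?d (sh t) * ?I (sh t) z \<partial>lborel)"
  proof -
    have "(\<integral>z. (\<Sum>t\<in>shifts N. ?d (sh t) * ?I (sh t) z) \<partial>lborel) =
        (\<Sum>t\<in>shifts N. \<integral>z. ?d (sh t) * ?I (sh t) z \<partial>lborel)"
      by (rule Bochner_Integration.integral_sum) (rule integrable_mult_right[OF int])
    then show ?thesis by (simp only: integral_mult_right_zero)
  qed
  also have "\<dots> = ?c * (\<Sum>t\<in>shifts N. ?d (sh t) * (\<integral>z. ?I (sh t) z \<partial>lborel))"
    by (simp only: integral_mult_right_zero)
  also have "(\<Sum>t\<in>shifts N. ?d (sh t) * (\<integral>z. ?I (sh t) z \<partial>lborel)) =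
      (\<Sum>n\<in>sh ` shifts N. ?d n * (\<integral>z. ?I n z \<partial>lborel))"
    by (simp only: sum.reindex[OF sh_inj] o_def)
  also have "\<dots> = (\<Sum>n\<in>sh ` shifts N. if n = m then ?d m * of_real (pi\<^sup>2 * dt / (al m * be m)) else 0)"
  proof (rule sum.cong)
    fix n assume "n \<in> sh ` shifts N"
    then have "al n > 0" "be n > 0" using shifts_pos by auto
    then show "?d n * (\<integral>z. ?I n z \<partial>lborel) = (if n = m then ?d m * of_real (pi\<^sup>2 * dt / (al m * be m)) else 0)"
      using integral_zmon_cnj_zmon(2)[OF m, of n] by auto
  qed simp
  also have "\<dots> = ?d m * of_real (pi\<^sup>2 * dt / (al m * be m))"
    using assms(5) by (simp add: finite_shifts)
  also have "?c * \<dots> = zmon m w"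
    using dt_pos m by (simp add: field_simps)
  finally show ?thesis .
qed

text \<open>Dominated convergence: the partial sums obey the bound of the full kernel, uniformly in \<open>N\<close>.\<close>

lemma integral_zmon_kernel:
  assumes m: "al m > 0" "be m > 0" and w: "w \<in> U" "fst w \<noteq> 0" "snd w \<noteq> 0"
  shows "(\<integral>z. indicator U z *\<^sub>R (zmon m z * cnj (kernel z w)) \<partial>lborel) = zmon m w"
proof -
  let ?C = "\<lambda>n. norm (zmon n w) * (dt / (1 - norm (X w))\<^sup>2) * (dt / (1 - norm (Y w))\<^sup>2)"
  let ?g = "\<lambda>z. norm (1 / (pi\<^sup>2 * dt)) * (\<Sum>n\<in>R. ?C n * norm ((indicator U z *\<^sub>R zmon m z) * (indicator U z *\<^sub>R zmon n z)))"
  have "(\<lambda>N. \<integral>z. indicator U z *\<^sub>R (zmon m z * cnj (kernel_partial N z w)) \<partial>lborel)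
      \<longlonglongrightarrow> (\<integral>z. indicator U z *\<^sub>R (zmon m z * cnj (kernel z w)) \<partial>lborel)"
  proof (rule integral_dominated_convergence[where w = ?g])
    have [measurable]: "(\<lambda>z. indicator U z *\<^sub>R kernel z w) \<in> borel_measurable borel"
      using bergman_cut(1)[OF kernel_in_bergman_space[OF w(1)]] by (rule cut_measurable)
    have "(\<lambda>z. zmon m z * cnj (indicator U z *\<^sub>R kernel z w)) \<in> borel_measurable borel"
      by measurable
    then show "(\<lambda>z. indicator U z *\<^sub>R (zmon m z * cnj (kernel z w))) \<in> borel_measurable lborel"
      by (simp add: scaleR_conv_of_real mult_ac)
    show "(\<lambda>z. indicator U z *\<^sub>R (zmon m z * cnj (kernel_partial N z w))) \<in> borel_measurable lborel" for N
      by measurable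
    have "integrable lborel (\<lambda>z. (indicator U z *\<^sub>R zmon m z) * (indicator U z *\<^sub>R zmon n z))" if "n \<in> R" for n
      by (rule integrable_mult_L2) (use m R_D[OF that] integrable_cut_zmon in auto)
    then show "integrable lborel ?g"
      by (intro integrable_mult_right Bochner_Integration.integrable_sum integrable_norm)
    show "AE z in lborel. (\<lambda>N. indicator U z *\<^sub>R (zmon m z * cnj (kernel_partial N z w)))
        \<longlonglongrightarrow> indicator U z *\<^sub>R (zmon m z * cnj (kernel z w))"
    proof (rule AE_I2)
      fix z
      show "(\<lambda>N. indicator U z *\<^sub>R (zmon m z * cnj (kernel_partial N z w)))
        \<longlonglongrightarrow> indicator U z *\<^sub>R (zmon m z * cnj (kernel z w))"
        by (cases "z \<in> U") (auto intro!: tendsto_intros kernel_partial_tendsto w)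
    qed
    show "AE z in lborel. norm (indicator U z *\<^sub>R (zmon m z * cnj (kernel_partial N z w))) \<le> ?g z" for N
    proof (rule AE_I2)
      fix z
      show "norm (indicator U z *\<^sub>R (zmon m z * cnj (kernel_partial N z w))) \<le> ?g z"
      proof (cases "z \<in> U")
        case True
        have "norm (zmon m z) * norm (kernel_partial N z w) \<le> norm (zmon m z) *
          (norm (1 / (pi\<^sup>2 * dt)) * (\<Sum>n\<in>R. norm (zmon n z) * ?C n))"
          by (intro mult_left_mono norm_kernel_partial_le True w) simp
        also have "\<dots> = ?g z"
          using True by (simp add: sum_distrib_left norm_mult mult_ac)
        finally show ?thesis using True by (simp add: norm_mult)
      qed simp
    qed
  qed
  moreover have "\<forall>\<^sub>F N in sequentially. (\<integral>z. indicator U z *\<^sub>R (zmon m z * cnj (kernel_partial N z w)) \<partial>lborel) = zmon m w"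
    using shifts_exhaust[OF m] by eventually_elim (rule integral_zmon_kernel_partial[OF m w(2,3)])
  ultimately show ?thesis
    by (rule LIMSEQ_unique[OF _ tendsto_eventually])
qed


section \<open>The reproducing property\<close>

definition reproduce :: "(complex \<times> complex \<Rightarrow> complex) \<Rightarrow> complex \<times> complex \<Rightarrow> complex" where
  "reproduce f w = (\<integral>z. indicator U z *\<^sub>R (f z * cnj (kernel z w)) \<partial>lborel)"

lemma cnj_ag_sum: "cnj (ag_sum d a x) = ag_sum d a (cnj x)"
  by (simp add: ag_sum_def)

lemma kernel_term_cnj: "kernel_term m z w = cnj (kernel_term m w z)"
  by (simp add: kernel_term_def cnj_ag_sum mult_ac)

lemma kernel_pmul: assumes "e \<in> torus" shows "kernel (pmul e z) (pmul e w) = kernel z w"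
proof -
  have inv: "zmon m (pmul e z) * cnj (zmon m (pmul e w)) = zmon m z * cnj (zmon m w)" for m
  proof -
    have "zmon m e * cnj (zmon m e) = 1"
      using norm_zmon_torus[OF assms, of m] by (simp add: complex_norm_square[symmetric])
    moreover have "zmon m (pmul e z) * cnj (zmon m (pmul e w)) = (zmon m e * cnj (zmon m e)) * (zmon m z * cnj (zmon m w))"
      by (simp add: zmon_pmul mult_ac)
    ultimately show ?thesis by simp
  qed
  then show ?thesis
    by (simp add: kernel_def kernel_term_def X_def Y_def)
qed

lemma kernel_term_tendsto:
  assumes m: "m \<in> R" and z: "z \<in> U" and w: "w \<in> U" and v: "v \<longlonglongrightarrow> w"
  shows "(\<lambda>n. kernel_term m z (v n)) \<longlonglongrightarrow> kernel_term m z w"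
proof -
  have "isCont (\<lambda>w. kernel_term m w z) w"
    by (intro holo_at_imp_continuous holo_at_kernel_term assms)
  then have "(\<lambda>n. kernel_term m (v n) z) \<longlonglongrightarrow> kernel_term m w z"
    using v by (rule isCont_tendsto_compose)
  then show ?thesis
    unfolding kernel_term_cnj[of m z] by (rule tendsto_cnj)
qed

text \<open>A dominating function for the continuity of \<open>w \<mapsto> \<integral> f(z) cnj (K(z, w))\<close>: the constant in
  \<open>norm_kernel_term_le\<close> depends continuously on \<open>w\<close>.\<close>

lemma kernel_term_sequence_bound:
  assumes m: "m \<in> R" and w: "w \<in> U" and v: "v \<longlonglongrightarrow> w" "\<And>n. v n \<in> U"
  shows "\<exists>C. \<forall>n. \<forall>z\<in>U. norm (kernel_term m z (v n)) \<le> norm (zmon m z) * C"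
proof -
  let ?c = "\<lambda>w. norm (zmon m w) * (dt / (1 - norm (X w))\<^sup>2) * (dt / (1 - norm (Y w))\<^sup>2)"
  have lim: "(\<lambda>n. zmon m (v n)) \<longlonglongrightarrow> zmon m w" "(\<lambda>n. X (v n)) \<longlonglongrightarrow> X w" "(\<lambda>n. Y (v n)) \<longlonglongrightarrow> Y w"
    by (intro isCont_tendsto_compose[OF holo_at_imp_continuous v(1)] holo_at_zmon_R holo_at_X holo_at_Y m w)+
  have "(\<lambda>n. ?c (v n)) \<longlonglongrightarrow> ?c w"
    using norm_X[OF w] norm_Y[OF w] by (intro tendsto_intros lim) auto
  then have "Bseq (\<lambda>n. ?c (v n))"
    by (rule convergent_imp_Bseq[OF convergentI])
  then obtain C where C: "\<And>n. norm (?c (v n)) \<le> C"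
    by (auto simp: Bseq_def)
  show ?thesis
  proof (intro exI[of _ C] allI ballI)
    fix n z assume z: "z \<in> U"
    have "norm (kernel_term m z (v n)) \<le> norm (zmon m z) * ?c (v n)"
      by (rule norm_kernel_term_le[OF m z v(2)])
    also have "?c (v n) \<le> C"
      using C[of n] unfolding real_norm_def by (rule order_trans[OF abs_ge_self])
    finally show "norm (kernel_term m z (v n)) \<le> norm (zmon m z) * C"
      by (simp add: mult_left_mono)
  qed
qed

lemma reproduce_tendsto:
  assumes f: "f \<in> bergman_space U" and w: "w \<in> U" and v: "v \<longlonglongrightarrow> w" "\<And>n. v n \<in> U"
  shows "(\<lambda>n. reproduce f (v n)) \<longlonglongrightarrow> reproduce f w"
proof -
  have "\<forall>m\<in>R. \<exists>C. \<forall>n. \<forall>z\<in>U. norm (kernel_term m z (v n)) \<le> norm (zmon m z) * C"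
    using kernel_term_sequence_bound[OF _ w v] by blast
  then obtain C where C: "\<And>m n z. m \<in> R \<Longrightarrow> z \<in> U \<Longrightarrow> norm (kernel_term m z (v n)) \<le> norm (zmon m z) * C m"
    by metis
  define F where "F z = indicator U z *\<^sub>R f z" for z
  have L2: "integrable lborel (\<lambda>z. (norm (F z))\<^sup>2)" and [measurable]: "F \<in> borel_measurable borel"
    using bergman_cut[OF f] cut_measurable by (auto simp: F_def [abs_def])
  define G where "G w z = indicator U z *\<^sub>R kernel z w" for w z
  have G [measurable]: "G w \<in> borel_measurable borel" if "w \<in> U" for w
    unfolding G_def using bergman_cut(1)[OF kernel_in_bergman_space[OF that]] by (rule cut_measurable)
  have eq: "indicator U z *\<^sub>R (f z * cnj (kernel z w)) = F z * cnj (G w z)" for z w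
    by (auto simp: F_def G_def split: split_indicator)
  let ?g = "\<lambda>z. norm (1 / (pi\<^sup>2 * dt)) * (\<Sum>m\<in>R. C m * norm (F z * (indicator U z *\<^sub>R zmon m z)))"
  show ?thesis
    unfolding reproduce_def eq
  proof (rule integral_dominated_convergence[where w = ?g])
    show "(\<lambda>z. F z * cnj (G w z)) \<in> borel_measurable lborel"
      using G[OF w] by measurable
    show "(\<lambda>z. F z * cnj (G (v n) z)) \<in> borel_measurable lborel" for n
      using G[OF v(2)[of n]] by measurable
    have "integrable lborel (\<lambda>z. F z * (indicator U z *\<^sub>R zmon m z))" if "m \<in> R" for m
      by (rule integrable_mult_L2) (use L2 R_D[OF that] integrable_cut_zmon in auto)
    then show "integrable lborel ?g"
      by (intro integrable_mult_right Bochner_Integration.integrable_sum integrable_norm)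
    show "AE z in lborel. (\<lambda>n. F z * cnj (G (v n) z)) \<longlonglongrightarrow> F z * cnj (G w z)"
    proof (rule AE_I2)
      fix z
      have "(\<lambda>n. G (v n) z) \<longlonglongrightarrow> G w z"
        unfolding G_def kernel_def using w v dt_pos
        by (cases "z \<in> U") (auto intro!: tendsto_intros kernel_term_tendsto)
      then show "(\<lambda>n. F z * cnj (G (v n) z)) \<longlonglongrightarrow> F z * cnj (G w z)"
        by (intro tendsto_intros)
    qed
    show "AE z in lborel. norm (F z * cnj (G (v n) z)) \<le> ?g z" for n
    proof (rule AE_I2)
      fix z
      show "norm (F z * cnj (G (v n) z)) \<le> ?g z"
      proof (cases "z \<in> U")
        case True
        have "norm (\<Sum>m\<in>R. kernel_term m z (v n)) \<le> (\<Sum>m\<in>R. norm (zmon m z) * C m)"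
          using C[OF _ True] by (rule sum_norm_le)
        then have "norm (F z) * (norm (1 / (pi\<^sup>2 * dt)) * norm (\<Sum>m\<in>R. kernel_term m z (v n))) \<le>
            norm (F z) * (norm (1 / (pi\<^sup>2 * dt)) * (\<Sum>m\<in>R. norm (zmon m z) * C m))"
          by (intro mult_left_mono) auto
        also have "\<dots> = ?g z"
          using True by (simp add: sum_distrib_left sum_divide_distrib norm_mult mult_ac)
        finally have le: "norm (F z) * (norm (1 / (pi\<^sup>2 * dt)) * norm (\<Sum>m\<in>R. kernel_term m z (v n))) \<le> ?g z" .
        have G_norm: "norm (G (v n) z) = norm (1 / (pi\<^sup>2 * dt)) * norm (\<Sum>m\<in>R. kernel_term m z (v n))"
          using True unfolding G_def kernel_def norm_scaleR norm_mult norm_of_real by simp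
        have "norm (F z * cnj (G (v n) z)) = norm (F z) * norm (G (v n) z)"
          by (simp add: norm_mult)
        then show ?thesis
          unfolding G_norm using le by (rule ord_eq_le_trans)
      qed (simp add: F_def)
    qed
  qed
qed

lemma continuous_on_pmul: "continuous_on S (\<lambda>e. pmul e w)"
  unfolding pmul_def by (intro continuous_intros)

lemma continuous_on_reproduce: "f \<in> bergman_space U \<Longrightarrow> continuous_on U (reproduce f)"
  unfolding continuous_on_sequentially using reproduce_tendsto by (auto simp: o_def)

text \<open>Rotating the argument of the kernel amounts to rotating \<open>f\<close>, so averaging against a character
  replaces \<open>f\<close> by its Laurent component, which the kernel reproduces.\<close>

lemma torus_mean_reproduce:
  assumes f: "f \<in> bergman_space U" and w: "w \<in> U" "fst w \<noteq> 0" "snd w \<noteq> 0"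
  shows "(\<integral>e. indicator torus e *\<^sub>R reproduce f (pmul e w) * zmon (- m) e \<partial>torus_measure) =
    (\<integral>e. indicator U (pmul e w) *\<^sub>R f (pmul e w) * zmon (- m) e \<partial>torus_measure)"
proof -
  define F where "F z = indicator U z *\<^sub>R f z" for z
  have L2: "integrable lborel (\<lambda>z. (norm (F z))\<^sup>2)" and [measurable]: "F \<in> borel_measurable borel"
    using bergman_cut[OF f] cut_measurable by (auto simp: F_def [abs_def])
  define G where "G z = cnj (indicator U z *\<^sub>R kernel z w)" for z
  have G2: "integrable lborel (\<lambda>z. (norm (G z))\<^sup>2)"
    using bergman_cut(2)[OF kernel_in_bergman_space[OF w(1)]] by (simp add: G_def)
  have [measurable]: "G \<in> borel_measurable borel"
    unfolding G_def using cut_measurable[OF bergman_cut(1)[OF kernel_in_bergman_space[OF w(1)]]]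
    by (rule borel_measurable_cnj)
  from laurent_coefficient[OF bergman_cut(1)[OF f], of m, folded F_def]
  obtain c where "\<forall>z\<in>U. fst z \<noteq> 0 \<longrightarrow> snd z \<noteq> 0 \<longrightarrow>
      (\<integral>e. F (pmul e z) * zmon (- m) e \<partial>torus_measure) = c * zmon m z" ..
  then have c: "(\<integral>e. F (pmul e z) * zmon (- m) e \<partial>torus_measure) = c * zmon m z"
    if "z \<in> U" "fst z \<noteq> 0" "snd z \<noteq> 0" for z
    using that by blast
  have rot: "reproduce f (pmul e w) = (\<integral>z. F (pmul e z) * G z \<partial>lborel)" if e: "e \<in> torus" for e
  proof -
    have [measurable]: "(\<lambda>z. indicator U z *\<^sub>R kernel z (pmul e w)) \<in> borel_measurable borel"
      using bergman_cut(1)[OF kernel_in_bergman_space, of "pmul e w"] e w by (intro cut_measurable) auto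
    have "reproduce f (pmul e w) = (\<integral>z. F z * cnj (indicator U z *\<^sub>R kernel z (pmul e w)) \<partial>lborel)"
      unfolding reproduce_def F_def by (intro Bochner_Integration.integral_cong) (auto split: split_indicator)
    also have "\<dots> = (\<integral>z. F (pmul e z) * cnj (indicator U (pmul e z) *\<^sub>R kernel (pmul e z) (pmul e w)) \<partial>lborel)"
      by (rule integral_pmul[OF _ e, symmetric]) measurable
    also have "\<dots> = (\<integral>z. F (pmul e z) * G z \<partial>lborel)"
      using e by (simp add: kernel_pmul G_def indicator_def)
    finally show ?thesis .
  qed
  have int: "integrable (torus_measure \<Otimes>\<^sub>M lborel) (\<lambda>(e, z). F (pmul e z) * G z * zmon (- m) e)"
    using integrable_torus_pair_L2[OF _ _ L2 G2] by (simp add: case_prod_beta')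
  have "(\<integral>e. indicator torus e *\<^sub>R reproduce f (pmul e w) * zmon (- m) e \<partial>torus_measure) =
      (\<integral>e. \<integral>z. F (pmul e z) * G z * zmon (- m) e \<partial>lborel \<partial>torus_measure)"
  proof (rule integral_cong_AE)
    have "continuous_on torus (\<lambda>e. reproduce f (pmul e w))"
      by (rule continuous_on_compose2[OF continuous_on_reproduce[OF f]])
         (use w in \<open>auto intro: continuous_on_pmul\<close>)
    then have [measurable]: "(\<lambda>e. indicator torus e *\<^sub>R reproduce f (pmul e w)) \<in> borel_measurable borel"
      by (intro borel_measurable_continuous_on_indicator) simp_all
    show "(\<lambda>e. indicator torus e *\<^sub>R reproduce f (pmul e w) * zmon (- m) e) \<in> borel_measurable torus_measure"
      by measurable
    show "(\<lambda>e. \<integral>z. F (pmul e z) * G z * zmon (- m) e \<partial>lborel) \<in> borel_measurable torus_measure"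
      by measurable
    show "AE e in torus_measure. indicator torus e *\<^sub>R reproduce f (pmul e w) * zmon (- m) e =
        (\<integral>z. F (pmul e z) * G z * zmon (- m) e \<partial>lborel)"
      using AE_torus by eventually_elim (simp add: rot)
  qed
  also have "\<dots> = (\<integral>z. \<integral>e. F (pmul e z) * G z * zmon (- m) e \<partial>torus_measure \<partial>lborel)"
    using torus_lborel.Fubini_integral[OF int] by simp
  also have "\<dots> = (\<integral>z. c * (indicator U z *\<^sub>R (zmon m z * cnj (kernel z w))) \<partial>lborel)"
  proof (rule integral_cong_AE)
    have "(\<lambda>z. c * (zmon m z * G z)) \<in> borel_measurable lborel" by measurable
    also have "(\<lambda>z. c * (zmon m z * G z)) = (\<lambda>z. c * (indicator U z *\<^sub>R (zmon m z * cnj (kernel z w))))"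
      by (auto simp: G_def fun_eq_iff split: split_indicator)
    finally show "(\<lambda>z. c * (indicator U z *\<^sub>R (zmon m z * cnj (kernel z w)))) \<in> borel_measurable lborel" .
    show "(\<lambda>z. \<integral>e. F (pmul e z) * G z * zmon (- m) e \<partial>torus_measure) \<in> borel_measurable lborel"
      by measurable
    show "AE z in lborel. (\<integral>e. F (pmul e z) * G z * zmon (- m) e \<partial>torus_measure) =
        c * (indicator U z *\<^sub>R (zmon m z * cnj (kernel z w)))"
      using AE_lborel_coordinates_nonzero
    proof eventually_elim
      case (elim z)
      have "(\<integral>e. F (pmul e z) * G z * zmon (- m) e \<partial>torus_measure) = G z * (\<integral>e. F (pmul e z) * zmon (- m) e \<partial>torus_measure)"
        by (subst integral_mult_right_zero[symmetric]) (simp add: mult_ac)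
      then show ?case
        using c[of z] elim by (cases "z \<in> U") (simp_all add: G_def mult_ac)
    qed
  qed
  also have "\<dots> = c * (\<integral>z. indicator U z *\<^sub>R (zmon m z * cnj (kernel z w)) \<partial>lborel)"
    by (rule integral_mult_right_zero)
  also have "\<dots> = c * zmon m w"
  proof (cases "c = 0")
    case False
    then have "al m > 0 \<and> be m > 0"
      using c by (intro laurent_coefficient_L2[OF f]) (auto simp: F_def)
    then show ?thesis
      using integral_zmon_kernel[OF _ _ w] by simp
  qed simp
  also have "\<dots> = (\<integral>e. F (pmul e w) * zmon (- m) e \<partial>torus_measure)"
    using c[OF w] by simp
  finally show ?thesis
    by (simp add: F_def)
qed

text \<open>As functions of the rotation \<open>e\<close>, both sides at \<open>pmul e w\<close> are continuous and have the same Fourier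
  coefficients; evaluate at \<open>e = (1, 1)\<close>.\<close>

lemma reproduce_nonzero:
  assumes f: "f \<in> bergman_space U" and w: "w \<in> U" "fst w \<noteq> 0" "snd w \<noteq> 0"
  shows "reproduce f w = f w"
proof -
  define h where "h e = indicator torus e *\<^sub>R reproduce f (pmul e w) - indicator U (pmul e w) *\<^sub>R f (pmul e w)" for e
  have hol: "f holomorphic2_on U" by (rule bergman_cut(1)[OF f])
  have c1: "continuous_on torus (\<lambda>e. reproduce f (pmul e w))"
    by (rule continuous_on_compose2[OF continuous_on_reproduce[OF f]])
       (use w in \<open>auto intro: continuous_on_pmul\<close>)
  have c1': "continuous_on torus (\<lambda>e. indicator torus e *\<^sub>R reproduce f (pmul e w))"
    using c1 by (simp cong: continuous_on_cong)
  have c2: "continuous_on torus (\<lambda>e. indicator U (pmul e w) *\<^sub>R f (pmul e w))"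
    by (rule continuous_on_orbit[OF hol w(1)])
  have m1: "(\<lambda>e. indicator torus e *\<^sub>R reproduce f (pmul e w)) \<in> borel_measurable borel"
    using c1 by (intro borel_measurable_continuous_on_indicator) simp_all
  have [measurable]: "(\<lambda>z. indicator U z *\<^sub>R f z) \<in> borel_measurable borel"
    by (rule cut_measurable[OF hol])
  have m2: "(\<lambda>e. indicator U (pmul e w) *\<^sub>R f (pmul e w)) \<in> borel_measurable borel"
    by (rule measurable_compose[where f = "\<lambda>e. pmul e w" and g = "\<lambda>z. indicator U z *\<^sub>R f z"]) measurable
  have "(\<integral>e. h e * zmon m e \<partial>torus_measure) = 0" for m
    using torus_mean_reproduce[OF f w, of "- m"] integrable_torus_zmon[OF m1 c1'] integrable_torus_zmon[OF m2 c2]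
    by (simp add: h_def left_diff_distrib)
  moreover have "h \<in> borel_measurable borel"
    unfolding h_def by (rule borel_measurable_diff[OF m1 m2])
  moreover have "continuous_on torus h"
    unfolding h_def by (rule continuous_on_diff[OF c1' c2])
  ultimately have "fourier_null h"
    by (simp add: fourier_null_def)
  then have "h (1, 1) = 0"
    by (rule fourier_null_imp_zero) (simp add: torus_iff)
  then show ?thesis
    using w by (simp add: h_def pmul_def torus_iff)
qed

text \<open>A point on a coordinate axis is a limit of points off the axes, and both sides are continuous.\<close>

lemma reproduce_eq:
  assumes f: "f \<in> bergman_space U" and w: "w \<in> U"
  shows "reproduce f w = f w"
proof -
  define v where "v n = (if fst w = 0 then of_real (1 / real (Suc n)) else fst w, if snd w = 0 then of_real (1 / real (Suc n)) else snd w)" for n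
  have "(\<lambda>n. complex_of_real (1 / real (Suc n))) \<longlonglongrightarrow> complex_of_real 0"
    by (intro tendsto_of_real LIMSEQ_Suc[OF lim_1_over_n])
  then have lim0: "(\<lambda>n. complex_of_real (1 / real (Suc n))) \<longlonglongrightarrow> 0"
    by (simp only: of_real_0)
  have "v \<longlonglongrightarrow> (fst w, snd w)"
    unfolding v_def
  proof (rule tendsto_Pair)
    show "(\<lambda>n. if fst w = 0 then of_real (1 / real (Suc n)) else fst w) \<longlonglongrightarrow> fst w"
      by (cases "fst w = 0") (simp_all only: if_True if_False lim0 tendsto_const simp_thms)
    show "(\<lambda>n. if snd w = 0 then of_real (1 / real (Suc n)) else snd w) \<longlonglongrightarrow> snd w"
      by (cases "snd w = 0") (simp_all only: if_True if_False lim0 tendsto_const simp_thms)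
  qed
  then have v: "v \<longlonglongrightarrow> w" by simp
  have nz: "fst (v n) \<noteq> 0" "snd (v n) \<noteq> 0" for n
    by (auto simp: v_def simp del: of_nat_Suc)
  have U: "\<forall>\<^sub>F n in sequentially. v n \<in> U"
    using topological_tendstoD[OF v open_U w] .
  have "isCont (reproduce f) w"
    using continuous_on_reproduce[OF f] continuous_on_eq_continuous_at[OF open_U] w by blast
  then have 1: "(\<lambda>n. reproduce f (v n)) \<longlonglongrightarrow> reproduce f w"
    by (rule isCont_tendsto_compose[OF _ v])
  have "isCont f w"
    using bergman_cut(1)[OF f] w by (auto simp: holomorphic2_on_iff holo_at_imp_continuous)
  then have "(\<lambda>n. f (v n)) \<longlonglongrightarrow> f w"
    by (rule isCont_tendsto_compose[OF _ v])
  then have 2: "(\<lambda>n. reproduce f (v n)) \<longlonglongrightarrow> f w"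
    by (rule Lim_transform_eventually) (use U in \<open>eventually_elim, simp add: reproduce_nonzero[OF f] nz\<close>)
  show ?thesis
    by (rule LIMSEQ_unique[OF 1 2])
qed

lemma is_bergman_kernel_kernel: "is_bergman_kernel U kernel"
  unfolding is_bergman_kernel_def
proof (intro ballI conjI)
  fix w f assume "w \<in> U" "f \<in> bergman_space U"
  then show "f w = (LINT z:U|lborel. f z * cnj (kernel z w))"
    using reproduce_eq[of f w] by (simp add: reproduce_def set_lebesgue_integral_def)
qed (rule kernel_in_bergman_space)

end

section \<open>Integer polynomials in two variables\<close>

lemma eval_int_poly2_0: "eval_int_poly2 0 t1 t2 = 0"
  by (simp add: eval_int_poly2_def)

lemma eval_int_poly2_add: "eval_int_poly2 (g + h) t1 t2 = eval_int_poly2 g t1 t2 + eval_int_poly2 h t1 t2"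
proof -
  have add: "map_poly f (u + v) = map_poly f u + map_poly f v"
    if "\<And>x y. f (x + y) = f x + f y" "f 0 = 0" for f :: "'a::comm_monoid_add \<Rightarrow> 'b::comm_monoid_add" and u v
    by (rule poly_eqI) (simp add: coeff_map_poly that)
  have "map_poly (of_int :: int \<Rightarrow> complex) (u + v) = map_poly of_int u + map_poly of_int v" for u v
    by (rule add) simp_all
  then show ?thesis
    unfolding eval_int_poly2_def by (subst add) simp_all
qed

lemma eval_int_poly2_monom: "eval_int_poly2 (monom (monom c i) j) t1 t2 = of_int c * t1 ^ i * t2 ^ j"
  by (simp add: eval_int_poly2_def map_poly_monom poly_monom)

lemma eval_int_poly2_sum: "eval_int_poly2 (\<Sum>i\<in>I. g i) t1 t2 = (\<Sum>i\<in>I. eval_int_poly2 (g i) t1 t2)"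
  by (induction I rule: infinite_finite_induct) (simp_all add: eval_int_poly2_0 eval_int_poly2_add)

section \<open>The closed form of the kernel\<close>

text \<open>If \<open>u = v\<close>, both sides are divisions by 0 and equal 0.\<close>

lemma ag_sum_divide:
  assumes "v \<noteq> 0"
  shows "ag_sum d a (u / v) = v * (of_int a * v + of_int (d - a) * u) / (v - u)\<^sup>2"
proof -
  have "1 - u / v = (v - u) / v" "of_int a + of_int (d - a) * (u / v) = (of_int a * v + of_int (d - a) * u) / v"
    using assms by (simp_all add: field_simps)
  then show ?thesis
    unfolding ag_sum_def using assms by (simp add: power_divide power2_eq_square)
qed

context monomial_wedge
begin

text \<open>The product \<open>t\<^sub>1\<^sup>i t\<^sub>2\<^sup>j (a t\<^sub>2\<^sup>q + (d - a) t\<^sub>1\<^sup>p) (b t\<^sub>1\<^sup>s + (d - b) t\<^sub>2\<^sup>r)\<close>, multiplied out. The offsets \<open>s\<close> and \<open>q\<close> in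
  \<open>i\<close> and \<open>j\<close> come from clearing the denominators of \<open>X\<close> and \<open>Y\<close>.\<close>

definition numerator_term :: "int \<times> int \<Rightarrow> int poly poly" where
  "numerator_term m = (let i = nat (fst m + s); j = nat (snd m + q); a = al m; b = be m in
     monom (monom (a * b) (i + s)) (j + q) + monom (monom (a * (dt - b)) i) (j + q + r) +
     monom (monom ((dt - a) * b) (i + p + s)) j + monom (monom ((dt - a) * (dt - b)) (i + p)) (j + r))"

lemma eval_numerator_term:
  "eval_int_poly2 (numerator_term m) t1 t2 = t1 ^ nat (fst m + s) * t2 ^ nat (snd m + q) *
     (of_int (al m) * t2 ^ q + of_int (dt - al m) * t1 ^ p) * (of_int (be m) * t1 ^ s + of_int (dt - be m) * t2 ^ r)"
  by (simp add: numerator_term_def Let_def eval_int_poly2_add eval_int_poly2_monom power_add algebra_simps)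

text \<open>Cramer's rule with \<open>al m > 0\<close> and \<open>be m \<le> dt\<close> bounds the first exponent from below; exchanging
  the roles of \<open>al\<close> and \<open>be\<close> bounds the second.\<close>

lemma R_exponents:
  assumes "m \<in> R"
  shows "fst m + s \<ge> 0" "snd m + q \<ge> 0"
proof -
  note m = R_D[OF assms]
  have "int s * be m \<le> int s * dt" "int q * al m \<le> int q * dt"
    using m by (auto intro!: mult_left_mono)
  moreover have "int p * al m > 0" "int r * be m > 0"
    using m p_pos r_pos by auto
  ultimately have "dt * (fst m + 1 + int s) > 0" "dt * (snd m + 1 + int q) > 0"
    using dt_al_be[of m] by (simp_all add: distrib_left mult.commute)
  then show "fst m + s \<ge> 0" "snd m + q \<ge> 0"
    using dt_pos by (simp_all add: zero_less_mult_iff)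
qed

text \<open>Here \<open>t\<^sub>1\<close> or \<open>t\<^sub>2\<close> may be 0, but then the exponent of that variable in the denominator of \<open>X\<close> or \<open>Y\<close>
  is 0 as well, so the fractions may still be expanded.\<close>

lemma kernel_term_closed_form:
  assumes m: "m \<in> R" and z: "z \<in> U" and w: "w \<in> U"
  defines "t1 \<equiv> fst z * cnj (fst w)" and "t2 \<equiv> snd z * cnj (snd w)"
  shows "kernel_term m z w = eval_int_poly2 (numerator_term m) t1 t2 / ((t2 ^ q - t1 ^ p)\<^sup>2 * (t1 ^ s - t2 ^ r)\<^sup>2)"
proof -
  have t1: "t1 = 0 \<Longrightarrow> s = 0" and t2: "t2 = 0 \<Longrightarrow> q = 0"
    using U_fst_zero[OF z] U_fst_zero[OF w] U_snd_zero[OF z] U_snd_zero[OF w] by (auto simp: t1_def t2_def)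
  then have ne: "t1 ^ s \<noteq> 0" "t2 ^ q \<noteq> 0"
    by (auto simp: power_0_left)
  have zmon_t: "zmon n z * cnj (zmon n w) = zmon n (t1, t2)" for n
    by (simp add: zmon_def t1_def t2_def power_int_mult_distrib)
  have X: "X z * cnj (X w) = t1 ^ p / t2 ^ q" and Y: "Y z * cnj (Y w) = t2 ^ r / t1 ^ s"
    unfolding X_def Y_def zmon_t by (simp_all add: zmon_def power_int_minus field_simps)
  have powi: "x powi k * x ^ n = x ^ nat (k + int n)" if "x = 0 \<Longrightarrow> n = 0" "k + int n \<ge> 0" for x :: complex and k n
  proof (cases "x = 0")
    case True
    then show ?thesis using that by (simp add: power_int_def)
  next
    case False
    then have "x powi k * x ^ n = x powi (k + int n)"
      by (simp add: power_int_add)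
    then show ?thesis using that by (simp add: power_int_def)
  qed
  have "zmon m (t1, t2) * t1 ^ s * t2 ^ q = (t1 powi fst m * t1 ^ s) * (t2 powi snd m * t2 ^ q)"
    by (simp add: zmon_def mult_ac)
  also have "\<dots> = t1 ^ nat (fst m + s) * t2 ^ nat (snd m + q)"
    using powi[OF t1 R_exponents(1)[OF m]] powi[OF t2 R_exponents(2)[OF m]] by simp
  finally have exps: "zmon m (t1, t2) * t1 ^ s * t2 ^ q = t1 ^ nat (fst m + s) * t2 ^ nat (snd m + q)" .
  have rearrange: "x * (y * a) * (v * b) = (x * v * y) * a * b" for x y a v b :: complex
    by (simp only: mult_ac)
  have "zmon m (t1, t2) * (t2 ^ q * (of_int (al m) * t2 ^ q + of_int (dt - al m) * t1 ^ p)) *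
      (t1 ^ s * (of_int (be m) * t1 ^ s + of_int (dt - be m) * t2 ^ r)) = eval_int_poly2 (numerator_term m) t1 t2"
    unfolding eval_numerator_term rearrange exps ..
  moreover have "kernel_term m z w = zmon m (t1, t2) * (t2 ^ q * (of_int (al m) * t2 ^ q + of_int (dt - al m) * t1 ^ p)) *
      (t1 ^ s * (of_int (be m) * t1 ^ s + of_int (dt - be m) * t2 ^ r)) / ((t2 ^ q - t1 ^ p)\<^sup>2 * (t1 ^ s - t2 ^ r)\<^sup>2)"
    unfolding kernel_term_def zmon_t X Y ag_sum_divide[OF ne(1)] ag_sum_divide[OF ne(2)] by simp
  ultimately show ?thesis by simp
qed

lemma bergman_kernel_closed_form:
  assumes z: "z \<in> U" and w: "w \<in> U"
  defines "t1 \<equiv> fst z * cnj (fst w)" and "t2 \<equiv> snd z * cnj (snd w)"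
  shows "bergman_kernel U z w = 1 / (of_real pi ^ 2 * of_int dt) *
    (eval_int_poly2 (\<Sum>m\<in>R. numerator_term m) t1 t2 / ((t2 ^ q - t1 ^ p)\<^sup>2 * (t1 ^ s - t2 ^ r)\<^sup>2))"
proof -
  have "bergman_kernel U z w = kernel z w"
    by (rule bergman_kernel_eqI[OF is_bergman_kernel_kernel z w])
  also have "\<dots> = 1 / (of_real pi ^ 2 * of_int dt) * (\<Sum>m\<in>R. eval_int_poly2 (numerator_term m) t1 t2 / ((t2 ^ q - t1 ^ p)\<^sup>2 * (t1 ^ s - t2 ^ r)\<^sup>2))"
    unfolding kernel_def t1_def t2_def
    by (intro arg_cong2[where f = "(*)"] sum.cong kernel_term_closed_form z w) simp_all
  finally show ?thesis
    by (simp only: eval_int_poly2_sum sum_divide_distrib)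
qed

end

section \<open>Bounded monomial polyhedra\<close>

lemma det_2x2: "det (B :: int^2^2) = B$1$1 * B$2$2 - B$1$2 * B$2$1"
  by (rule det_2)

lemma bounded_on_quadrant_imp_nonpos:
  fixes a b :: int and M :: real
  assumes "\<And>(u :: real) (v :: real). u > 0 \<Longrightarrow> v > 0 \<Longrightarrow> a * u + b * v \<le> M"
  shows "a \<le> 0" "b \<le> 0"
proof -
  have *: "a \<le> 0" if h: "\<And>(u :: real) (v :: real). u > 0 \<Longrightarrow> v > 0 \<Longrightarrow> a * u + b * v \<le> M" for a b :: int
  proof (rule ccontr)
    assume "\<not> a \<le> 0"
    \<comment> \<open>Evaluate at \<open>(K, 1)\<close> with \<open>K\<close> so large that \<open>a \<ge> 1\<close> would exceed the bound.\<close>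
    define K where "K = \<bar>M\<bar> + \<bar>real_of_int b\<bar> + 1"
    have K: "K > 0" by (simp add: K_def add_nonneg_pos)
    have "1 * K \<le> a * K"
      using \<open>\<not> a \<le> 0\<close> K by (intro mult_right_mono) auto
    moreover have "a * K + real_of_int b * 1 \<le> M"
      by (rule h) (simp_all add: K)
    moreover have "\<bar>M\<bar> + \<bar>real_of_int b\<bar> < K"
      by (simp add: K_def)
    ultimately show False by linarith
  qed
  show "a \<le> 0" by (rule *[OF assms])
  show "b \<le> 0" by (rule *[of b a]) (use assms in \<open>simp add: add.commute\<close>)
qed

lemma exp_in_monomial_polyhedron:
  fixes B :: "int^2^2" and x1 x2 :: real
  assumes "B$1$1 * x1 + B$1$2 * x2 < 0" "B$2$1 * x1 + B$2$2 * x2 < 0"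
  shows "(of_real (exp x1), of_real (exp x2)) \<in> monomial_polyhedron B"
proof -
  have powi: "exp x powi k = exp (of_int k * x)" for x :: real and k
    by (simp add: exp_power_int mult.commute)
  show ?thesis
    using assms by (auto simp: monomial_polyhedron_def forall_2 powi exp_add[symmetric])
qed

text \<open>The vector tested here is the adjugate matrix applied to \<open>(- u, - v)\<close>.\<close>

lemma adjugate_halfplanes:
  fixes a b c d u v :: real
  assumes "a * d - b * c > 0" "u > 0" "v > 0"
  shows "a * ((- d) * u + b * v) + b * (c * u + (- a) * v) < 0"
    and "c * ((- d) * u + b * v) + d * (c * u + (- a) * v) < 0"
proof -
  have "a * ((- d) * u + b * v) + b * (c * u + (- a) * v) = - ((a * d - b * c) * u)"
    "c * ((- d) * u + b * v) + d * (c * u + (- a) * v) = - ((a * d - b * c) * v)"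
    by (simp_all add: algebra_simps)
  then show "a * ((- d) * u + b * v) + b * (c * u + (- a) * v) < 0"
    and "c * ((- d) * u + b * v) + d * (c * u + (- a) * v) < 0"
    using mult_pos_pos[OF assms(1,2)] mult_pos_pos[OF assms(1,3)] by simp_all
qed

text \<open>In logarithmic coordinates the domain is \<open>B x < 0\<close>, the image of the negative quadrant under
  the inverse of \<open>B\<close>; it is bounded above only if that inverse has no negative entry.\<close>

lemma bounded_monomial_polyhedron_signs:
  fixes B :: "int^2^2"
  assumes det: "det B > 0" and bdd: "bounded (monomial_polyhedron B)"
  shows "B$1$1 > 0" "B$2$2 > 0" "B$1$2 \<le> 0" "B$2$1 \<le> 0"
proof -
  obtain M where M: "\<And>z. z \<in> monomial_polyhedron B \<Longrightarrow> norm z \<le> M"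
    using bdd by (auto simp: bounded_iff)
  have bound: "x1 \<le> M \<and> x2 \<le> M" if "B$1$1 * x1 + B$1$2 * x2 < 0" "B$2$1 * x1 + B$2$2 * x2 < 0" for x1 x2 :: real
  proof -
    have n: "norm (complex_of_real (exp x1), complex_of_real (exp x2)) \<le> M"
      by (intro M exp_in_monomial_polyhedron that)
    have "exp x1 \<le> M" "exp x2 \<le> M"
      using order_trans[OF norm_fst_le n] order_trans[OF norm_snd_le n] by auto
    then show ?thesis
      using exp_ge_add_one_self[of x1] exp_ge_add_one_self[of x2] by linarith
  qed
  have adj: "(- B$2$2) * u + B$1$2 * v \<le> M \<and> B$2$1 * u + (- B$1$1) * v \<le> M" if "u > 0" "v > 0" for u v :: real
  proof (rule bound)
    have "0 < real_of_int (B$1$1) * real_of_int (B$2$2) - real_of_int (B$1$2) * real_of_int (B$2$1)"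
      using det unfolding det_2x2 of_int_mult[symmetric] of_int_diff[symmetric] of_int_0_less_iff .
    note adjugate_halfplanes[OF this that]
    then show "B$1$1 * ((- B$2$2) * u + B$1$2 * v) + B$1$2 * (B$2$1 * u + (- B$1$1) * v) < 0"
      "B$2$1 * ((- B$2$2) * u + B$1$2 * v) + B$2$2 * (B$2$1 * u + (- B$1$1) * v) < 0"
      by (simp_all only: of_int_minus)
  qed
  have "- B$2$2 \<le> 0" "B$1$2 \<le> 0"
    by (rule bounded_on_quadrant_imp_nonpos[OF adj[THEN conjunct1]]; assumption)+
  moreover have "B$2$1 \<le> 0" "- B$1$1 \<le> 0"
    by (rule bounded_on_quadrant_imp_nonpos[OF adj[THEN conjunct2]]; assumption)+
  ultimately have le: "B$1$1 \<ge> 0" "B$2$2 \<ge> 0" "B$1$2 \<le> 0" "B$2$1 \<le> 0"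
    by auto
  then show "B$1$2 \<le> 0" "B$2$1 \<le> 0" by auto
  have "B$1$2 * B$2$1 \<ge> 0" using le by (simp add: mult_nonpos_nonpos)
  then have "B$1$1 * B$2$2 > 0" using det by (simp add: det_2x2)
  then show "B$1$1 > 0" "B$2$2 > 0" using le by (auto simp: zero_less_mult_iff)
qed

text \<open>Up to the order of its entries a row of \<open>B\<close> has the form \<open>(g p, - g q)\<close>, and taking \<open>g\<close>-th powers preserves the inequality. The
  side condition for \<open>c = 0\<close> excludes exactly the points at which \<open>c ^ q = 0\<close>.\<close>

lemma monomial_inequality_iff:
  fixes a c :: real and g :: int and p q :: nat
  assumes "a \<ge> 0" "c \<ge> 0" "g > 0"
  shows "(c = 0 \<longrightarrow> - (g * int q) \<ge> 0) \<and> a powi (g * int p) * c powi (- (g * int q)) < 1 \<longleftrightarrow> a ^ p < c ^ q"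
proof -
  have pw: "x powi (g * int n) = (x ^ n) ^ nat g" for x :: real and n
  proof -
    have "nat (g * int n) = n * nat g"
      using assms(3) by (simp add: nat_mult_distrib mult.commute)
    then show ?thesis
      using assms(3) by (simp add: power_int_def power_mult)
  qed
  show ?thesis
  proof (cases "c ^ q = 0")
    case True
    then have "c = 0" "q > 0" by auto
    then show ?thesis using assms by (auto simp: mult_le_0_iff not_less power_0_left)
  next
    case False
    then have pos: "c ^ q > 0"
      using zero_le_power[OF assms(2), of q] by linarith
    have "c = 0 \<longrightarrow> q = 0" using False by auto
    moreover have "a powi (g * int p) * c powi (- (g * int q)) = (a ^ p) ^ nat g / (c ^ q) ^ nat g"
      unfolding power_int_minus pw by (simp add: divide_inverse)
    moreover have "(a ^ p) ^ nat g / (c ^ q) ^ nat g < 1 \<longleftrightarrow> (a ^ p) ^ nat g < (c ^ q) ^ nat g"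
      by (rule divide_less_eq_1_pos[OF zero_less_power[OF pos]])
    moreover have "(a ^ p) ^ nat g < (c ^ q) ^ nat g \<longleftrightarrow> a ^ p < c ^ q"
      using assms pos by (auto intro: power_strict_mono dest: power_less_imp_less_base)
    ultimately show ?thesis by auto
  qed
qed

lemma monomial_polyhedron_eq_wedge:
  fixes B :: "int^2^2"
  assumes "g1 > 0" "g2 > 0" "B$1$1 = g1 * int p" "B$1$2 = - (g1 * int q)" "B$2$2 = g2 * int r" "B$2$1 = - (g2 * int s)"
    and "monomial_wedge p q r s"
  shows "monomial_polyhedron B = monomial_wedge.U p q r s"
proof -
  interpret monomial_wedge p q r s by fact
  have "(z1, z2) \<in> monomial_polyhedron B \<longleftrightarrow>
      ((cmod z2 = 0 \<longrightarrow> - (g1 * int q) \<ge> 0) \<and> cmod z1 powi (g1 * int p) * cmod z2 powi (- (g1 * int q)) < 1) \<and>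
      ((cmod z1 = 0 \<longrightarrow> - (g2 * int s) \<ge> 0) \<and> cmod z2 powi (g2 * int r) * cmod z1 powi (- (g2 * int s)) < 1)" for z1 z2
    using assms(1,2) unfolding monomial_polyhedron_def by (auto simp: forall_2 assms(3-6) mult.commute)
  also have "\<dots> z1 z2 \<longleftrightarrow> (z1, z2) \<in> U" for z1 z2
    unfolding monomial_inequality_iff[OF norm_ge_zero norm_ge_zero assms(1)]
      monomial_inequality_iff[OF norm_ge_zero norm_ge_zero assms(2)] by (simp add: U_def)
  finally show ?thesis by auto
qed

theorem theorem1:
  fixes A B :: "int^2^2"
  assumes "det B > 0"
    and "bounded (monomial_polyhedron B)"
    and "A = vector
           [vector [B$2$2 div gcd (B$2$2) (B$2$1), (- B$1$2) div gcd (B$1$2) (B$1$1)],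
            vector [(- B$2$1) div gcd (B$2$2) (B$2$1), B$1$1 div gcd (B$1$2) (B$1$1)]]"
  shows "\<exists>g :: int poly poly. \<forall>z1 z2 w1 w2.
           (z1, z2) \<in> monomial_polyhedron B \<longrightarrow> (w1, w2) \<in> monomial_polyhedron B \<longrightarrow>
           (let t1 = z1 * cnj w1; t2 = z2 * cnj w2 in
             bergman_kernel (monomial_polyhedron B) (z1, z2) (w1, w2) =
               1 / (of_real pi ^ 2 * of_int (det A)) *
               (eval_int_poly2 g t1 t2 /
                 ((t2 powi (A$1$2) - t1 powi (A$2$2))\<^sup>2 * (t1 powi (A$2$1) - t2 powi (A$1$1))\<^sup>2)))"
proof -
  note sg = bounded_monomial_polyhedron_signs[OF assms(1,2)]
  define g1 g2 where "g1 = gcd (B$1$2) (B$1$1)" and "g2 = gcd (B$2$2) (B$2$1)"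
  define p q r s where "p = nat (B$1$1 div g1)" and "q = nat ((- B$1$2) div g1)"
    and "r = nat (B$2$2 div g2)" and "s = nat ((- B$2$1) div g2)"
  have g_pos: "g1 > 0" "g2 > 0"
    using sg(1,2) unfolding g1_def g2_def gcd_pos_int by simp_all
  have nonneg: "B$1$1 div g1 \<ge> 0" "(- B$1$2) div g1 \<ge> 0" "B$2$2 div g2 \<ge> 0" "(- B$2$1) div g2 \<ge> 0"
    using sg g_pos by (simp_all add: pos_imp_zdiv_nonneg_iff)
  have dvd: "g1 dvd B$1$1" "g1 dvd - B$1$2" "g2 dvd B$2$2" "g2 dvd - B$2$1"
    by (simp_all add: g1_def g2_def)
  have B: "B$1$1 = g1 * int p" "B$1$2 = - (g1 * int q)" "B$2$2 = g2 * int r" "B$2$1 = - (g2 * int s)"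
    using dvd nonneg by (simp_all add: p_def q_def r_def s_def)
  have A: "A$1$1 = int r" "A$1$2 = int q" "A$2$1 = int s" "A$2$2 = int p"
    using nonneg by (simp_all add: assms(3) p_def q_def r_def s_def flip: g1_def g2_def)
  have "det B = g1 * g2 * (int p * int r - int q * int s)"
    by (simp add: det_2x2 B algebra_simps)
  then have "0 < g1 * g2 * (int p * int r - int q * int s)"
    using assms(1) by (simp only:)
  then have "0 < int p * int r - int q * int s"
    by (rule zero_less_mult_pos[OF _ mult_pos_pos[OF g_pos]])
  then have "int q * int s < int p * int r"
    by simp
  then have "q * s < p * r"
    by (simp only: of_nat_mult[symmetric] of_nat_less_iff)
  then interpret monomial_wedge p q r s by unfold_locales
  have U: "monomial_polyhedron B = U"
    by (rule monomial_polyhedron_eq_wedge[OF g_pos B monomial_wedge_axioms])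
  have detA: "det A = dt"
    by (simp add: det_2x2 A dt_def mult.commute)
  show ?thesis
    unfolding U detA A Let_def power_int_of_nat
    using bergman_kernel_closed_form by (intro exI[of _ "\<Sum>m\<in>R. numerator_term m"]) auto
qed

end
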